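(* Let $p,q\ge 0$ with $p+q=1$ and $0<\tau:=p/q<1$. Let $m,n\ge 1$. For $x\in \mathbb{W}_n^-$ and $y\in\mathbb{W}_m^+$ put $$H(x,y)=\prod_{j=1}^n\prod_{i=1}^m \tau^{\theta(x_j-y_i)},$$ where $\theta(u)=1$ for $u>0$ and $\theta(u)=0$ for $u\le 0$. Then for every $t\ge 0$ and pointwise for all $(x,y)\in \mathbb{W}_n^-\times\mathbb{W}_m^+$, $$\mathbb{E}_x\big(H(x(t),y)\big)=\mathbb{E}_y\big(H(x,y(t))\big).$$
   Context: $\mathbb{W}_m^+=\{y\in\mathbb{R}^m: y_1\le\dots\le y_m\}$ and $\mathbb{W}_n^-=\{x\in\mathbb{R}^n: x_n\le\dots\le x_1\}$. The process $y(t)\in\mathbb{W}_m^+$ (Brownian motions with point interaction, or oblique reflection) started at $y$ is the unique strong solution of $y_j(t)=y_j+B_j(t)-p\Lambda^{(j,j+1)}(t)+q\Lambda^{(j-1,j)}(t)$, $j=1,\dots,m$, where $B_1,\dots,B_m$ are independent standard Brownian motions, $\Lambda^{(j,j+1)}(t)=L^{y_{j+1}-y_j}(t,0)$ is the right-sided local time at $0$ accumulated on $[0,t]$ by the nonnegative semimartingale $y_{j+1}-y_j$, and $\Lambda^{(0,1)}=\Lambda^{(m,m+1)}=0$. $\mathbb{E}_y$ denotes expectation for this process started at $y$. The dual process $x(t)\in\mathbb{W}_n^-$ started at $x$ has the same dynamics with the roles of $p$ and $q$ interchanged: $x_j(t)=x_j+B_j(t)+p\Lambda^{(j,j+1)}(t)-q\Lambda^{(j-1,j)}(t)$,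 $j=1,\dots,n$, with $\Lambda^{(j,j+1)}(t)=L^{x_j-x_{j+1}}(t,0)$ the right-sided local time at $0$ of $x_j-x_{j+1}$ and $\Lambda^{(0,1)}=\Lambda^{(n,n+1)}=0$ (so $x_j$ is pushed right with fraction $p$ of the local time when meeting its left neighbour and left with fraction $q$ when meeting its right neighbour); $\mathbb{E}_x$ denotes expectation for this process started at $x$. *)

theory Defs
  imports "HOL-Probability.Probability"
begin

definition weyl_plus :: "nat \<Rightarrow> (nat \<Rightarrow> real) \<Rightarrow> bool" where
  "weyl_plus m y \<longleftrightarrow> (\<forall>i. 1 \<le> i \<and> i < m \<longrightarrow> y i \<le> y (Suc i))"

definition weyl_minus :: "nat \<Rightarrow> (nat \<Rightarrow> real) \<Rightarrow> bool" where
  "weyl_minus n x \<longleftrightarrow> (\<forall>j. 1 \<le> j \<and> j < n \<longrightarrow> x (Suc j) \<le> x j)"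

definition theta :: "real \<Rightarrow> nat" where
  "theta u = (if u > 0 then 1 else 0)"

definition H :: "real \<Rightarrow> nat \<Rightarrow> nat \<Rightarrow> (nat \<Rightarrow> real) \<Rightarrow> (nat \<Rightarrow> real) \<Rightarrow> real" where
  "H \<tau> n m x y = (\<Prod>j\<in>{1..n}. \<Prod>i\<in>{1..m}. \<tau> ^ theta (x j - y i))"

definition indep_std_BMs :: "'a measure \<Rightarrow> nat set \<Rightarrow> (nat \<Rightarrow> real \<Rightarrow> 'a \<Rightarrow> real) \<Rightarrow> bool" where
  "indep_std_BMs M J B \<longleftrightarrow> prob_space M \<and>
     (\<forall>j\<in>J. \<forall>t\<ge>0. B j t \<in> borel_measurable M) \<and>
     (AE \<omega> in M. \<forall>j\<in>J. B j 0 \<omega> = 0 \<and> continuous_on {0..} (\<lambda>t. B j t \<omega>)) \<and>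
     (\<forall>(ts :: nat \<Rightarrow> real) (N :: nat). ts 0 = 0 \<and> (\<forall>k<N. ts k < ts (Suc k)) \<longrightarrow>
        prob_space.indep_vars M (\<lambda>_. borel)
          (\<lambda>(j, k) \<omega>. B j (ts (Suc k)) \<omega> - B j (ts k) \<omega>) (J \<times> {..<N}) \<and>
        (\<forall>j\<in>J. \<forall>k<N. distributed M lborel (\<lambda>\<omega>. B j (ts (Suc k)) \<omega> - B j (ts k) \<omega>)
                        (normal_density 0 (sqrt (ts (Suc k) - ts k)))))"

text \<open>Path-level characterisation of the collision local time Lambda of a nonnegative gap
  process Z at 0 (Skorokhod condition): Lambda(0) = 0, Lambda continuous and nondecreasing,
  Z stays nonnegative and Lambda increases only at times when Z = 0.\<close>
definition collision_local_time :: "(real \<Rightarrow> real) \<Rightarrow> (real \<Rightarrow> real) \<Rightarrow> bool" where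
  "collision_local_time \<Lambda> Z \<longleftrightarrow> \<Lambda> 0 = 0 \<and> continuous_on {0..} \<Lambda> \<and> mono_on {0..} \<Lambda> \<and>
     (\<forall>t\<ge>0. Z t \<ge> 0) \<and>
     (\<forall>s t. 0 \<le> s \<and> s \<le> t \<and> \<Lambda> s < \<Lambda> t \<longrightarrow> (\<exists>u\<in>{s..t}. Z u = 0))"

definition BMPI_up :: "real \<Rightarrow> real \<Rightarrow> nat \<Rightarrow> (nat \<Rightarrow> real) \<Rightarrow> (nat \<Rightarrow> real \<Rightarrow> 'a \<Rightarrow> real)
     \<Rightarrow> (nat \<Rightarrow> real \<Rightarrow> 'a \<Rightarrow> real) \<Rightarrow> (nat \<Rightarrow> real \<Rightarrow> 'a \<Rightarrow> real) \<Rightarrow> 'a \<Rightarrow> bool" where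
  "BMPI_up p q m y0 B Y L \<omega> \<longleftrightarrow>
     (\<forall>j\<in>{1..m}. \<forall>t\<ge>0. Y j t \<omega> = y0 j + B j t \<omega>
        - p * (if j < m then L j t \<omega> else 0) + q * (if 1 < j then L (j - 1) t \<omega> else 0)) \<and>
     (\<forall>j\<in>{1..<m}. collision_local_time (\<lambda>t. L j t \<omega>) (\<lambda>t. Y (Suc j) t \<omega> - Y j t \<omega>))"

definition BMPI_down :: "real \<Rightarrow> real \<Rightarrow> nat \<Rightarrow> (nat \<Rightarrow> real) \<Rightarrow> (nat \<Rightarrow> real \<Rightarrow> 'a \<Rightarrow> real)
     \<Rightarrow> (nat \<Rightarrow> real \<Rightarrow> 'a \<Rightarrow> real) \<Rightarrow> (nat \<Rightarrow> real \<Rightarrow> 'a \<Rightarrow> real) \<Rightarrow> 'a \<Rightarrow> bool" where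
  "BMPI_down p q n x0 B X L \<omega> \<longleftrightarrow>
     (\<forall>j\<in>{1..n}. \<forall>t\<ge>0. X j t \<omega> = x0 j + B j t \<omega>
        + p * (if j < n then L j t \<omega> else 0) - q * (if 1 < j then L (j - 1) t \<omega> else 0)) \<and>
     (\<forall>j\<in>{1..<n}. collision_local_time (\<lambda>t. L j t \<omega>) (\<lambda>t. X j t \<omega> - X (Suc j) t \<omega>))"

end

theory Submission
  imports Defs
begin

text \<open>With \<open>w = - y\<close> both processes follow the same one-sided dynamics, and
  \<open>H(x, y) = G\<^sub>0(x, w)\<close> with \<open>G\<^sub>c(x, w) = (\<Prod>j. \<Prod>i. \<tau> ^ \<theta>(x\<^sub>j + w\<^sub>i - c))\<close> symmetric in the
  two arguments. Both processes are approximated, along the Brownian paths themselves, by walks with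
  step size \<open>h\<close> whose increments are cut off at \<open>r\<close> and which are reflected after each step; the
  Lipschitz property of the Skorokhod map gives pathwise convergence.

  Averaging \<open>G\<^sub>c\<close> over \<open>c\<close> with a tent function gives a Lipschitz function \<open>\<phi>(x, w)\<close>. The error of
  exchanging one step of \<open>x\<close> for one step of \<open>w\<close> vanishes if no two particles of the same system are
  within \<open>2r\<close>, is \<open>O(r\<^sup>2)\<close> if the values \<open>x\<^sub>j + w\<^sub>i\<close> do not nearly coincide for index pairs
  differing in both components (this is where \<open>\<tau> = p / q\<close> enters), and is \<open>O(r)\<close> always. A discrete
  Tanaka formula bounds the time that a difference of two particles spends in an interval of length
  \<open>O(r)\<close> by \<open>O(r)\<close>. Summing over pairs of times of the two independent walks, which amounts to
  averaging over the final time, the total error is \<open>O(r\<^sup>3 / h)\<close>, which tends to 0 for a suitable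
  choice of \<open>r\<close>. Continuity in time removes the average; letting the tent shrink to \<open>0\<close> from the
  right recovers \<open>H\<close> pointwise, since \<open>\<theta>\<close> is left-continuous.\<close>

section \<open>Oblique reflection and the Skorokhod problem\<close>

text \<open>The obstacle is the corner where two neighbours of one system collide while two sums x_j
  + w_i differing in both indices nearly agree: another sum may then separate the two neighbouring
  ones, their weights need not have ratio \<tau>, and the first-order pushing terms need not cancel.
  Such configurations have codimension two. To exploit this with occupation estimates for single
  differences, the times k and l of the two walks must range independently, each contributing a
  factor O(r); a single antidiagonal k + l = K, the usual path of a duality argument, does not
  separate the two sums. Against the double time sum weighted by h^2, an error O(r) with weight
  O(r^2) and an error O(r^2) with weight O(r) both give r^3; keeping a single time average costs
  1/h. On the other side r must be large against sqrt h, so that truncation is eventually invisible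
  on a Brownian path. The choice r = h^(3/8) meets both demands. The inequality p < q enters
  quantitatively: f(j) = j satisfies q f(j - 1) + p f(j + 1) = f(j) - (q - p), and this defect is
  the origin of the constants with denominator q - p.\<close>

locale oblique =
  fixes p q :: real
  assumes p_pos: "0 < p" and p_less_q: "p < q" and p_q_sum: "p + q = 1"
begin

lemma q_pos: "0 < q" and p_less_1: "p < 1" and q_less_1: "q < 1" and q_minus_p: "0 < q - p"
  using p_pos p_less_q p_q_sum by linarith+

text \<open>The pushing terms of one reflection step solve a linear complementarity problem; their least
  solution is the limit of a monotone iteration.\<close>
primrec push_iter :: "nat \<Rightarrow> (nat \<Rightarrow> real) \<Rightarrow> nat \<Rightarrow> nat \<Rightarrow> real" where
  "push_iter n v 0 = (\<lambda>j. 0)"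
| "push_iter n v (Suc k) = (\<lambda>j. if j \<in> {1..<n}
     then max 0 (v (Suc j) - v j + q * push_iter n v k (j - 1) + p * push_iter n v k (Suc j)) else 0)"

definition push :: "nat \<Rightarrow> (nat \<Rightarrow> real) \<Rightarrow> nat \<Rightarrow> real" where
  "push n v j = lim (\<lambda>k. push_iter n v k j)"

text \<open>Since p + q = 1, the push at \<open>j\<close> opens the gap between \<open>j\<close> and
  \<open>Suc j\<close> by exactly its own size. Indices 0 and \<open>n\<close> carry no push, so the
  extreme particles need no special case. The restriction makes the result a point of the product
  space over \<open>{1..n}\<close>.\<close>

definition reflect :: "nat \<Rightarrow> (nat \<Rightarrow> real) \<Rightarrow> nat \<Rightarrow> real" where
  "reflect n v = (\<lambda>j\<in>{1..n}. v j + p * push n v j - q * push n v (j - 1))"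

lemma push_iter_nonneg: "0 \<le> push_iter n v k j"
  by (cases k) auto

lemma push_iter_outside: "j \<notin> {1..<n} \<Longrightarrow> push_iter n v k j = 0"
  by (cases k) auto

lemma push_iter_mono: "push_iter n v k j \<le> push_iter n v (Suc k) j"
proof (induction k arbitrary: j)
  case 0
  then show ?case by (auto simp: push_iter_nonneg)
next
  case (Suc k)
  have "q * push_iter n v k (j - 1) + p * push_iter n v k (Suc j)
      \<le> q * push_iter n v (Suc k) (j - 1) + p * push_iter n v (Suc k) (Suc j)"
    using Suc.IH less_imp_le[OF q_pos] less_imp_le[OF p_pos] by (intro add_mono mult_left_mono)
  then show ?case
    unfolding push_iter.simps(2)[of n v "Suc k"] push_iter.simps(2)[of n v k, THEN fun_cong, of j]
    by (auto simp del: push_iter.simps)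
qed

text \<open>The linear function c * j with c = D / (q - p) is a supersolution of the recursion: q (j
  - 1) + p (j + 1) = j - (q - p), and the defect absorbs \<open>D\<close>. Being nonnegative, it
  also survives the maximum with 0 and dominates the zero values outside
  \<open>{1..<n}\<close>.\<close>

lemma push_iter_bound:
  assumes "0 \<le> D" and D: "\<And>j. j \<in> {1..<n} \<Longrightarrow> v (Suc j) - v j \<le> D"
  shows "push_iter n v k j \<le> D * j / (q - p)"
proof (induction k arbitrary: j)
  case 0
  then show ?case using q_minus_p \<open>0 \<le> D\<close> by simp
next
  case (Suc k)
  show ?case
  proof (cases "j \<in> {1..<n}")
    case True
    define c where "c = D / (q - p)"
    have c: "0 \<le> c" "D = c * (q - p)"
      using q_minus_p \<open>0 \<le> D\<close> by (auto simp: c_def)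
    have "q * push_iter n v k (j - 1) \<le> q * (c * real (j - 1))"
      using Suc.IH[of "j - 1"] q_pos by (intro mult_left_mono) (auto simp: c_def)
    moreover have "p * push_iter n v k (Suc j) \<le> p * (c * real (Suc j))"
      using Suc.IH[of "Suc j"] p_pos by (intro mult_left_mono) (auto simp: c_def)
    ultimately have "v (Suc j) - v j + q * push_iter n v k (j - 1) + p * push_iter n v k (Suc j)
      \<le> D + q * (c * real (j - 1)) + p * (c * real (Suc j))"
      using D[OF True] by linarith
    also have "\<dots> = (p + q) * (c * j)"
      using True c(2) by (auto simp: algebra_simps of_nat_diff)
    finally have "v (Suc j) - v j + q * push_iter n v k (j - 1) + p * push_iter n v k (Suc j) \<le> c * j"
      by (simp add: p_q_sum)
    then show ?thesis using True mult_nonneg_nonneg[OF c(1), of j] by (simp add: c_def)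
  next
    case False
    then show ?thesis using q_minus_p \<open>0 \<le> D\<close> by (simp add: push_iter_outside del: push_iter.simps)
  qed
qed

lemma push_iter_tendsto: "(\<lambda>k. push_iter n v k j) \<longlonglongrightarrow> push n v j"
proof -
  define D where "D = (\<Sum>j\<in>{1..<n}. \<bar>v (Suc j) - v j\<bar>)"
  have "v (Suc j) - v j \<le> D" if "j \<in> {1..<n}" for j
  proof -
    have "\<bar>v (Suc j) - v j\<bar> \<le> D" unfolding D_def by (rule member_le_sum) (use that in auto)
    then show ?thesis by linarith
  qed
  then have "\<And>k. push_iter n v k j \<le> D * j / (q - p)"
    by (intro push_iter_bound) (auto simp: D_def sum_nonneg)
  then have "bdd_above (range (\<lambda>k. push_iter n v k j))" by (auto intro!: bdd_aboveI)
  moreover have "incseq (\<lambda>k. push_iter n v k j)" by (intro incseq_SucI push_iter_mono)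
  ultimately have "convergent (\<lambda>k. push_iter n v k j)"
    using LIMSEQ_incseq_SUP convergent_def by blast
  then show ?thesis by (simp add: push_def convergent_LIMSEQ_iff)
qed

lemma push_nonneg: "0 \<le> push n v j"
  using push_iter_tendsto by (rule LIMSEQ_le_const) (simp add: push_iter_nonneg)

lemma push_outside: "j \<notin> {1..<n} \<Longrightarrow> push n v j = 0"
  by (simp add: push_def push_iter_outside)

lemma push_bound:
  assumes "0 \<le> D" and "\<And>j. j \<in> {1..<n} \<Longrightarrow> v (Suc j) - v j \<le> D"
  shows "push n v j \<le> D * j / (q - p)"
  using push_iter_tendsto by (rule LIMSEQ_le_const2) (use push_iter_bound[of D n v, OF assms] in auto)

text \<open>The recursion passes to the limit. Read through \<open>reflect_gap\<close>, the maximum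
  says at once that the new gap is nonnegative and that it vanishes wherever the push does
  not.\<close>

lemma push_fixpoint:
  assumes "j \<in> {1..<n}"
  shows "push n v j = max 0 (v (Suc j) - v j + q * push n v (j - 1) + p * push n v (Suc j))"
proof -
  have "(\<lambda>k. push_iter n v (Suc k) j)
      \<longlonglongrightarrow> max 0 (v (Suc j) - v j + q * push n v (j - 1) + p * push n v (Suc j))"
    unfolding push_iter.simps(2) using assms
    by (auto intro!: tendsto_max tendsto_intros push_iter_tendsto)
  moreover have "(\<lambda>k. push_iter n v (Suc k) j) \<longlonglongrightarrow> push n v j"
    using push_iter_tendsto by (rule LIMSEQ_Suc)
  ultimately show ?thesis using LIMSEQ_unique by blast
qed

lemma push_eq_0:
  assumes "weyl_minus n v"
  shows "push n v j = 0"
proof -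
  have "push n v j \<le> (0::real) * j / (q - p)"
    using assms by (intro push_bound) (auto simp: weyl_minus_def)
  then show ?thesis using push_nonneg[of n v j] by simp
qed

lemma reflect_weyl_id: "weyl_minus n v \<Longrightarrow> reflect n v = restrict v {1..n}"
  by (simp add: reflect_def push_eq_0)

lemma reflect_gap:
  assumes "j \<in> {1..<n}"
  shows "reflect n v j - reflect n v (Suc j)
    = v j - v (Suc j) + push n v j - q * push n v (j - 1) - p * push n v (Suc j)"
proof -
  have "p * push n v j + q * push n v j = push n v j"
    using p_q_sum by (metis distrib_right mult_1)
  then show ?thesis using assms by (simp add: reflect_def)
qed

lemma reflect_gap_nonneg: "j \<in> {1..<n} \<Longrightarrow> 0 \<le> reflect n v j - reflect n v (Suc j)"
  using reflect_gap[of j n v] push_fixpoint[of j n v] by linarith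

lemma reflect_gap_eq_0: "j \<in> {1..<n} \<Longrightarrow> push n v j \<noteq> 0 \<Longrightarrow> reflect n v j - reflect n v (Suc j) = 0"
  using reflect_gap[of j n v] push_fixpoint[of j n v] by (simp add: max_def split: if_splits)

lemma reflect_weyl: "weyl_minus n (reflect n v)"
  using reflect_gap_nonneg by (fastforce simp: weyl_minus_def)

text \<open>Where a push acts, the new gap is 0; elsewhere only the neighbouring pushes act, and
  they shrink a gap that stays nonnegative. Hence reflection cannot increase squared gaps.\<close>

lemma reflect_gap_le: "j \<in> {1..<n} \<Longrightarrow> \<bar>reflect n v j - reflect n v (Suc j)\<bar> \<le> \<bar>v j - v (Suc j)\<bar>"
  using reflect_gap[of j n v] reflect_gap_nonneg[of j n v] reflect_gap_eq_0[of j n v]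
    mult_nonneg_nonneg[OF less_imp_le[OF q_pos] push_nonneg[of n v "j - 1"]]
    mult_nonneg_nonneg[OF less_imp_le[OF p_pos] push_nonneg[of n v "Suc j"]]
  by (cases "push n v j = 0") auto

lemma measurable_push_iter [measurable]:
  "(\<lambda>v. push_iter n v k j) \<in> borel_measurable (PiM {1..n} (\<lambda>_. borel))"
proof (induction k arbitrary: j)
  case (Suc k)
  note Suc.IH [measurable]
  show ?case
  proof (cases "j \<in> {1..<n}")
    case True
    then have [measurable]: "(\<lambda>v. v j) \<in> borel_measurable (PiM {1..n} (\<lambda>_. borel :: real measure))"
      "(\<lambda>v. v (Suc j)) \<in> borel_measurable (PiM {1..n} (\<lambda>_. borel :: real measure))"
      by (auto intro!: measurable_component_singleton)
    show ?thesis unfolding push_iter.simps(2) if_P[OF True] by measurable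
  next
    case False
    then show ?thesis unfolding push_iter.simps(2) if_not_P[OF False] by simp
  qed
qed simp

lemma measurable_push [measurable]:
  "(\<lambda>v. push n v j) \<in> borel_measurable (PiM {1..n} (\<lambda>_. borel))"
  using push_iter_tendsto by (rule borel_measurable_LIMSEQ_real) measurable

lemma measurable_reflect [measurable]:
  "reflect n \<in> PiM {1..n} (\<lambda>_. borel) \<rightarrow>\<^sub>M PiM {1..n} (\<lambda>_. borel)"
proof -
  have "(\<lambda>v. v j + p * push n v j - q * push n v (j - 1))
      \<in> borel_measurable (PiM {1..n} (\<lambda>_. borel))" if "j \<in> {1..n}" for j
  proof -
    have [measurable]: "(\<lambda>v. v j) \<in> borel_measurable (PiM {1..n} (\<lambda>_. borel :: real measure))"
      using that by (rule measurable_component_singleton)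
    show ?thesis by measurable
  qed
  then show ?thesis unfolding reflect_def by (intro measurable_restrict) auto
qed

end

text \<open>The complementarity condition is stated through the last zero of the gap before \<open>s\<close>, a form
  that also makes sense for piecewise constant paths.\<close>
definition skorokhod :: "real \<Rightarrow> real \<Rightarrow> nat \<Rightarrow> real \<Rightarrow> (nat \<Rightarrow> real \<Rightarrow> real) \<Rightarrow> (nat \<Rightarrow> real \<Rightarrow> real) \<Rightarrow> bool"
  where "skorokhod p q n T Z L \<longleftrightarrow>
    (\<forall>j s. j \<notin> {1..<n} \<longrightarrow> L j s = 0) \<and>
    (\<forall>j\<in>{1..<n}. mono_on {0..T} (L j) \<and> (\<forall>s\<in>{0..T}. 0 \<le> L j s \<and>
       0 \<le> Z j s + L j s - q * L (j - 1) s - p * L (Suc j) s \<and>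
       (L j s = 0 \<or> (\<exists>u\<in>{0..s}. L j u = L j s \<and>
          Z j u + L j u - q * L (j - 1) u - p * L (Suc j) u = 0))))"

lemma skorokhodD:
  assumes "skorokhod p q n T Z L"
  shows "j \<notin> {1..<n} \<Longrightarrow> L j s = 0"
    and "s \<in> {0..T} \<Longrightarrow> 0 \<le> L j s"
    and "s \<in> {0..T} \<Longrightarrow> u \<in> {0..s} \<Longrightarrow> L j u \<le> L j s"
    and "j \<in> {1..<n} \<Longrightarrow> s \<in> {0..T} \<Longrightarrow> 0 \<le> Z j s + L j s - q * L (j - 1) s - p * L (Suc j) s"
    and "j \<in> {1..<n} \<Longrightarrow> s \<in> {0..T} \<Longrightarrow> L j s \<noteq> 0 \<Longrightarrow>
      \<exists>u\<in>{0..s}. L j u = L j s \<and> Z j u + L j u - q * L (j - 1) u - p * L (Suc j) u = 0"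
proof -
  show out: "L j s = 0" if "j \<notin> {1..<n}" for j s
    using assms that by (simp add: skorokhod_def)
  show "0 \<le> L j s" if "s \<in> {0..T}"
    using assms that out[of j s] by (cases "j \<in> {1..<n}") (auto simp: skorokhod_def)
  show "L j u \<le> L j s" if "s \<in> {0..T}" "u \<in> {0..s}"
  proof (cases "j \<in> {1..<n}")
    case True
    then have "mono_on {0..T} (L j)" using assms by (simp add: skorokhod_def)
    then show ?thesis using that by (auto elim!: mono_onD)
  qed (simp add: out)
  show "0 \<le> Z j s + L j s - q * L (j - 1) s - p * L (Suc j) s" if "j \<in> {1..<n}" "s \<in> {0..T}"
    using assms that unfolding skorokhod_def by blast
  show "\<exists>u\<in>{0..s}. L j u = L j s \<and> Z j u + L j u - q * L (j - 1) u - p * L (Suc j) u = 0"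
    if "j \<in> {1..<n}" "s \<in> {0..T}" "L j s \<noteq> 0"
    using assms that unfolding skorokhod_def by blast
qed

section \<open>Stability of the Skorokhod problem\<close>

context oblique
begin

text \<open>A positive maximum would have a smallest index where it is attained. The left neighbour
  is strictly smaller there, and because q > 0 the weighted mean of the neighbours falls below the
  maximum, against \<open>sub\<close>.\<close>

lemma max_principle:
  fixes w :: "nat \<Rightarrow> real"
  assumes out: "\<And>j. j \<notin> {1..<n} \<Longrightarrow> w j \<le> 0"
    and sub: "\<And>j. j \<in> {1..<n} \<Longrightarrow> w j \<le> q * w (j - 1) + p * w (Suc j)"
  shows "w j \<le> 0"
proof (rule ccontr)
  assume "\<not> w j \<le> 0"
  then have j: "j \<in> {1..<n}" "0 < w j" using out by (meson, linarith)
  define Mx where "Mx = Max (w ` {1..<n})"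
  have le: "w i \<le> Mx" if "i \<in> {1..<n}" for i unfolding Mx_def using that by auto
  have pos: "0 < Mx" using le[OF j(1)] j(2) by linarith
  have le': "w i \<le> Mx" for i using le[of i] out[of i] pos by (cases "i \<in> {1..<n}") auto
  have "Mx \<in> w ` {1..<n}" unfolding Mx_def using j by (intro Max_in) auto
  then have ex: "\<exists>i. i \<in> {1..<n} \<and> w i = Mx" by auto
  define i where "i = (LEAST i. i \<in> {1..<n} \<and> w i = Mx)"
  have i: "i \<in> {1..<n}" "w i = Mx" using LeastI_ex[OF ex] by (auto simp: i_def)
  have "w (i - 1) \<noteq> Mx"
  proof
    assume *: "w (i - 1) = Mx"
    then have "i - 1 \<in> {1..<n}" using out[of "i - 1"] pos by (meson not_le)
    then have "i \<le> i - 1" using * Least_le[of "\<lambda>i. i \<in> {1..<n} \<and> w i = Mx" "i - 1"] by (simp add: i_def)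
    then show False using i by auto
  qed
  then have "w (i - 1) < Mx" using le'[of "i - 1"] by linarith
  then have "q * w (i - 1) + p * w (Suc i) < q * Mx + p * Mx"
    using q_pos p_pos le'[of "Suc i"] by (intro add_less_le_mono) auto
  also have "\<dots> = Mx" using p_q_sum by (metis add.commute distrib_right mult_1)
  finally show False using sub[OF i(1)] i(2) by linarith
qed

text \<open>Comparison at the last zero of the gap before \<open>s\<close>, where the pushing is determined by the
  input and the neighbouring terms.\<close>
lemma skorokhod_compare:
  assumes sk: "skorokhod p q n T Z L" "skorokhod p q n T Z' L'"
    and close: "\<And>j s. j \<in> {1..<n} \<Longrightarrow> s \<in> {0..T} \<Longrightarrow> \<bar>Z j s - Z' j s\<bar> \<le> \<epsilon>"
    and "0 \<le> \<epsilon>" "s \<in> {0..T}"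
  shows "\<bar>L j s - L' j s\<bar> \<le> \<epsilon> * j / (q - p)"
proof -
  have T: "0 \<le> T" and ne: "{0..T} \<noteq> {}" using \<open>s \<in> {0..T}\<close> by auto
  \<comment> \<open>Taking the supremum over time leaves one number per index and turns the
    comparison of paths into a difference inequality in the index.\<close>
  define \<Delta> where "\<Delta> j = (SUP s\<in>{0..T}. \<bar>L j s - L' j s\<bar>)" for j
  have out: "L j s = 0" "L' j s = 0" if "j \<notin> {1..<n}" for j s
    using skorokhodD(1)[OF sk(1) that] skorokhodD(1)[OF sk(2) that] .
  have bdd: "bdd_above ((\<lambda>s. \<bar>L j s - L' j s\<bar>) ` {0..T})" for j
  proof (cases "j \<in> {1..<n}")
    case True
    have "\<bar>L j s - L' j s\<bar> \<le> L j T + L' j T" if "s \<in> {0..T}" for s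
    proof -
      have "0 \<le> L j s" "0 \<le> L' j s" "L j s \<le> L j T" "L' j s \<le> L' j T"
        using skorokhodD(2,3)[OF sk(1)] skorokhodD(2,3)[OF sk(2)] that T by auto
      then show ?thesis by linarith
    qed
    then show ?thesis by (rule bdd_aboveI2)
  next
    case False
    then show ?thesis by (intro bdd_aboveI2[of _ _ 0]) (simp add: out)
  qed
  have up: "\<bar>L j s - L' j s\<bar> \<le> \<Delta> j" if "s \<in> {0..T}" for j s
    unfolding \<Delta>_def by (rule cSUP_upper[OF that bdd])
  \<comment> \<open>Formulated for an arbitrary pair of solutions, because the absolute value needs
    it in both orders.\<close>
  have one_sided: "A j s - A' j s \<le> \<epsilon> + q * \<Delta> (j - 1) + p * \<Delta> (Suc j)"
    if sA: "skorokhod p q n T ZZ A" "skorokhod p q n T ZZ' A'"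
      and cl: "\<And>j s. j \<in> {1..<n} \<Longrightarrow> s \<in> {0..T} \<Longrightarrow> \<bar>ZZ j s - ZZ' j s\<bar> \<le> \<epsilon>"
      and ub: "\<And>j s. s \<in> {0..T} \<Longrightarrow> \<bar>A j s - A' j s\<bar> \<le> \<Delta> j"
      and j: "j \<in> {1..<n}" and s: "s \<in> {0..T}" for A A' ZZ ZZ' j s
  proof -
    have \<Delta>0: "0 \<le> \<Delta> i" for i using ub[OF s, of i] by linarith
    show ?thesis
    proof (cases "A j s = 0")
      case True
      have "0 \<le> A' j s" using skorokhodD(2)[OF sA(2) s] .
      then show ?thesis
        using True \<open>0 \<le> \<epsilon>\<close> mult_nonneg_nonneg[OF less_imp_le[OF q_pos] \<Delta>0[of "j - 1"]]
          mult_nonneg_nonneg[OF less_imp_le[OF p_pos] \<Delta>0[of "Suc j"]] by linarith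
    next
      case False
      then obtain u where u: "u \<in> {0..s}" "A j u = A j s"
        "ZZ j u + A j u - q * A (j - 1) u - p * A (Suc j) u = 0"
        using skorokhodD(5)[OF sA(1) j s] by blast
      have uT: "u \<in> {0..T}" using u(1) s by auto
      \<comment> \<open>\<open>A\<close> has the same value at \<open>u\<close> as at
        \<open>s\<close>, while \<open>A'\<close> can only have grown since \<open>u\<close>; so an
        upper bound for the difference at the zero \<open>u\<close> carries over to
        \<open>s\<close>.\<close>
      have "A' j u \<le> A' j s" using skorokhodD(3)[OF sA(2) s u(1)] .
      moreover have "0 \<le> ZZ' j u + A' j u - q * A' (j - 1) u - p * A' (Suc j) u"
        using skorokhodD(4)[OF sA(2) j uT] .
      moreover have "q * (A (j - 1) u - A' (j - 1) u) \<le> q * \<Delta> (j - 1)"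
        using ub[OF uT, of "j - 1"] q_pos by (intro mult_left_mono) auto
      moreover have "p * (A (Suc j) u - A' (Suc j) u) \<le> p * \<Delta> (Suc j)"
        using ub[OF uT, of "Suc j"] p_pos by (intro mult_left_mono) auto
      moreover have "ZZ' j u - ZZ j u \<le> \<epsilon>" using cl[OF j uT] by linarith
      ultimately show ?thesis using u by (simp add: algebra_simps)
    qed
  qed
  have sub: "\<Delta> j \<le> \<epsilon> + q * \<Delta> (j - 1) + p * \<Delta> (Suc j)" if j: "j \<in> {1..<n}" for j
  proof -
    have "\<bar>L j s - L' j s\<bar> \<le> \<epsilon> + q * \<Delta> (j - 1) + p * \<Delta> (Suc j)" if s: "s \<in> {0..T}" for s
    proof -
      have "L j s - L' j s \<le> \<epsilon> + q * \<Delta> (j - 1) + p * \<Delta> (Suc j)"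
        by (rule one_sided[OF sk close up j s])
      moreover have "L' j s - L j s \<le> \<epsilon> + q * \<Delta> (j - 1) + p * \<Delta> (Suc j)"
        by (rule one_sided[OF sk(2,1) _ _ j s]) (use close up in \<open>auto simp: abs_minus_commute\<close>)
      ultimately show ?thesis by linarith
    qed
    then show ?thesis unfolding \<Delta>_def by (rule cSUP_least[OF ne])
  qed
  \<comment> \<open>Subtracting the supersolution c * j removes the inhomogeneous term \<epsilon>,
    so that \<open>max_principle\<close> applies.\<close>
  define c where "c = \<epsilon> / (q - p)"
  have c: "0 \<le> c" "\<epsilon> = c * (q - p)" using \<open>0 \<le> \<epsilon>\<close> q_minus_p by (auto simp: c_def)
  have "\<Delta> j - c * j \<le> 0"
  proof (rule max_principle[of n "\<lambda>j. \<Delta> j - c * j"])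
    fix j assume "j \<notin> {1..<n}"
    from out[OF this] have "\<Delta> j = 0" using T by (simp add: \<Delta>_def)
    then show "\<Delta> j - c * j \<le> 0" using c(1) by simp
  next
    fix j assume j: "j \<in> {1..<n}"
    have "\<epsilon> + q * (c * (real j - 1)) + p * (c * (real j + 1)) = c * real j"
      unfolding c(2) eq_diff_eq[THEN iffD2, OF p_q_sum] by (simp add: algebra_simps)
    moreover have "real (j - 1) = real j - 1" "real (Suc j) = real j + 1" using j by auto
    ultimately show "\<Delta> j - c * real j
        \<le> q * (\<Delta> (j - 1) - c * real (j - 1)) + p * (\<Delta> (Suc j) - c * real (Suc j))"
      using sub[OF j] by (simp only: right_diff_distrib)
  qed
  then have "\<Delta> j \<le> \<epsilon> * j / (q - p)" by (simp add: c_def)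
  then show ?thesis using up[OF \<open>s \<in> {0..T}\<close>, of j] by linarith
qed

end

section \<open>The mollified duality function\<close>

lemma power_theta: "(\<tau> :: real) ^ theta u = (if 0 < u then \<tau> else 1)"
  unfolding theta_def by simp

definition G :: "real \<Rightarrow> nat \<Rightarrow> nat \<Rightarrow> real \<Rightarrow> (nat \<Rightarrow> real) \<Rightarrow> (nat \<Rightarrow> real) \<Rightarrow> real" where
  "G \<tau> n m c x w = (\<Prod>j\<in>{1..n}. \<Prod>i\<in>{1..m}. \<tau> ^ theta (x j + w i - c))"

lemma G_swap: "G \<tau> n m c x w = G \<tau> m n c w x"
  unfolding G_def by (subst prod.swap) (simp add: add.commute)

lemma G_nonneg: "0 \<le> \<tau> \<Longrightarrow> 0 \<le> G \<tau> n m c x w"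
  by (simp add: G_def prod_nonneg)

lemma G_le_1: "0 \<le> \<tau> \<Longrightarrow> \<tau> \<le> 1 \<Longrightarrow> G \<tau> n m c x w \<le> 1"
  unfolding G_def by (intro prod_le_1 conjI prod_nonneg) (auto simp: power_le_one)

lemma G_Times: "G \<tau> n m c x w = (\<Prod>a\<in>{1..n}\<times>{1..m}. \<tau> ^ theta (x (fst a) + w (snd a) - c))"
  unfolding G_def by (simp add: prod.cartesian_product case_prod_unfold)

lemma G_card:
  "G \<tau> n m c x w = \<tau> ^ card {a \<in> {1..n}\<times>{1..m}. c < x (fst a) + w (snd a)}"
proof -
  have "G \<tau> n m c x w = \<tau> ^ (\<Sum>a\<in>{1..n}\<times>{1..m}. theta (x (fst a) + w (snd a) - c))"
    unfolding G_Times by (simp add: power_sum)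
  also have "(\<Sum>a\<in>{1..n}\<times>{1..m}. theta (x (fst a) + w (snd a) - c))
      = card {a \<in> {1..n}\<times>{1..m}. c < x (fst a) + w (snd a)}"
    by (simp add: theta_def sum.If_cases Int_def)
  finally show ?thesis .
qed

lemma G_cong: "(\<And>j. j \<in> {1..n} \<Longrightarrow> x j = x' j) \<Longrightarrow> (\<And>i. i \<in> {1..m} \<Longrightarrow> w i = w' i)
    \<Longrightarrow> G \<tau> n m c x w = G \<tau> n m c x' w'"
  unfolding G_def by (intro prod.cong refl) auto

text \<open>With peak \<delta> and slopes 1 the Lipschitz constant does not depend on \<delta>; the
  price is a total mass \<delta>^2, which is divided out at the end. The support lies to the right
  of 0 because \<open>theta\<close> takes the value 0 at 0.\<close>

definition tent :: "real \<Rightarrow> real \<Rightarrow> real" where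
  "tent \<delta> c = max 0 (\<delta> - \<bar>c - \<delta>\<bar>)"

lemma tent_nonneg: "0 \<le> tent \<delta> c"
  by (simp add: tent_def)

lemma tent_le: "0 \<le> \<delta> \<Longrightarrow> tent \<delta> c \<le> \<delta>"
  by (simp add: tent_def)

lemma tent_Lipschitz: "\<bar>tent \<delta> c - tent \<delta> c'\<bar> \<le> \<bar>c - c'\<bar>"
  by (auto simp: tent_def max_def abs_if split: if_splits)

lemma tent_eq_0: "c \<notin> {0..2 * \<delta>} \<Longrightarrow> tent \<delta> c = 0"
  by (auto simp: tent_def max_def abs_if split: if_splits)

lemma measurable_tent [measurable]: "tent \<delta> \<in> borel_measurable borel"
  unfolding tent_def by measurable

lemma integrable_tent_mult:
  assumes [measurable]: "g \<in> borel_measurable borel" and g: "\<And>c. \<bar>g c\<bar> \<le> 1" and "0 \<le> \<delta>"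
  shows "integrable lborel (\<lambda>c. tent \<delta> c * g c)"
proof (rule Bochner_Integration.integrable_bound)
  show "integrable lborel (\<lambda>c. \<delta> * indicator {0..2 * \<delta>} c)" using \<open>0 \<le> \<delta>\<close> by simp
  show "AE c in lborel. norm (tent \<delta> c * g c) \<le> norm (\<delta> * indicator {0..2 * \<delta>} c)"
  proof (rule AE_I2)
    fix c
    have "\<bar>tent \<delta> c * g c\<bar> \<le> \<delta> * 1"
      unfolding abs_mult using tent_nonneg[of \<delta> c] tent_le[OF \<open>0 \<le> \<delta>\<close>, of c] g[of c] \<open>0 \<le> \<delta>\<close>
      by (intro mult_mono) auto
    then show "norm (tent \<delta> c * g c) \<le> norm (\<delta> * indicator {0..2 * \<delta>} c)"
      using tent_eq_0[of c \<delta>] \<open>0 \<le> \<delta>\<close> by (auto simp: indicator_def)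
  qed
qed simp

text \<open>An antiderivative of \<open>tent\<close>: averaging the indicator of c < d over the
  level c turns a jump into a function of d with Lipschitz derivative.\<close>

definition tent_int :: "real \<Rightarrow> real \<Rightarrow> real" where
  "tent_int \<delta> d = (\<integral>c. tent \<delta> c * indicator {..<d} c \<partial>lborel)"

lemma tent_int_taylor:
  assumes "0 \<le> \<delta>"
  shows "\<bar>tent_int \<delta> d' - tent_int \<delta> d - tent \<delta> d * (d' - d)\<bar> \<le> 2 * (d' - d)\<^sup>2"
proof -
  \<comment> \<open>The expansion point \<open>e\<close> may be either end of the interval, which
    covers both orders of \<open>d\<close> and \<open>d'\<close>.\<close>
  have *: "\<bar>tent_int \<delta> b - tent_int \<delta> a - tent \<delta> e * (b - a)\<bar> \<le> (b - a)\<^sup>2"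
    if "a \<le> b" and e: "e = a \<or> e = b" for a b e
  proof -
    have i1: "integrable lborel (\<lambda>c. tent \<delta> c * indicator {..<d} c)" for d
      using assms by (intro integrable_tent_mult) (auto simp: indicator_def)
    have "tent_int \<delta> b - tent_int \<delta> a
        = (\<integral>c. tent \<delta> c * indicator {..<b} c - tent \<delta> c * indicator {..<a} c \<partial>lborel)"
      unfolding tent_int_def by (simp add: i1)
    also have "\<dots> = (\<integral>c. indicator {a..<b} c * tent \<delta> c \<partial>lborel)"
      using that by (intro Bochner_Integration.integral_cong refl) (auto simp: indicator_def)
    finally have "tent_int \<delta> b - tent_int \<delta> a = (\<integral>c. indicator {a..<b} c * tent \<delta> c \<partial>lborel)" .
    moreover have "(\<integral>c. indicator {a..<b} c * tent \<delta> e \<partial>lborel) = tent \<delta> e * (b - a)"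
      using that by simp
    moreover have i2: "integrable lborel (\<lambda>c. indicator {a..<b} c * tent \<delta> c)"
      using integrable_tent_mult[of "indicator {a..<b}" \<delta>] assms
      by (simp add: mult.commute indicator_def)
    moreover have i3: "integrable lborel (\<lambda>c. indicator {a..<b} c * tent \<delta> e)"
      using that by simp
    ultimately have "tent_int \<delta> b - tent_int \<delta> a - tent \<delta> e * (b - a)
      = (\<integral>c. indicator {a..<b} c * tent \<delta> c - indicator {a..<b} c * tent \<delta> e \<partial>lborel)"
      using that by simp
    also have "\<bar>\<dots>\<bar> \<le> (\<integral>c. (b - a) * indicator {a..<b} c \<partial>lborel)"
    proof (rule order_trans[OF integral_abs_bound], rule integral_mono)
      show "integrable lborel (\<lambda>c. \<bar>indicator {a..<b} c * tent \<delta> c - indicator {a..<b} c * tent \<delta> e\<bar>)"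
        using i2 i3 by simp
      show "integrable lborel (\<lambda>c. (b - a) * indicator {a..<b} c)" using that by simp
      show "\<bar>indicator {a..<b} c * tent \<delta> c - indicator {a..<b} c * tent \<delta> e\<bar>
          \<le> (b - a) * indicator {a..<b} c" for c
        using tent_Lipschitz[of \<delta> c e] that by (auto simp: indicator_def)
    qed
    also have "\<dots> = (b - a)\<^sup>2" using that by (simp add: power2_eq_square)
    finally show ?thesis .
  qed
  show ?thesis
  proof (cases "d \<le> d'")
    case True
    then show ?thesis using *[of d d' d] by (smt (verit) zero_le_power2)
  next
    case False
    have "tent_int \<delta> d' - tent_int \<delta> d - tent \<delta> d * (d' - d)
        = - (tent_int \<delta> d - tent_int \<delta> d' - tent \<delta> d * (d - d'))" by (simp add: algebra_simps)
    moreover have "(d - d')\<^sup>2 = (d' - d)\<^sup>2" by (simp add: power2_commute)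
    ultimately show ?thesis using *[of d' d d] False by (smt (verit) zero_le_power2)
  qed
qed

definition phi :: "real \<Rightarrow> real \<Rightarrow> nat \<Rightarrow> nat \<Rightarrow> (nat \<Rightarrow> real) \<Rightarrow> (nat \<Rightarrow> real) \<Rightarrow> real" where
  "phi \<delta> \<tau> n m x w = (\<integral>c. tent \<delta> c * G \<tau> n m c x w \<partial>lborel)"

lemma phi_swap: "phi \<delta> \<tau> n m x w = phi \<delta> \<tau> m n w x"
  unfolding phi_def by (subst G_swap) simp

lemma phi_cong: "(\<And>j. j \<in> {1..n} \<Longrightarrow> x j = x' j) \<Longrightarrow> (\<And>i. i \<in> {1..m} \<Longrightarrow> w i = w' i)
    \<Longrightarrow> phi \<delta> \<tau> n m x w = phi \<delta> \<tau> n m x' w'"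
  using G_cong[of n x x' m w w' \<tau>] by (simp add: phi_def)

lemma measurable_G_c [measurable]: "(\<lambda>c. G \<tau> n m c x w) \<in> borel_measurable borel"
  unfolding G_def power_theta by measurable

lemma integrable_phi:
  assumes "0 \<le> \<tau>" "\<tau> \<le> 1" "0 \<le> \<delta>"
  shows "integrable lborel (\<lambda>c. tent \<delta> c * G \<tau> n m c x w)"
  using assms G_nonneg[of \<tau> n m _ x w] G_le_1[of \<tau> n m _ x w] by (intro integrable_tent_mult) auto

text \<open>A product of factors in [0, 1] changes by at most the sum of the changes of its factors.
  The factor of (j, i) changes only for levels between the old and the new value of x_j + w_i, a set
  of length |x_j - x'_j|, and each j occurs with \<open>m\<close> values of i.\<close>

lemma phi_Lipschitz:
  assumes \<tau>: "0 \<le> \<tau>" "\<tau> \<le> 1" and \<delta>: "0 \<le> \<delta>" "\<delta> \<le> 1"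
  shows "\<bar>phi \<delta> \<tau> n m x w - phi \<delta> \<tau> n m x' w\<bar> \<le> real m * (\<Sum>j\<in>{1..n}. \<bar>x j - x' j\<bar>)"
proof -
  let ?A = "{1..n}\<times>{1..m}"
  define lo hi where "lo a = min (x (fst a) + w (snd a)) (x' (fst a) + w (snd a))"
    and "hi a = max (x (fst a) + w (snd a)) (x' (fst a) + w (snd a))" for a
  have lohi: "lo a \<le> hi a" for a by (auto simp: lo_def hi_def)
  have le: "\<bar>tent \<delta> c * G \<tau> n m c x w - tent \<delta> c * G \<tau> n m c x' w\<bar>
      \<le> (\<Sum>a\<in>?A. indicator {lo a..<hi a} c)" for c
  proof -
    have "\<bar>G \<tau> n m c x w - G \<tau> n m c x' w\<bar> \<le>
        (\<Sum>a\<in>?A. \<bar>\<tau> ^ theta (x (fst a) + w (snd a) - c) - \<tau> ^ theta (x' (fst a) + w (snd a) - c)\<bar>)"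
      unfolding G_Times real_norm_def[symmetric]
      by (rule norm_prod_diff) (use \<tau> in \<open>auto simp: power_theta\<close>)
    also have "\<dots> \<le> (\<Sum>a\<in>?A. indicator {lo a..<hi a} c)"
      using \<tau> by (intro sum_mono) (auto simp: power_theta indicator_def lo_def hi_def)
    finally have "\<bar>G \<tau> n m c x w - G \<tau> n m c x' w\<bar> \<le> (\<Sum>a\<in>?A. indicator {lo a..<hi a} c)" .
    moreover have "\<bar>tent \<delta> c\<bar> \<le> 1" using tent_nonneg[of \<delta> c] tent_le[of \<delta> c] \<delta> by simp
    ultimately have "\<bar>tent \<delta> c\<bar> * \<bar>G \<tau> n m c x w - G \<tau> n m c x' w\<bar>
        \<le> 1 * (\<Sum>a\<in>?A. indicator {lo a..<hi a} c)"
      by (intro mult_mono) auto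
    then show ?thesis by (simp add: abs_mult[symmetric] right_diff_distrib)
  qed
  have "\<bar>phi \<delta> \<tau> n m x w - phi \<delta> \<tau> n m x' w\<bar>
      = \<bar>\<integral>c. tent \<delta> c * G \<tau> n m c x w - tent \<delta> c * G \<tau> n m c x' w \<partial>lborel\<bar>"
    unfolding phi_def using integrable_phi[OF \<tau> \<delta>(1)] by simp
  also have "\<dots> \<le> (\<integral>c. (\<Sum>a\<in>?A. indicator {lo a..<hi a} c) \<partial>lborel)"
  proof (rule order_trans[OF integral_abs_bound], rule integral_mono)
    show "integrable lborel (\<lambda>c. \<bar>tent \<delta> c * G \<tau> n m c x w - tent \<delta> c * G \<tau> n m c x' w\<bar>)"
      using integrable_phi[OF \<tau> \<delta>(1)] by simp
    show "integrable lborel (\<lambda>c. \<Sum>a\<in>?A. indicator {lo a..<hi a} c :: real)"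
      by (intro Bochner_Integration.integrable_sum) (simp add: lohi)
  qed (rule le)
  also have "\<dots> = (\<Sum>a\<in>?A. \<bar>x (fst a) - x' (fst a)\<bar>)"
  proof (subst Bochner_Integration.integral_sum)
    show "integrable lborel (indicator {lo a..<hi a} :: real \<Rightarrow> real)" for a
      by (simp add: lohi)
    show "(\<Sum>a\<in>?A. \<integral>c. indicator {lo a..<hi a} c \<partial>lborel) = (\<Sum>a\<in>?A. \<bar>x (fst a) - x' (fst a)\<bar>)"
      by (intro sum.cong refl) (simp add: lohi, auto simp: lo_def hi_def)
  qed
  also have "\<dots> = real m * (\<Sum>j\<in>{1..n}. \<bar>x j - x' j\<bar>)"
  proof -
    have "(\<Sum>a\<in>?A. \<bar>x (fst a) - x' (fst a)\<bar>) = (\<Sum>j\<in>{1..n}. \<Sum>i\<in>{1..m}. \<bar>x j - x' j\<bar>)"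
      by (subst sum.cartesian_product) (simp add: case_prod_unfold)
    then show ?thesis by (simp add: sum_distrib_left)
  qed
  finally show ?thesis .
qed

section \<open>Ordering the sums x_j + w_i and expanding \<open>phi\<close>\<close>

lemma sum_power_card_below:
  fixes \<tau> :: real
  assumes "finite A" "S \<subseteq> A"
    and down: "\<And>a b. a \<in> S \<Longrightarrow> b \<in> A \<Longrightarrow> lt b a \<Longrightarrow> b \<in> S"
    and irr: "\<And>a. \<not> lt a a" and trans: "\<And>a b c. lt a b \<Longrightarrow> lt b c \<Longrightarrow> lt a c"
    and tot: "\<And>a b. a \<in> A \<Longrightarrow> b \<in> A \<Longrightarrow> a \<noteq> b \<Longrightarrow> lt a b \<or> lt b a"
  shows "(\<Sum>a\<in>S. \<tau> ^ card {b \<in> A. lt b a}) = (\<Sum>k<card S. \<tau> ^ k)"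
proof -
  let ?r = "\<lambda>a. card {b \<in> A. lt b a}"
  have fS: "finite S" using assms(1,2) by (rule finite_subset[rotated])
  have less: "?r a < ?r b" if "a \<in> A" "b \<in> A" "lt a b" for a b
  proof (rule psubset_card_mono)
    have "{c \<in> A. lt c a} \<subseteq> {c \<in> A. lt c b}" using trans[OF _ that(3)] by auto
    moreover have "a \<in> {c \<in> A. lt c b}" "a \<notin> {c \<in> A. lt c a}" using that irr by auto
    ultimately show "{c \<in> A. lt c a} \<subset> {c \<in> A. lt c b}" by blast
  qed (use \<open>finite A\<close> in simp)
  \<comment> \<open>The rank is strictly increasing along \<open>lt\<close> and \<open>S\<close> is
    an initial segment of \<open>A\<close>, so the ranks on \<open>S\<close> are exactly the numbers
    below \<open>card S\<close>.\<close>
  have inj: "inj_on ?r S"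
  proof (rule inj_onI)
    fix a b assume "a \<in> S" "b \<in> S" "?r a = ?r b"
    then show "a = b" using less[of a b] less[of b a] tot[of a b] \<open>S \<subseteq> A\<close> by force
  qed
  have "?r ` S \<subseteq> {..<card S}"
  proof safe
    fix a assume a: "a \<in> S"
    have "{b \<in> A. lt b a} \<subseteq> S" using down[OF a] by auto
    moreover have "a \<notin> {b \<in> A. lt b a}" using irr by simp
    ultimately have "{b \<in> A. lt b a} \<subset> S" using a by auto
    then show "?r a < card S" using fS by (simp add: psubset_card_mono)
  qed
  then have "?r ` S = {..<card S}"
    by (intro card_subset_eq) (auto simp: card_image[OF inj])
  then show ?thesis using sum.reindex[OF inj, of "\<lambda>k. \<tau> ^ k"] by (simp add: o_def)
qed

text \<open>Larger sums come first. The tie-break by indices gives a strict total order even when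
  sums coincide, as they do whenever two particles of one system touch. It agrees with the Weyl
  chamber, where smaller indices have larger coordinates, so a tie between sums sharing an index may
  open up and the order stays valid.\<close>

definition before :: "(nat \<Rightarrow> real) \<Rightarrow> (nat \<Rightarrow> real) \<Rightarrow> nat \<times> nat \<Rightarrow> nat \<times> nat \<Rightarrow> bool" where
  "before x w a b \<longleftrightarrow> x (fst b) + w (snd b) < x (fst a) + w (snd a) \<or>
     x (fst b) + w (snd b) = x (fst a) + w (snd a) \<and> (fst a < fst b \<or> fst a = fst b \<and> snd a < snd b)"

definition rank :: "nat \<Rightarrow> nat \<Rightarrow> (nat \<Rightarrow> real) \<Rightarrow> (nat \<Rightarrow> real) \<Rightarrow> nat \<times> nat \<Rightarrow> nat" where
  "rank n m x w a = card {b \<in> {1..n}\<times>{1..m}. before x w b a}"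

lemma before_total: "a \<noteq> b \<Longrightarrow> before x w a b \<or> before x w b a"
  by (auto simp: before_def prod_eq_iff)

text \<open>Since \<open>1 - \<tau> ^ N = (1 - \<tau>) * (\<Sum>k<N. \<tau> ^ k)\<close>, the function \<open>G\<close> is a weighted sum of indicators
  of single differences, with weights depending only on their order; near a configuration without
  coincidences that order is constant and \<open>phi\<close> is smooth.\<close>
lemma phi_rank:
  assumes \<tau>: "0 < \<tau>" "\<tau> < 1" and "0 \<le> \<delta>"
    and compat: "\<And>a b. a \<in> {1..n}\<times>{1..m} \<Longrightarrow> b \<in> {1..n}\<times>{1..m} \<Longrightarrow> before x w a b \<Longrightarrow>
      x' (fst b) + w' (snd b) \<le> x' (fst a) + w' (snd a)"
  shows "phi \<delta> \<tau> n m x' w' = (\<integral>c. tent \<delta> c \<partial>lborel)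
    - (1 - \<tau>) * (\<Sum>a\<in>{1..n}\<times>{1..m}. \<tau> ^ rank n m x w a * tent_int \<delta> (x' (fst a) + w' (snd a)))"
proof -
  let ?A = "{1..n}\<times>{1..m}"
  let ?d = "\<lambda>a. x' (fst a) + w' (snd a)"
  have G: "G \<tau> n m c x' w' = 1 - (1 - \<tau>) * (\<Sum>a\<in>?A. \<tau> ^ rank n m x w a * indicator {..<?d a} c)" for c
  proof -
    let ?S = "{a \<in> ?A. c < ?d a}"
    have "1 - \<tau> ^ card ?S = (1 - \<tau>) * (\<Sum>k<card ?S. \<tau> ^ k)"
      by (rule one_diff_power_eq)
    also have "(\<Sum>k<card ?S. \<tau> ^ k) = (\<Sum>a\<in>?S. \<tau> ^ card {b \<in> ?A. before x w b a})"
    proof (rule sum_power_card_below[symmetric])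
      \<comment> \<open>By \<open>compat\<close> the sums of (x', w') above the level form an
        initial segment for the order taken at (x, w), which is what allows ranks computed before
        the step to be used after it.\<close>
      show "b \<in> ?S" if "a \<in> ?S" "b \<in> ?A" "before x w b a" for a b
        using compat[of b a] that by auto
    qed (use before_total in \<open>auto simp: before_def\<close>)
    also have "\<dots> = (\<Sum>a\<in>?A. \<tau> ^ rank n m x w a * indicator {..<?d a} c)"
      by (simp add: rank_def indicator_def Int_def sum.If_cases if_distrib cong: if_cong)
    finally show ?thesis by (simp add: G_card)
  qed
  have i0: "integrable lborel (tent \<delta>)"
    using integrable_tent_mult[of "\<lambda>_. 1" \<delta>] \<open>0 \<le> \<delta>\<close> by simp
  have i1: "integrable lborel (\<lambda>c. tent \<delta> c * indicator {..<d} c)" for d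
    using \<open>0 \<le> \<delta>\<close> by (intro integrable_tent_mult) (auto simp: indicator_def)
  have "phi \<delta> \<tau> n m x' w' = (\<integral>c. tent \<delta> c -
      (1 - \<tau>) * (\<Sum>a\<in>?A. \<tau> ^ rank n m x w a * (tent \<delta> c * indicator {..<?d a} c)) \<partial>lborel)"
    unfolding phi_def
  proof (intro Bochner_Integration.integral_cong refl)
    fix c
    have "(\<Sum>a\<in>?A. \<tau> ^ rank n m x w a * (tent \<delta> c * indicator {..<?d a} c))
        = tent \<delta> c * (\<Sum>a\<in>?A. \<tau> ^ rank n m x w a * indicator {..<?d a} c)"
      unfolding sum_distrib_left by (intro sum.cong refl mult.left_commute)
    then show "tent \<delta> c * G \<tau> n m c x' w' = tent \<delta> c - (1 - \<tau>) *
        (\<Sum>a\<in>?A. \<tau> ^ rank n m x w a * (tent \<delta> c * indicator {..<?d a} c))"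
      unfolding G by (simp only: right_diff_distrib mult_1_right mult.left_commute)
  qed
  also have "\<dots> = (\<integral>c. tent \<delta> c \<partial>lborel) -
      (1 - \<tau>) * (\<Sum>a\<in>?A. \<tau> ^ rank n m x w a * tent_int \<delta> (?d a))"
    using i0 i1 by (simp add: tent_int_def)
  finally show ?thesis .
qed

text \<open>Sums that share an index are exempt: moving \<open>x\<close> cannot change the order of
  sums with the same j, and the Weyl chamber fixes the order of sums with the same i.\<close>

definition no_coincidence :: "nat \<Rightarrow> nat \<Rightarrow> real \<Rightarrow> (nat \<Rightarrow> real) \<Rightarrow> (nat \<Rightarrow> real) \<Rightarrow> bool" where
  "no_coincidence n m R x w \<longleftrightarrow> (\<forall>j\<in>{1..n}. \<forall>j'\<in>{1..n}. \<forall>i\<in>{1..m}. \<forall>i'\<in>{1..m}.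
     j \<noteq> j' \<longrightarrow> i \<noteq> i' \<longrightarrow> R < \<bar>(x j + w i) - (x j' + w i')\<bar>)"

lemma weyl_minus_antimono:
  assumes "weyl_minus n x" "1 \<le> i" "i \<le> j" "j \<le> n"
  shows "x j \<le> x i"
  using assms(3,4)
proof (induction j rule: dec_induct)
  case (step k)
  then have "x (Suc k) \<le> x k" using assms by (auto simp: weyl_minus_def)
  then show ?case using step by auto
qed simp

text \<open>Sums with both indices different are more than 2\<rho> apart and each moves by at most
  \<rho>; sums with a common index keep their order because \<open>w\<close> does not move and
  \<open>x'\<close> stays in the Weyl chamber.\<close>

lemma before_compat:
  assumes wx: "weyl_minus n x" and ww: "weyl_minus m w" and wx': "weyl_minus n x'"
    and nc: "no_coincidence n m (2 * \<rho>) x w"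
    and close: "\<And>j. j \<in> {1..n} \<Longrightarrow> \<bar>x' j - x j\<bar> \<le> \<rho>"
    and a: "a \<in> {1..n}\<times>{1..m}" and b: "b \<in> {1..n}\<times>{1..m}" and ab: "before x w a b"
  shows "x' (fst b) + w (snd b) \<le> x' (fst a) + w (snd a)"
proof -
  obtain j i j' i' where ji: "a = (j, i)" "b = (j', i')" by (cases a, cases b) auto
  have r: "j \<in> {1..n}" "i \<in> {1..m}" "j' \<in> {1..n}" "i' \<in> {1..m}" using a b ji by auto
  consider "j = j'" | "i = i'" | "j \<noteq> j'" "i \<noteq> i'" by blast
  then show ?thesis
  proof cases
    case 1
    then show ?thesis using ab ji by (auto simp: before_def)
  next
    case 2
    have "j \<le> j'"
    proof (rule ccontr)
      assume "\<not> j \<le> j'"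
      then have "x j \<le> x j'" "j' < j" using r by (auto intro!: weyl_minus_antimono[OF wx])
      then show False using ab ji 2 by (auto simp: before_def)
    qed
    then have "x' j' \<le> x' j" using r by (auto intro!: weyl_minus_antimono[OF wx'])
    then show ?thesis using ji 2 by simp
  next
    case 3
    then have "2 * \<rho> < \<bar>(x j + w i) - (x j' + w i')\<bar>" using nc r by (auto simp: no_coincidence_def)
    moreover have "x j' + w i' \<le> x j + w i" using ab ji by (auto simp: before_def)
    ultimately show ?thesis using close[OF r(1)] close[OF r(3)] ji by (auto simp: abs_if split: if_splits)
  qed
qed

text \<open>Nothing fits between the sums of (j, i) and (Suc j, i): with the same i, an index
  strictly between \<open>j\<close> and \<open>Suc j\<close> would be required, and with another i
  the sum would be a coincidence at distance \<open>R\<close>. This is the source of the ratio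
  \<tau> between the two weights.\<close>

lemma rank_Suc:
  assumes wx: "weyl_minus n x" and nc: "no_coincidence n m R x w"
    and j: "j \<in> {1..<n}" and i: "i \<in> {1..m}" and gap: "x j - x (Suc j) \<le> R"
  shows "rank n m x w (Suc j, i) = Suc (rank n m x w (j, i))"
proof -
  let ?A = "{1..n}\<times>{1..m}"
  have jj: "x (Suc j) \<le> x j" using wx j by (auto simp: weyl_minus_def)
  have bj: "before x w (j, i) (Suc j, i)" using jj by (auto simp: before_def)
  have "{b \<in> ?A. before x w b (Suc j, i)} = insert (j, i) {b \<in> ?A. before x w b (j, i)}"
  proof (intro equalityI subsetI)
    fix b assume b: "b \<in> {b \<in> ?A. before x w b (Suc j, i)}"
    show "b \<in> insert (j, i) {b \<in> ?A. before x w b (j, i)}"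
    proof (rule ccontr)
      assume "b \<notin> insert (j, i) {b \<in> ?A. before x w b (j, i)}"
      then have nb: "b \<noteq> (j, i)" "\<not> before x w b (j, i)" using b by auto
      then have jb: "before x w (j, i) b" using before_total by blast
      obtain j' i' where ji: "b = (j', i')" by (cases b)
      have r: "j' \<in> {1..n}" "i' \<in> {1..m}" using b ji by auto
      have bnd: "x j' + w i' \<le> x j + w i" "x (Suc j) + w i \<le> x j' + w i'"
        using jb b ji by (auto simp: before_def)
      show False
      proof (cases "i' = i")
        case True
        have "j < j'"
        proof (rule ccontr)
          assume "\<not> j < j'"
          then have "x j \<le> x j'" "j' \<le> j" using r j by (auto intro!: weyl_minus_antimono[OF wx])
          then show False using jb ji nb True by (auto simp: before_def)
        qed
        moreover have "j' < Suc j"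
        proof (rule ccontr)
          assume "\<not> j' < Suc j"
          then have "x j' \<le> x (Suc j)" "Suc j \<le> j'" using r j by (auto intro!: weyl_minus_antimono[OF wx])
          then show False using b ji True by (auto simp: before_def)
        qed
        ultimately show False by simp
      next
        case False
        have "\<bar>(x k + w i) - (x j' + w i')\<bar> \<le> R" if "k = j \<or> k = Suc j" for k
          using that bnd gap by auto
        \<comment> \<open>\<open>no_coincidence\<close> speaks only of pairs differing in both
          components, and \<open>j'\<close> may be \<open>j\<close> or \<open>Suc j\<close>. At
          least one of these two differs from \<open>j'\<close>, and both of their sums are within
          \<open>R\<close> of the sum in question.\<close>
        moreover have "\<exists>k. (k = j \<or> k = Suc j) \<and> k \<noteq> j'" by (metis n_not_Suc_n)
        ultimately obtain k where k: "k = j \<or> k = Suc j" "k \<noteq> j'"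
            "\<bar>(x k + w i) - (x j' + w i')\<bar> \<le> R"
          by blast
        from k(1) have kn: "k \<in> {1..n}" using j by auto
        have "R < \<bar>(x k + w i) - (x j' + w i')\<bar>"
          using nc kn r i k(2) False unfolding no_coincidence_def by (metis (no_types))
        then show False using k(3) by linarith
      qed
    qed
  next
    fix b assume "b \<in> insert (j, i) {b \<in> ?A. before x w b (j, i)}"
    then show "b \<in> {b \<in> ?A. before x w b (Suc j, i)}"
      using bj i j by (auto simp: before_def)
  qed
  moreover have "(j, i) \<notin> {b \<in> ?A. before x w b (j, i)}" by (simp add: before_def)
  ultimately show ?thesis by (simp add: rank_def)
qed

text \<open>Summation by parts; no boundary terms arise because \<open>l\<close> vanishes at 0 and
  at \<open>n\<close>.\<close>

lemma sum_push_shift: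
  fixes l T :: "nat \<Rightarrow> real"
  assumes out: "\<And>j. j \<notin> {1..<n} \<Longrightarrow> l j = 0"
  shows "(\<Sum>j\<in>{1..n}. T j * (p * l j - q * l (j - 1))) = (\<Sum>j\<in>{1..<n}. l j * (p * T j - q * T (Suc j)))"
proof (cases n)
  case (Suc k)
  have "(\<Sum>j\<in>{1..n}. T j * l j) = (\<Sum>j\<in>{1..<n}. T j * l j)"
    using out[of n] by (intro sum.mono_neutral_right) (auto simp: Suc le_less_Suc_eq intro!: out)
  moreover have "(\<Sum>j\<in>{1..n}. T j * l (j - 1)) = (\<Sum>j\<in>{0..k}. T (Suc j) * l j)"
    unfolding Suc One_nat_def sum.shift_bounds_cl_Suc_ivl by simp
  moreover have "\<dots> = (\<Sum>j\<in>{1..<n}. T (Suc j) * l j)"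
    by (intro sum.mono_neutral_right) (auto simp: Suc intro!: out)
  ultimately have "p * (\<Sum>j\<in>{1..n}. T j * l j) - q * (\<Sum>j\<in>{1..n}. T j * l (j - 1))
      = p * (\<Sum>j\<in>{1..<n}. T j * l j) - q * (\<Sum>j\<in>{1..<n}. T (Suc j) * l j)" by simp
  then show ?thesis
    by (simp add: sum_distrib_left sum_subtractf[symmetric] algebra_simps)
qed simp

section \<open>First-order expansion of one reflected step\<close>

context oblique
begin

abbreviation \<tau> :: real where "\<tau> \<equiv> p / q"

lemma tau: "0 < \<tau>" "\<tau> < 1" "q * \<tau> = p"
  using p_pos p_less_q q_pos by auto

text \<open>In units of the noise bound \<open>r\<close>: 1 for the noise itself, and 2 n / (q - p)
  for the pushing, by \<open>push_bound\<close> with D = 2 r, since noise can make an ordered gap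
  negative by at most 2 r.\<close>

definition spread :: "nat \<Rightarrow> real" where "spread n = 1 + 2 * n / (q - p)"

lemma spread_ge_1: "1 \<le> spread n"
  using q_minus_p by (simp add: spread_def)

text \<open>Starting in the Weyl chamber, the noise creates overlaps of at most 2 r, so
  \<open>push_bound\<close> controls every push. A nonzero push requires a gap that the noise of its
  two particles and the two adjacent pushes can close, whence 2 r + 2 (spread n - 1) r in the third
  claim.\<close>

lemma reflect_step:
  assumes wx: "weyl_minus n x" and "0 \<le> r" and xi: "\<And>j. \<bar>\<xi> j\<bar> \<le> r"
  defines "v \<equiv> \<lambda>j. x j + \<xi> j"
  shows "push n v j \<le> (spread n - 1) * r"
    and "j \<in> {1..n} \<Longrightarrow> \<bar>reflect n v j - x j\<bar> \<le> spread n * r"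
    and "j \<in> {1..<n} \<Longrightarrow> push n v j \<noteq> 0 \<Longrightarrow> x j - x (Suc j) \<le> 2 * spread n * r"
proof -
  have vv: "v (Suc j) - v j \<le> 2 * r" if "j \<in> {1..<n}" for j
    using wx that xi[of j] xi[of "Suc j"] by (auto simp: v_def weyl_minus_def abs_le_iff dest!: spec[of _ j])
  have pb: "push n v j \<le> (spread n - 1) * r" for j
  proof (cases "j \<in> {1..<n}")
    case True
    have "push n v j \<le> 2 * r * j / (q - p)" by (rule push_bound) (use vv \<open>0 \<le> r\<close> in auto)
    also have "\<dots> \<le> 2 * r * n / (q - p)"
      using True \<open>0 \<le> r\<close> q_minus_p by (intro divide_right_mono mult_left_mono) auto
    finally show ?thesis by (simp add: spread_def mult_ac)
  next
    case False
    then show ?thesis using push_outside[of j n v] \<open>0 \<le> r\<close> q_minus_p by (simp add: spread_def)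
  qed
  have sr: "0 \<le> (spread n - 1) * r" using \<open>0 \<le> r\<close> spread_ge_1[of n] by simp
  have cb: "0 \<le> c * push n v j" "c * push n v j \<le> (spread n - 1) * r" if "0 \<le> c" "c \<le> 1" for c j
    using mult_mono[OF that(2) pb[of j]] sr push_nonneg[of n v j] that by auto
  show "push n v j \<le> (spread n - 1) * r" by (rule pb)
  have sr1: "spread n * r = r + (spread n - 1) * r" by (simp add: algebra_simps)
  show "\<bar>reflect n v j - x j\<bar> \<le> spread n * r" if "j \<in> {1..n}"
    using that xi[of j] cb[of p j] cb[of q "j - 1"] p_pos p_less_1 q_pos q_less_1
    unfolding sr1 by (auto simp: reflect_def v_def abs_le_iff)
  show "x j - x (Suc j) \<le> 2 * spread n * r" if "j \<in> {1..<n}" "push n v j \<noteq> 0"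
  proof -
    have "0 \<le> v (Suc j) - v j + q * push n v (j - 1) + p * push n v (Suc j)"
      using push_fixpoint[OF that(1), of v] that(2) by (simp add: max_def split: if_splits)
    then show ?thesis
      using xi[of j] xi[of "Suc j"] cb[of q "j - 1"] cb[of p "Suc j"] p_pos p_less_1 q_pos q_less_1
      unfolding mult.assoc sr1 by (auto simp: v_def abs_le_iff)
  qed
qed

text \<open>The weights of neighbouring particles have ratio \<open>\<tau>\<close>, so by \<open>p - q * \<tau> = 0\<close> the pushing terms
  cancel to first order; only the noise remains.\<close>
lemma phi_step:
  assumes wx: "weyl_minus n x" and ww: "weyl_minus m w" and "0 \<le> r" and xi: "\<And>j. \<bar>\<xi> j\<bar> \<le> r"
    and "0 \<le> \<delta>" and nc: "no_coincidence n m (2 * (spread n * r)) x w"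
  shows "\<bar>phi \<delta> \<tau> n m (reflect n (\<lambda>j. x j + \<xi> j)) w - phi \<delta> \<tau> n m x w
    + (1 - \<tau>) * (\<Sum>a\<in>{1..n}\<times>{1..m}. \<tau> ^ rank n m x w a * tent \<delta> (x (fst a) + w (snd a)) * \<xi> (fst a))\<bar>
    \<le> 4 * (real n * real m) * (spread n * r)\<^sup>2"
proof -
  let ?A = "{1..n}\<times>{1..m}"
  define v where "v = (\<lambda>j. x j + \<xi> j)"
  define x' where "x' = reflect n v"
  define \<rho> where "\<rho> = spread n * r"
  define l where "l = push n v"
  define d where "d a = x (fst a) + w (snd a)" for a
  define d' where "d' a = x' (fst a) + w (snd a)" for a
  define k where "k a = \<tau> ^ rank n m x w a" for a
  note rs = reflect_step[where \<xi> = \<xi>, OF wx \<open>0 \<le> r\<close> xi, folded v_def x'_def l_def]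
  have \<rho>: "0 \<le> \<rho>" using \<open>0 \<le> r\<close> spread_ge_1[of n] by (simp add: \<rho>_def)
  have k: "0 \<le> k a" "k a \<le> 1" for a using tau by (auto simp: k_def power_le_one)
  have wx': "weyl_minus n x'" by (simp add: x'_def reflect_weyl)
  have dd: "d' a - d a = \<xi> (fst a) + (p * l (fst a) - q * l (fst a - 1))" if "a \<in> ?A" for a
    using that by (auto simp: d_def d'_def x'_def reflect_def l_def v_def)
  have e1: "phi \<delta> \<tau> n m x' w = (\<integral>c. tent \<delta> c \<partial>lborel) - (1 - \<tau>) * (\<Sum>a\<in>?A. k a * tent_int \<delta> (d' a))"
    unfolding k_def d'_def
    by (rule phi_rank[OF tau(1,2) \<open>0 \<le> \<delta>\<close>])
      (use before_compat[OF wx ww wx' nc] rs(2) in auto)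
  have e2: "phi \<delta> \<tau> n m x w = (\<integral>c. tent \<delta> c \<partial>lborel) - (1 - \<tau>) * (\<Sum>a\<in>?A. k a * tent_int \<delta> (d a))"
    unfolding k_def d_def by (rule phi_rank[OF tau(1,2) \<open>0 \<le> \<delta>\<close>]) (auto simp: before_def)
  \<comment> \<open>\<open>E1\<close> collects the Taylor remainders; \<open>E2\<close> is the
    contribution of the pushing, which looks first-order and has to be shown to be of second
    order.\<close>
  define E1 where "E1 = (\<Sum>a\<in>?A. k a * (tent_int \<delta> (d' a) - tent_int \<delta> (d a) - tent \<delta> (d a) * (d' a - d a)))"
  define E2 where "E2 = (\<Sum>a\<in>?A. k a * tent \<delta> (d a) * (p * l (fst a) - q * l (fst a - 1)))"
  have "(\<Sum>a\<in>?A. k a * tent \<delta> (d a) * (d' a - d a)) = (\<Sum>a\<in>?A. k a * tent \<delta> (d a) * \<xi> (fst a)) + E2"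
    unfolding E2_def sum.distrib[symmetric] by (intro sum.cong refl) (simp only: dd distrib_left)
  moreover have "E1 = (\<Sum>a\<in>?A. k a * tent_int \<delta> (d' a)) - (\<Sum>a\<in>?A. k a * tent_int \<delta> (d a))
      - (\<Sum>a\<in>?A. k a * tent \<delta> (d a) * (d' a - d a))"
    unfolding E1_def sum_subtractf[symmetric] by (intro sum.cong refl) (simp add: algebra_simps)
  ultimately have E12: "(\<Sum>a\<in>?A. k a * tent_int \<delta> (d' a)) - (\<Sum>a\<in>?A. k a * tent_int \<delta> (d a))
      - (\<Sum>a\<in>?A. k a * tent \<delta> (d a) * \<xi> (fst a)) = E1 + E2" by linarith
  have main: "phi \<delta> \<tau> n m x' w - phi \<delta> \<tau> n m x w
      + (1 - \<tau>) * (\<Sum>a\<in>?A. k a * tent \<delta> (d a) * \<xi> (fst a)) = - ((1 - \<tau>) * (E1 + E2))"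
    unfolding e1 e2 E12[symmetric] by (simp only: right_diff_distrib)
  have "\<bar>E1\<bar> \<le> (\<Sum>a\<in>?A. 2 * \<rho>\<^sup>2)"
    unfolding E1_def
  proof (rule order_trans[OF sum_abs], rule sum_mono)
    fix a assume a: "a \<in> ?A"
    have "\<bar>d' a - d a\<bar> \<le> \<rho>" using rs(2)[of "fst a"] a by (auto simp: d_def d'_def \<rho>_def)
    then have "(d' a - d a)\<^sup>2 \<le> \<rho>\<^sup>2" by (rule power2_le_iff_abs_le[THEN iffD2, OF \<rho>])
    then have "\<bar>tent_int \<delta> (d' a) - tent_int \<delta> (d a) - tent \<delta> (d a) * (d' a - d a)\<bar> \<le> 2 * \<rho>\<^sup>2"
      using tent_int_taylor[OF \<open>0 \<le> \<delta>\<close>, of "d' a" "d a"] by linarith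
    then have "k a * \<bar>tent_int \<delta> (d' a) - tent_int \<delta> (d a) - tent \<delta> (d a) * (d' a - d a)\<bar> \<le> 1 * (2 * \<rho>\<^sup>2)"
      using k[of a] by (intro mult_mono) auto
    then show "\<bar>k a * (tent_int \<delta> (d' a) - tent_int \<delta> (d a) - tent \<delta> (d a) * (d' a - d a))\<bar> \<le> 2 * \<rho>\<^sup>2"
      using k[of a] by (simp add: abs_mult)
  qed
  then have E1: "\<bar>E1\<bar> \<le> 2 * (real n * real m) * \<rho>\<^sup>2" by simp
  have "E2 = (\<Sum>i\<in>{1..m}. \<Sum>j\<in>{1..n}. k (j, i) * tent \<delta> (d (j, i)) * (p * l j - q * l (j - 1)))"
    unfolding E2_def by (subst sum.swap, subst sum.cartesian_product) (simp add: case_prod_unfold)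
  also have "\<dots> = (\<Sum>i\<in>{1..m}. \<Sum>j\<in>{1..<n}. l j * (p * (k (j, i) * tent \<delta> (d (j, i)))
      - q * (k (Suc j, i) * tent \<delta> (d (Suc j, i)))))"
    by (intro sum.cong refl sum_push_shift) (auto simp: l_def intro!: push_outside)
  also have "\<bar>\<dots>\<bar> \<le> (\<Sum>i\<in>{1..m}. \<Sum>j\<in>{1..<n}. 2 * \<rho>\<^sup>2)"
  proof (rule order_trans[OF sum_abs], rule sum_mono, rule order_trans[OF sum_abs], rule sum_mono)
    fix i j assume i: "i \<in> {1..m}" and j: "j \<in> {1..<n}"
    show "\<bar>l j * (p * (k (j, i) * tent \<delta> (d (j, i))) - q * (k (Suc j, i) * tent \<delta> (d (Suc j, i))))\<bar> \<le> 2 * \<rho>\<^sup>2"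
    proof (cases "l j = 0")
      case False
      \<comment> \<open>A nonzero push forces a small gap, so the two sums have consecutive ranks.
        What remains is a difference of \<open>tent\<close> at two points at most 2\<rho> apart,
        times a push of size at most \<rho>.\<close>
      have gap: "x j - x (Suc j) \<le> 2 * \<rho>" using rs(3)[OF j False] by (simp add: \<rho>_def mult.assoc)
      have "rank n m x w (Suc j, i) = Suc (rank n m x w (j, i))"
        using rank_Suc[OF wx nc j i] gap by (simp add: \<rho>_def)
      then have "q * k (Suc j, i) = p * k (j, i)" by (simp only: k_def power_Suc mult.assoc[symmetric] tau(3))
      then have "p * (k (j, i) * tent \<delta> (d (j, i))) - q * (k (Suc j, i) * tent \<delta> (d (Suc j, i)))
          = (p * k (j, i)) * (tent \<delta> (d (j, i)) - tent \<delta> (d (Suc j, i)))"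
        by (metis mult.assoc right_diff_distrib)
      moreover have "\<bar>tent \<delta> (d (j, i)) - tent \<delta> (d (Suc j, i))\<bar> \<le> 2 * \<rho>"
        using tent_Lipschitz[of \<delta> "d (j, i)" "d (Suc j, i)"] gap wx j
        by (auto simp: d_def weyl_minus_def)
      moreover have "\<bar>p * k (j, i)\<bar> \<le> 1"
        using k[of "(j, i)"] p_pos p_less_1 by (simp add: abs_mult mult_le_one)
      ultimately have "\<bar>p * (k (j, i) * tent \<delta> (d (j, i))) - q * (k (Suc j, i) * tent \<delta> (d (Suc j, i)))\<bar> \<le> 1 * (2 * \<rho>)"
        unfolding abs_mult by (simp only: abs_mult) (intro mult_mono, auto)
      moreover have "\<bar>l j\<bar> \<le> \<rho>"
        using rs(1)[of j] push_nonneg[of n v j] \<open>0 \<le> r\<close> by (simp add: \<rho>_def l_def algebra_simps)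
      ultimately have "\<bar>l j\<bar> * \<bar>p * (k (j, i) * tent \<delta> (d (j, i))) - q * (k (Suc j, i) * tent \<delta> (d (Suc j, i)))\<bar>
          \<le> \<rho> * (1 * (2 * \<rho>))"
        using \<rho> by (intro mult_mono) auto
      then show ?thesis by (simp add: abs_mult power2_eq_square)
    qed simp
  qed
  also have "\<dots> = 2 * (real m * real (n - 1)) * \<rho>\<^sup>2" by simp
  also have "\<dots> \<le> 2 * (real n * real m) * \<rho>\<^sup>2"
    by (intro mult_right_mono mult_left_mono) (auto simp: mult.commute intro!: mult_left_mono)
  finally have E2: "\<bar>E2\<bar> \<le> 2 * (real n * real m) * \<rho>\<^sup>2" .
  have "\<bar>(1 - \<tau>) * (E1 + E2)\<bar> \<le> 1 * (2 * (real n * real m) * \<rho>\<^sup>2 + 2 * (real n * real m) * \<rho>\<^sup>2)"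
    unfolding abs_mult by (intro mult_mono order_trans[OF abs_triangle_ineq] add_mono E1 E2) (use tau in auto)
  then have "\<bar>phi \<delta> \<tau> n m x' w - phi \<delta> \<tau> n m x w
      + (1 - \<tau>) * (\<Sum>a\<in>?A. k a * tent \<delta> (d a) * \<xi> (fst a))\<bar> \<le> 4 * (real n * real m) * \<rho>\<^sup>2"
    unfolding main abs_minus_cancel by (rule order_trans) (simp add: algebra_simps)
  then show ?thesis unfolding k_def d_def x'_def v_def \<rho>_def .
qed

end

section \<open>Truncated Gaussian steps\<close>

definition gauss :: "real \<Rightarrow> real measure" where
  "gauss h = density lborel (normal_density 0 (sqrt h))"

definition noise :: "real \<Rightarrow> nat \<Rightarrow> (nat \<Rightarrow> real) measure" where
  "noise h n = PiM {1..n} (\<lambda>_. gauss h)"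

definition clip :: "real \<Rightarrow> real \<Rightarrow> real" where
  "clip r u = max (- r) (min r u)"

lemma abs_clip_le: "0 \<le> r \<Longrightarrow> \<bar>clip r u\<bar> \<le> r"
  by (auto simp: clip_def)

lemma clip_id: "\<bar>u\<bar> \<le> r \<Longrightarrow> clip r u = u"
  by (auto simp: clip_def)

lemma measurable_clip [measurable]: "clip r \<in> borel_measurable borel"
  unfolding clip_def by measurable

lemma sets_gauss [simp, measurable_cong]: "sets (gauss h) = sets borel"
  and space_gauss [simp]: "space (gauss h) = UNIV"
  by (simp_all add: gauss_def)

lemma prob_space_gauss: "0 < h \<Longrightarrow> prob_space (gauss h)"
  unfolding gauss_def by (rule prob_space_normal_density) simp

lemma sets_noise [simp, measurable_cong]: "sets (noise h n) = sets (PiM {1..n} (\<lambda>_. borel))"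
  unfolding noise_def by (intro sets_PiM_cong) auto

lemma prob_space_noise: "0 < h \<Longrightarrow> prob_space (noise h n)"
  unfolding noise_def by (intro prob_space_PiM prob_space_gauss)

lemma integrable_prob_bounded:
  fixes f :: "'a \<Rightarrow> real"
  assumes "prob_space M" "f \<in> borel_measurable M" "\<And>x. x \<in> space M \<Longrightarrow> \<bar>f x\<bar> \<le> B"
  shows "integrable M f"
proof -
  interpret prob_space M by fact
  show ?thesis using assms by (intro integrable_const_bound[of f B]) auto
qed

lemma integral_prob_abs_le:
  fixes f :: "'a \<Rightarrow> real"
  assumes "prob_space Q" "\<And>x. \<bar>f x\<bar> \<le> B"
  shows "\<bar>\<integral>x. f x \<partial>Q\<bar> \<le> B"
proof -
  interpret prob_space Q by fact
  have "0 \<le> B" using assms(2)[of undefined] by linarith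
  then have "\<bar>\<integral>x. f x \<partial>Q\<bar> \<le> (\<integral>x. B \<partial>Q)"
    by (intro order_trans[OF integral_abs_bound integral_mono'] assms) auto
  then show ?thesis by (simp add: prob_space)
qed

lemma integral_gauss: "f \<in> borel_measurable borel \<Longrightarrow>
    (\<integral>u. f u \<partial>gauss h) = (\<integral>u. normal_density 0 (sqrt h) u * f u \<partial>lborel)"
  unfolding gauss_def by (subst integral_density) auto

lemma gauss_moment_even:
  assumes "0 < h"
  shows "integrable (gauss h) (\<lambda>u. u ^ (2 * k))"
    and "(\<integral>u. u ^ (2 * k) \<partial>gauss h) = fact (2 * k) / ((2 / h) ^ k * fact k)"
proof -
  have *: "has_bochner_integral lborel (\<lambda>u. normal_density 0 (sqrt h) u * u ^ (2 * k))
      (fact (2 * k) / ((2 / h) ^ k * fact k))"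
    using normal_moment_even[of "sqrt h" 0 k, OF real_sqrt_gt_zero[OF assms]]
    unfolding real_sqrt_pow2[OF less_imp_le[OF assms]] diff_zero .
  then show "(\<integral>u. u ^ (2 * k) \<partial>gauss h) = fact (2 * k) / ((2 / h) ^ k * fact k)"
    by (simp add: integral_gauss has_bochner_integral_iff)
  show "integrable (gauss h) (\<lambda>u. u ^ (2 * k))"
    unfolding gauss_def using * by (subst integrable_density) (auto simp: has_bochner_integral_iff)
qed

lemma integral_clip:
  assumes "0 \<le> r"
  shows "(\<integral>u. clip r u \<partial>gauss h) = 0"
proof -
  have "(\<integral>u. clip r u \<partial>gauss h) = (\<integral>u. normal_density 0 (sqrt h) (- u) * clip r (- u) \<partial>lborel)"
    unfolding integral_gauss[OF measurable_clip]
    by (subst lborel_integral_real_affine[where c = "- 1" and t = 0]) auto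
  also have "\<dots> = (\<integral>u. - (normal_density 0 (sqrt h) u * clip r u) \<partial>lborel)"
  proof (intro Bochner_Integration.integral_cong refl)
    fix u
    have "clip r (- u) = - clip r u" using assms by (auto simp: clip_def)
    moreover have "normal_density 0 (sqrt h) (- u) = normal_density 0 (sqrt h) u"
      by (simp add: normal_density_def)
    ultimately show "normal_density 0 (sqrt h) (- u) * clip r (- u)
        = - (normal_density 0 (sqrt h) u * clip r u)" by simp
  qed
  also have "\<dots> = - (\<integral>u. clip r u \<partial>gauss h)" by (simp add: integral_gauss)
  finally show ?thesis by simp
qed

definition clip_var :: "real \<Rightarrow> real \<Rightarrow> real" where
  "clip_var h r = (\<integral>u. (clip r u)\<^sup>2 \<partial>gauss h)"

text \<open>The lower bound integrates u^2 - u^4 / r^2 <= (clip r u)^2 and uses the fourth moment 3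
  h^2. The requirement 6 h <= r^2 originates here: it makes 3 h^2 / r^2 at most h / 2.\<close>

lemma clip_var_bounds:
  assumes "0 < h" "0 < r" "6 * h \<le> r\<^sup>2"
  shows "h / 2 \<le> clip_var h r" "clip_var h r \<le> h"
proof -
  interpret prob_space "gauss h" by (rule prob_space_gauss) fact
  have m2: "integrable (gauss h) (\<lambda>u. u\<^sup>2)" "(\<integral>u. u\<^sup>2 \<partial>gauss h) = h"
    using gauss_moment_even[OF assms(1), of 1] assms by auto
  have m4: "integrable (gauss h) (\<lambda>u. u ^ 4)" "(\<integral>u. u ^ 4 \<partial>gauss h) = 3 * h\<^sup>2"
    using gauss_moment_even[OF assms(1), of 2] assms
    by (auto simp: fact_numeral power2_eq_square field_simps)
  have ic: "integrable (gauss h) (\<lambda>u. (clip r u)\<^sup>2)"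
    using abs_clip_le[of r] assms
    by (intro integrable_prob_bounded[of _ _ "r\<^sup>2"] prob_space_axioms) (auto simp: abs_le_square_iff[symmetric])
  have "clip_var h r \<le> (\<integral>u. u\<^sup>2 \<partial>gauss h)"
    unfolding clip_var_def
    by (intro integral_mono ic m2) (use assms in \<open>auto simp: abs_le_square_iff[symmetric] clip_def\<close>)
  then show "clip_var h r \<le> h" by (simp add: m2)
  have "u\<^sup>2 - u ^ 4 / r\<^sup>2 \<le> (clip r u)\<^sup>2" for u
  proof (cases "\<bar>u\<bar> \<le> r")
    case False
    then have "r\<^sup>2 \<le> u\<^sup>2" using assms by (simp add: abs_le_square_iff[symmetric])
    then have "u\<^sup>2 * r\<^sup>2 \<le> u\<^sup>2 * u\<^sup>2" by (intro mult_left_mono) auto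
    then have "u\<^sup>2 - u ^ 4 / r\<^sup>2 \<le> 0" using assms by (simp add: field_simps power4_eq_xxxx power2_eq_square)
    then show ?thesis using zero_le_power2 order_trans by blast
  qed (simp add: clip_id)
  then have "(\<integral>u. u\<^sup>2 - u ^ 4 / r\<^sup>2 \<partial>gauss h) \<le> clip_var h r"
    unfolding clip_var_def by (intro integral_mono ic Bochner_Integration.integrable_diff m2) (use m4 in auto)
  moreover have "(\<integral>u. u\<^sup>2 - u ^ 4 / r\<^sup>2 \<partial>gauss h) = h - 3 * h\<^sup>2 / r\<^sup>2" using m2 m4 by simp
  moreover have "3 * h\<^sup>2 / r\<^sup>2 \<le> h / 2"
  proof -
    have "h * (6 * h) \<le> h * r\<^sup>2" using assms by (intro mult_left_mono) auto
    then show ?thesis using assms by (simp add: field_simps power2_eq_square)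
  qed
  ultimately show "h / 2 \<le> clip_var h r" by linarith
qed

lemma noise_prod:
  fixes f :: "nat \<Rightarrow> real \<Rightarrow> real"
  assumes "0 < h" "\<And>j. j \<in> {1..n} \<Longrightarrow> f j \<in> borel_measurable borel"
    and "\<And>j u. j \<in> {1..n} \<Longrightarrow> \<bar>f j u\<bar> \<le> B"
  shows "(\<integral>z. (\<Prod>j\<in>{1..n}. f j (z j)) \<partial>noise h n) = (\<Prod>j\<in>{1..n}. \<integral>u. f j u \<partial>gauss h)"
proof -
  interpret product_prob_space "\<lambda>_::nat. gauss h"
    using prob_space_gauss[OF assms(1)] by (rule product_prob_spaceI)
  show ?thesis unfolding noise_def
    by (intro product_integral_prod integrable_prob_bounded[OF prob_space_gauss]) (use assms in auto)
qed

lemma noise_coord: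
  fixes f :: "real \<Rightarrow> real"
  assumes "0 < h" "f \<in> borel_measurable borel" "j \<in> {1..n}"
  shows "(\<integral>z. f (z j) \<partial>noise h n) = (\<integral>u. f u \<partial>gauss h)"
proof -
  have "(\<integral>u. f u \<partial>gauss h) = (\<integral>u. f u \<partial>distr (noise h n) (gauss h) (\<lambda>z. z j))"
    unfolding noise_def using assms prob_space_gauss by (subst distr_PiM_component) auto
  also have "\<dots> = (\<integral>z. f (z j) \<partial>noise h n)"
    by (rule integral_distr) (use assms in \<open>auto simp: noise_def\<close>)
  finally show ?thesis ..
qed

lemma noise_pair:
  fixes f g :: "real \<Rightarrow> real"
  assumes h: "0 < h" and m: "f \<in> borel_measurable borel" "g \<in> borel_measurable borel"
    and b: "\<And>u. \<bar>f u\<bar> \<le> B" "\<And>u. \<bar>g u\<bar> \<le> B" and ij: "i \<in> {1..n}" "j \<in> {1..n}" "i \<noteq> j"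
  shows "(\<integral>z. f (z i) * g (z j) \<partial>noise h n) = (\<integral>u. f u \<partial>gauss h) * (\<integral>u. g u \<partial>gauss h)"
proof -
  define k where "k l = (if l = i then f else if l = j then g else (\<lambda>_. 1))" for l
  have prod: "(\<Prod>l\<in>{1..n}. F l) = F i * F j"
    if "\<And>l. l \<in> {1..n} \<Longrightarrow> l \<noteq> i \<Longrightarrow> l \<noteq> j \<Longrightarrow> F l = 1" for F :: "nat \<Rightarrow> real"
  proof -
    have "(\<Prod>l\<in>{1..n}. F l) = (\<Prod>l\<in>{i, j}. F l)"
      by (intro prod.mono_neutral_right) (use ij that in auto)
    then show ?thesis using ij by simp
  qed
  interpret prob_space "gauss h" by (rule prob_space_gauss) fact
  have "(\<integral>z. (\<Prod>l\<in>{1..n}. k l (z l)) \<partial>noise h n) = (\<Prod>l\<in>{1..n}. \<integral>u. k l u \<partial>gauss h)"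
    by (rule noise_prod[OF h, of _ _ "max B 1"]) (use m b in \<open>auto simp: k_def le_max_iff_disj\<close>)
  also have "\<dots> = (\<integral>u. k i u \<partial>gauss h) * (\<integral>u. k j u \<partial>gauss h)"
    by (rule prod) (use prob_space in \<open>simp add: k_def\<close>)
  also have "\<dots> = (\<integral>u. f u \<partial>gauss h) * (\<integral>u. g u \<partial>gauss h)" using ij by (simp add: k_def)
  also have "(\<lambda>z. \<Prod>l\<in>{1..n}. k l (z l)) = (\<lambda>z. f (z i) * g (z j))"
    using ij by (intro ext) (subst prod, auto simp: k_def)
  finally show ?thesis .
qed

lemma measurable_noise_coord [measurable (raw)]:
  assumes "j \<in> {1..n}"
  shows "(\<lambda>z. z j) \<in> borel_measurable (noise h n)"
  by (subst measurable_cong_sets[OF sets_noise refl]) (rule measurable_component_singleton[OF assms])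

lemma measurable_G:
  assumes f: "\<And>j. j \<in> {1..n} \<Longrightarrow> (\<lambda>\<omega>. f \<omega> j) \<in> borel_measurable N"
    and g: "\<And>i. i \<in> {1..m} \<Longrightarrow> (\<lambda>\<omega>. g \<omega> i) \<in> borel_measurable N"
    and c: "c \<in> borel_measurable N"
  shows "(\<lambda>\<omega>. G \<tau> n m (c \<omega>) (f \<omega>) (g \<omega>)) \<in> borel_measurable N"
  unfolding G_def
proof (intro borel_measurable_prod)
  fix j i assume ji: "j \<in> {1..n}" "i \<in> {1..m}"
  note [measurable] = f[OF ji(1)] g[OF ji(2)] c
  show "(\<lambda>\<omega>. \<tau> ^ theta (f \<omega> j + g \<omega> i - c \<omega>)) \<in> borel_measurable N"
    unfolding power_theta by measurable
qed

lemma measurable_phi: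
  assumes f: "\<And>j. j \<in> {1..n} \<Longrightarrow> (\<lambda>\<omega>. f \<omega> j) \<in> borel_measurable N"
    and g: "\<And>i. i \<in> {1..m} \<Longrightarrow> (\<lambda>\<omega>. g \<omega> i) \<in> borel_measurable N"
  shows "(\<lambda>\<omega>. phi \<delta> \<tau> n m (f \<omega>) (g \<omega>)) \<in> borel_measurable N"
proof -
  have "(\<lambda>p. G \<tau> n m (snd p) (f (fst p)) (g (fst p))) \<in> borel_measurable (N \<Otimes>\<^sub>M lborel)"
  proof (rule measurable_G)
    show "(\<lambda>p. f (fst p) j) \<in> borel_measurable (N \<Otimes>\<^sub>M lborel)" if "j \<in> {1..n}" for j
      using measurable_compose[OF measurable_fst f[OF that]] .
    show "(\<lambda>p. g (fst p) i) \<in> borel_measurable (N \<Otimes>\<^sub>M lborel)" if "i \<in> {1..m}" for i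
      using measurable_compose[OF measurable_fst g[OF that]] .
  qed simp
  note this [measurable]
  have "(\<lambda>(\<omega>, c). tent \<delta> c * G \<tau> n m c (f \<omega>) (g \<omega>)) \<in> borel_measurable (N \<Otimes>\<^sub>M lborel)"
    unfolding case_prod_unfold by measurable
  then show ?thesis unfolding phi_def by (rule lborel.borel_measurable_lebesgue_integral)
qed

lemma phi_bounds:
  assumes \<tau>: "0 \<le> \<tau>" "\<tau> \<le> 1" and \<delta>: "0 \<le> \<delta>"
  shows "0 \<le> phi \<delta> \<tau> n m x w" "phi \<delta> \<tau> n m x w \<le> (\<integral>c. tent \<delta> c \<partial>lborel)"
proof -
  show "0 \<le> phi \<delta> \<tau> n m x w" unfolding phi_def
    by (intro Bochner_Integration.integral_nonneg) (use \<tau> in \<open>simp add: tent_nonneg G_nonneg\<close>)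
  show "phi \<delta> \<tau> n m x w \<le> (\<integral>c. tent \<delta> c \<partial>lborel)" unfolding phi_def
  proof (rule integral_mono)
    show "integrable lborel (tent \<delta>)" using integrable_tent_mult[of "\<lambda>_. 1" \<delta>] \<delta> by simp
    show "tent \<delta> c * G \<tau> n m c x w \<le> tent \<delta> c" for c
      using mult_left_mono[OF G_le_1[OF \<tau>] tent_nonneg] by force
  qed (rule integrable_phi[OF \<tau> \<delta>])
qed

text \<open>Fubini moves the expectation inside the average over the level; for a fixed level
  \<open>G\<close> is a product, which \<open>phi\<close> is not.\<close>

lemma integral_phi:
  assumes "prob_space N" and \<tau>: "0 \<le> \<tau>" "\<tau> \<le> 1" and \<delta>: "0 \<le> \<delta>"
    and f: "\<And>j. j \<in> {1..n} \<Longrightarrow> (\<lambda>\<omega>. f \<omega> j) \<in> borel_measurable N"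
    and g: "\<And>i. i \<in> {1..m} \<Longrightarrow> (\<lambda>\<omega>. g \<omega> i) \<in> borel_measurable N"
  shows "(\<integral>\<omega>. phi \<delta> \<tau> n m (f \<omega>) (g \<omega>) \<partial>N) = (\<integral>c. tent \<delta> c * (\<integral>\<omega>. G \<tau> n m c (f \<omega>) (g \<omega>) \<partial>N) \<partial>lborel)"
proof -
  interpret N: prob_space N by fact
  interpret P: pair_sigma_finite lborel N ..
  have "(\<lambda>p. G \<tau> n m (fst p) (f (snd p)) (g (snd p))) \<in> borel_measurable (lborel \<Otimes>\<^sub>M N)"
  proof (rule measurable_G)
    show "(\<lambda>p. f (snd p) j) \<in> borel_measurable (lborel \<Otimes>\<^sub>M N)" if "j \<in> {1..n}" for j
      using measurable_compose[OF measurable_snd f[OF that]] .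
    show "(\<lambda>p. g (snd p) i) \<in> borel_measurable (lborel \<Otimes>\<^sub>M N)" if "i \<in> {1..m}" for i
      using measurable_compose[OF measurable_snd g[OF that]] .
  qed simp
  note this [measurable]
  have "integrable (lborel \<Otimes>\<^sub>M N) (\<lambda>(c, \<omega>). tent \<delta> c * G \<tau> n m c (f \<omega>) (g \<omega>))"
  proof (rule integrableI_bounded_set)
    show "{0..2 * \<delta>} \<times> space N \<in> sets (lborel \<Otimes>\<^sub>M N)" by simp
    show "emeasure (lborel \<Otimes>\<^sub>M N) ({0..2 * \<delta>} \<times> space N) < \<infinity>"
      using \<delta> by (subst N.emeasure_pair_measure_Times) (auto simp: N.emeasure_space_1)
    show "(\<lambda>(c, \<omega>). tent \<delta> c * G \<tau> n m c (f \<omega>) (g \<omega>)) \<in> borel_measurable (lborel \<Otimes>\<^sub>M N)"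
      unfolding case_prod_unfold by measurable
    have "\<bar>tent \<delta> c * G \<tau> n m c (f \<omega>) (g \<omega>)\<bar> \<le> \<delta> * 1" for c \<omega>
      unfolding abs_mult using tent_nonneg[of \<delta> c] tent_le[OF \<delta>, of c] \<delta> G_nonneg[OF \<tau>(1)] G_le_1[OF \<tau>]
      by (intro mult_mono) auto
    then show "AE p in lborel \<Otimes>\<^sub>M N. p \<in> {0..2 * \<delta>} \<times> space N \<longrightarrow>
        norm (case p of (c, \<omega>) \<Rightarrow> tent \<delta> c * G \<tau> n m c (f \<omega>) (g \<omega>)) \<le> \<delta>"
      by (auto simp: case_prod_unfold)
    show "AE p in lborel \<Otimes>\<^sub>M N. p \<notin> {0..2 * \<delta>} \<times> space N \<longrightarrow>
        (case p of (c, \<omega>) \<Rightarrow> tent \<delta> c * G \<tau> n m c (f \<omega>) (g \<omega>)) = 0"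
      by (rule AE_I2) (use tent_eq_0 in \<open>force simp: space_pair_measure case_prod_unfold\<close>)
  qed
  from P.Fubini_integral[OF this]
  show ?thesis unfolding phi_def by simp
qed

text \<open>All factors except possibly the one at \<open>i0\<close> are constant and can be moved
  out of the integral, so the factors need not be independent.\<close>

lemma integral_prod_one_random:
  fixes f :: "'i \<Rightarrow> 'a \<Rightarrow> real"
  assumes "prob_space N" "finite I" and const: "\<And>i u. i \<in> I \<Longrightarrow> i \<noteq> i0 \<Longrightarrow> f i u = k i"
  shows "(\<integral>u. (\<Prod>i\<in>I. f i u) \<partial>N) = (\<Prod>i\<in>I. \<integral>u. f i u \<partial>N)"
proof -
  interpret prob_space N by fact
  have k: "(\<integral>u. f i u \<partial>N) = k i" if "i \<in> I" "i \<noteq> i0" for i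
    using const[OF that] by (simp add: prob_space)
  show ?thesis
  proof (cases "i0 \<in> I")
    case True
    have "(\<Prod>i\<in>I. f i u) = f i0 u * (\<Prod>i\<in>I - {i0}. k i)" for u
      unfolding prod.remove[OF \<open>finite I\<close> True]
      by (intro arg_cong2[where f = "(*)"] prod.cong refl) (use const in auto)
    then have "(\<integral>u. (\<Prod>i\<in>I. f i u) \<partial>N) = (\<integral>u. f i0 u * (\<Prod>i\<in>I - {i0}. k i) \<partial>N)"
      by simp
    also have "\<dots> = (\<integral>u. f i0 u \<partial>N) * (\<Prod>i\<in>I - {i0}. \<integral>u. f i u \<partial>N)"
    proof -
      have "(\<Prod>i\<in>I - {i0}. \<integral>u. f i u \<partial>N) = (\<Prod>i\<in>I - {i0}. k i)"
        by (intro prod.cong refl) (use k in auto)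
      then show ?thesis by simp
    qed
    finally show ?thesis using True \<open>finite I\<close> by (simp add: prod.remove[of I i0])
  next
    case False
    then have "(\<Prod>i\<in>I. f i u) = (\<Prod>i\<in>I. k i)" for u using const by (intro prod.cong) auto
    moreover have "(\<Prod>i\<in>I. \<integral>u. f i u \<partial>N) = (\<Prod>i\<in>I. k i)" using k False by (intro prod.cong) auto
    ultimately show ?thesis by (simp add: prob_space)
  qed
qed

lemma gap_far:
  assumes w: "weyl_minus m w" and gap: "\<And>i. i \<in> {1..<m} \<Longrightarrow> R < w i - w (Suc i)" and "0 \<le> R"
    and i: "i \<in> {1..m}" "i' \<in> {1..m}" "i \<noteq> i'"
  shows "R < \<bar>w i - w i'\<bar>"
proof -
  have *: "R < w a - w b" if "a \<in> {1..m}" "b \<in> {1..m}" "a < b" for a b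
  proof -
    have "w b \<le> w (Suc a)" using that by (intro weyl_minus_antimono[OF w]) auto
    then show ?thesis using gap[of a] that by auto
  qed
  show ?thesis using *[of i i'] *[of i' i] i by (cases i i' rule: linorder_cases) auto
qed

section \<open>One step of the walk and its effect on \<open>phi\<close>\<close>

context oblique
begin

lemma push_iter_cong: "(\<And>j. j \<in> {1..n} \<Longrightarrow> v j = v' j) \<Longrightarrow> push_iter n v k = push_iter n v' k"
  by (induction k) (auto simp: fun_eq_iff)

lemma reflect_cong: "(\<And>j. j \<in> {1..n} \<Longrightarrow> v j = v' j) \<Longrightarrow> reflect n v = reflect n v'"
  unfolding reflect_def push_def using push_iter_cong[of n v v'] by (intro restrict_ext) simp

definition move :: "nat \<Rightarrow> real \<Rightarrow> (nat \<Rightarrow> real) \<Rightarrow> (nat \<Rightarrow> real) \<Rightarrow> nat \<Rightarrow> real" where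
  "move n r x z = reflect n (\<lambda>j\<in>{1..n}. x j + clip r (z j))"

lemma move_eq: "move n r x z = reflect n (\<lambda>j. x j + clip r (z j))"
  unfolding move_def by (rule reflect_cong) simp

lemma move_weyl: "weyl_minus n (move n r x z)"
  unfolding move_def by (rule reflect_weyl)

lemma measurable_move:
  assumes f: "\<And>j. j \<in> {1..n} \<Longrightarrow> (\<lambda>\<omega>. f \<omega> j) \<in> borel_measurable N"
    and g: "\<And>j. j \<in> {1..n} \<Longrightarrow> (\<lambda>\<omega>. g \<omega> j) \<in> borel_measurable N"
  shows "(\<lambda>\<omega>. move n r (f \<omega>) (g \<omega>)) \<in> N \<rightarrow>\<^sub>M PiM {1..n} (\<lambda>_. borel)"
  unfolding move_def
proof (rule measurable_compose[OF _ measurable_reflect], rule measurable_restrict)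
  fix j assume j: "j \<in> {1..n}"
  note [measurable] = f[OF j] g[OF j]
  show "(\<lambda>\<omega>. f \<omega> j + clip r (g \<omega> j)) \<in> borel_measurable N" by measurable
qed

lemma measurable_move_coord:
  assumes "\<And>j. j \<in> {1..n} \<Longrightarrow> (\<lambda>\<omega>. f \<omega> j) \<in> borel_measurable N"
    and "\<And>j. j \<in> {1..n} \<Longrightarrow> (\<lambda>\<omega>. g \<omega> j) \<in> borel_measurable N" and "j \<in> {1..n}"
  shows "(\<lambda>\<omega>. move n r (f \<omega>) (g \<omega>) j) \<in> borel_measurable N"
  using measurable_compose[OF measurable_move[of n f N g r] measurable_component_singleton[of j]] assms
  by auto

lemma measurable_move_noise:
  "j \<in> {1..n} \<Longrightarrow> (\<lambda>z. move n r x z j) \<in> borel_measurable (noise h n)"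
  by (rule measurable_move_coord) (auto intro: measurable_noise_coord)

text \<open>For given \<open>c\<close> each noise coordinate affects at most one factor, so the expectation factorises
  into a product that is symmetric in \<open>x\<close> and \<open>w\<close>.\<close>
lemma integral_phi_move_far:
  assumes h: "0 < h" and r: "0 \<le> r" and \<delta>: "0 \<le> \<delta>"
    and x: "weyl_minus n x" "\<And>j. j \<in> {1..<n} \<Longrightarrow> 2 * r < x j - x (Suc j)"
    and w: "weyl_minus m w" "\<And>i. i \<in> {1..<m} \<Longrightarrow> 2 * r < w i - w (Suc i)"
  shows "(\<integral>z. phi \<delta> \<tau> n m (move n r x z) w \<partial>noise h n)
    = (\<integral>c. tent \<delta> c * (\<Prod>j\<in>{1..n}. \<Prod>i\<in>{1..m}. \<integral>u. \<tau> ^ theta (x j + w i + clip r u - c) \<partial>gauss h) \<partial>lborel)"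
proof -
  have mv: "move n r x z j = x j + clip r (z j)" if "j \<in> {1..n}" for z j
  proof -
    \<comment> \<open>Each noise is at most \<open>r\<close> in absolute value, so gaps above 2 r
      stay ordered and reflection does nothing.\<close>
    have "weyl_minus n (\<lambda>j. x j + clip r (z j))"
      unfolding weyl_minus_def
    proof (intro allI impI)
      fix j assume "1 \<le> j \<and> j < n"
      then have "2 * r < x j - x (Suc j)" using x(2) by simp
      then show "x (Suc j) + clip r (z (Suc j)) \<le> x j + clip r (z j)"
        using abs_clip_le[OF r, of "z j"] abs_clip_le[OF r, of "z (Suc j)"] by linarith
    qed
    then show ?thesis using that by (simp add: move_eq reflect_weyl_id)
  qed
  have outer: "(\<integral>z. phi \<delta> \<tau> n m (move n r x z) w \<partial>noise h n)
      = (\<integral>c. tent \<delta> c * (\<integral>z. G \<tau> n m c (move n r x z) w \<partial>noise h n) \<partial>lborel)"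
    using tau by (intro integral_phi prob_space_noise h \<delta> measurable_move_noise) auto
  have inner: "(\<integral>z. G \<tau> n m c (move n r x z) w \<partial>noise h n)
      = (\<Prod>j\<in>{1..n}. \<Prod>i\<in>{1..m}. \<integral>u. \<tau> ^ theta (x j + w i + clip r u - c) \<partial>gauss h)" for c
  proof -
    have "(\<integral>z. G \<tau> n m c (move n r x z) w \<partial>noise h n)
        = (\<integral>z. (\<Prod>j\<in>{1..n}. (\<lambda>j u. \<Prod>i\<in>{1..m}. \<tau> ^ theta (x j + w i + clip r u - c)) j (z j)) \<partial>noise h n)"
      unfolding G_def
      by (intro Bochner_Integration.integral_cong prod.cong refl) (simp add: mv algebra_simps)
    also have "\<dots> = (\<Prod>j\<in>{1..n}. \<integral>u. (\<Prod>i\<in>{1..m}. \<tau> ^ theta (x j + w i + clip r u - c)) \<partial>gauss h)"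
    proof (rule noise_prod[OF h, of _ _ 1])
      show "(\<lambda>u. \<Prod>i\<in>{1..m}. \<tau> ^ theta (x j + w i + clip r u - c)) \<in> borel_measurable borel" for j
        unfolding power_theta by measurable
      show "\<bar>\<Prod>i\<in>{1..m}. \<tau> ^ theta (x j + w i + clip r u - c)\<bar> \<le> 1" for j u
        unfolding abs_prod using tau by (intro prod_le_1) (auto simp: power_theta)
    qed
    also have "\<dots> = (\<Prod>j\<in>{1..n}. \<Prod>i\<in>{1..m}. \<integral>u. \<tau> ^ theta (x j + w i + clip r u - c) \<partial>gauss h)"
    proof (intro prod.cong refl)
      fix j
      \<comment> \<open>The gaps of \<open>w\<close> exceed 2 r, so for this \<open>j\<close> at
        most one sum lies within \<open>r\<close> of the level. \<open>i0\<close> is its index if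
        there is one and arbitrary otherwise; noise of size at most \<open>r\<close> cannot alter
        the remaining factors.\<close>
      define i0 where "i0 = (SOME i. i \<in> {1..m} \<and> \<bar>x j + w i - c\<bar> \<le> r)"
      have "\<tau> ^ theta (x j + w i + clip r u - c) = \<tau> ^ theta (x j + w i - c)"
        if i: "i \<in> {1..m}" "i \<noteq> i0" for i u
      proof -
        have "r < \<bar>x j + w i - c\<bar>"
        proof (rule ccontr)
          assume "\<not> r < \<bar>x j + w i - c\<bar>"
          then have ai: "\<bar>x j + w i - c\<bar> \<le> r" by simp
          then have "i0 \<in> {1..m} \<and> \<bar>x j + w i0 - c\<bar> \<le> r"
            unfolding i0_def using i(1) by (intro someI[of "\<lambda>i. i \<in> {1..m} \<and> \<bar>x j + w i - c\<bar> \<le> r" i]) simp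
          then have "2 * r < \<bar>w i - w i0\<bar>" "\<bar>x j + w i0 - c\<bar> \<le> r"
            using gap_far[OF w, of i i0] r i by auto
          then show False using ai by linarith
        qed
        then show ?thesis using abs_clip_le[OF r, of u] by (auto simp: power_theta)
      qed
      then show "(\<integral>u. (\<Prod>i\<in>{1..m}. \<tau> ^ theta (x j + w i + clip r u - c)) \<partial>gauss h)
          = (\<Prod>i\<in>{1..m}. \<integral>u. \<tau> ^ theta (x j + w i + clip r u - c) \<partial>gauss h)"
        by (intro integral_prod_one_random[OF prob_space_gauss[OF h]]) auto
    qed
    finally show ?thesis .
  qed
  show ?thesis unfolding outer inner ..
qed

text \<open>The product formula sees the two configurations only through the sums x_j + w_i, and the
  same one-particle noise law serves both systems. So away from collisions the exchange of one step
  is exact.\<close>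

lemma integral_phi_move_symmetric:
  assumes h: "0 < h" and r: "0 \<le> r" and \<delta>: "0 \<le> \<delta>"
    and x: "weyl_minus n x" "\<And>j. j \<in> {1..<n} \<Longrightarrow> 2 * r < x j - x (Suc j)"
    and w: "weyl_minus m w" "\<And>i. i \<in> {1..<m} \<Longrightarrow> 2 * r < w i - w (Suc i)"
  shows "(\<integral>z. phi \<delta> \<tau> n m (move n r x z) w \<partial>noise h n) = (\<integral>z. phi \<delta> \<tau> n m x (move m r w z) \<partial>noise h m)"
proof -
  let ?g = "\<lambda>j i c. \<integral>u. \<tau> ^ theta (x j + w i + clip r u - c) \<partial>gauss h"
  have "(\<integral>z. phi \<delta> \<tau> n m x (move m r w z) \<partial>noise h m) = (\<integral>z. phi \<delta> \<tau> m n (move m r w z) x \<partial>noise h m)"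
    by (subst phi_swap) simp
  also have "\<dots> = (\<integral>c. tent \<delta> c * (\<Prod>i\<in>{1..m}. \<Prod>j\<in>{1..n}. ?g j i c) \<partial>lborel)"
    using integral_phi_move_far[OF h r \<delta> w x] by (simp only: add.commute)
  also have "\<dots> = (\<integral>c. tent \<delta> c * (\<Prod>j\<in>{1..n}. \<Prod>i\<in>{1..m}. ?g j i c) \<partial>lborel)"
    by (subst prod.swap) simp
  also have "\<dots> = (\<integral>z. phi \<delta> \<tau> n m (move n r x z) w \<partial>noise h n)"
    using integral_phi_move_far[OF h r \<delta> x w] by simp
  finally show ?thesis ..
qed

lemma integrable_phi_move:
  assumes "0 < h" "0 \<le> \<delta>"
  shows "integrable (noise h n) (\<lambda>z. phi \<delta> \<tau> n m (move n r x z) w)"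
  using tau phi_bounds[of \<tau> \<delta> n m _ w] assms
  by (intro integrable_prob_bounded[OF prob_space_noise, where B = "\<integral>c. tent \<delta> c \<partial>lborel"]
      measurable_phi measurable_move_noise) auto

text \<open>The Lipschitz bound of \<open>phi\<close> times the largest displacement in one step;
  crude, but valid at coincidences as well.\<close>

lemma integral_phi_move_error:
  assumes h: "0 < h" and r: "0 \<le> r" and \<delta>: "0 \<le> \<delta>" "\<delta> \<le> 1"
    and x: "weyl_minus n x" and w: "weyl_minus m w"
  shows "\<bar>(\<integral>z. phi \<delta> \<tau> n m (move n r x z) w \<partial>noise h n) - phi \<delta> \<tau> n m x w\<bar>
    \<le> real n * real m * (spread n * r)"
proof -
  interpret prob_space "noise h n" by (rule prob_space_noise) fact
  have i: "integrable (noise h n) (\<lambda>z. phi \<delta> \<tau> n m (move n r x z) w)"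
    by (rule integrable_phi_move) fact+
  have "(\<integral>z. phi \<delta> \<tau> n m (move n r x z) w \<partial>noise h n) - phi \<delta> \<tau> n m x w
      = (\<integral>z. phi \<delta> \<tau> n m (move n r x z) w - phi \<delta> \<tau> n m x w \<partial>noise h n)"
    using i prob_space by simp
  also have "\<bar>\<dots>\<bar> \<le> (\<integral>z. real n * real m * (spread n * r) \<partial>noise h n)"
  proof (rule order_trans[OF integral_abs_bound], rule integral_mono)
    fix z
    have "\<bar>phi \<delta> \<tau> n m (move n r x z) w - phi \<delta> \<tau> n m x w\<bar> \<le> real m * (\<Sum>j\<in>{1..n}. \<bar>move n r x z j - x j\<bar>)"
      using tau \<delta> by (intro phi_Lipschitz) auto
    also have "\<dots> \<le> real m * (\<Sum>j\<in>{1..n}. spread n * r)"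
      unfolding move_eq using reflect_step(2)[OF x r abs_clip_le[OF r]]
      by (intro mult_left_mono sum_mono) auto
    finally show "\<bar>phi \<delta> \<tau> n m (move n r x z) w - phi \<delta> \<tau> n m x w\<bar> \<le> real n * real m * (spread n * r)"
      by (simp add: mult_ac)
  qed (use i in auto)
  finally show ?thesis using prob_space by simp
qed

text \<open>Away from coincidences \<open>phi_step\<close> leaves a term linear in the noise and a
  second-order remainder. The linear term has expectation 0, because truncated Gaussians are still
  centred.\<close>

lemma integral_phi_move_error_good:
  assumes h: "0 < h" and r: "0 \<le> r" and \<delta>: "0 \<le> \<delta>"
    and x: "weyl_minus n x" and w: "weyl_minus m w"
    and nc: "no_coincidence n m (2 * (spread n * r)) x w"
  shows "\<bar>(\<integral>z. phi \<delta> \<tau> n m (move n r x z) w \<partial>noise h n) - phi \<delta> \<tau> n m x w\<bar>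
    \<le> 4 * (real n * real m) * (spread n * r)\<^sup>2"
proof -
  let ?A = "{1..n}\<times>{1..m}"
  define k where "k a = \<tau> ^ rank n m x w a * tent \<delta> (x (fst a) + w (snd a))" for a
  interpret prob_space "noise h n" by (rule prob_space_noise) fact
  have i: "integrable (noise h n) (\<lambda>z. phi \<delta> \<tau> n m (move n r x z) w)"
    by (rule integrable_phi_move) fact+
  have const: "(\<integral>z. C \<partial>noise h n) = C" for C :: real using prob_space by simp
  have ic: "integrable (noise h n) (\<lambda>z. clip r (z j))" if "j \<in> {1..n}" for j
    using measurable_noise_coord[OF that] abs_clip_le[OF r]
    by (intro integrable_prob_bounded[OF prob_space_axioms, where B = r]) auto
  have isum: "integrable (noise h n) (\<lambda>z. (1 - \<tau>) * (\<Sum>a\<in>?A. k a * clip r (z (fst a))))"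
    by (intro integrable_mult_right Bochner_Integration.integrable_sum integrable_mult_right ic) auto
  have "(\<integral>z. (\<Sum>a\<in>?A. k a * clip r (z (fst a))) \<partial>noise h n) = (\<Sum>a\<in>?A. k a * (\<integral>u. clip r u \<partial>gauss h))"
  proof (subst Bochner_Integration.integral_sum)
    show "integrable (noise h n) (\<lambda>z. k a * clip r (z (fst a)))" if "a \<in> ?A" for a
      using that by (intro integrable_mult_right ic) auto
    show "(\<Sum>a\<in>?A. \<integral>z. k a * clip r (z (fst a)) \<partial>noise h n) = (\<Sum>a\<in>?A. k a * (\<integral>u. clip r u \<partial>gauss h))"
    proof (intro sum.cong refl)
      fix a assume "a \<in> ?A"
      then have "(\<integral>z. clip r (z (fst a)) \<partial>noise h n) = (\<integral>u. clip r u \<partial>gauss h)"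
        by (intro noise_coord[OF h measurable_clip]) auto
      then show "(\<integral>z. k a * clip r (z (fst a)) \<partial>noise h n) = k a * (\<integral>u. clip r u \<partial>gauss h)" by simp
    qed
  qed
  then have "(\<integral>z. (1 - \<tau>) * (\<Sum>a\<in>?A. k a * clip r (z (fst a))) \<partial>noise h n) = 0"
    by (simp add: integral_clip[OF r])
  then have eq: "(\<integral>z. phi \<delta> \<tau> n m (move n r x z) w \<partial>noise h n) - phi \<delta> \<tau> n m x w
      = (\<integral>z. phi \<delta> \<tau> n m (move n r x z) w - phi \<delta> \<tau> n m x w + (1 - \<tau>) * (\<Sum>a\<in>?A. k a * clip r (z (fst a))) \<partial>noise h n)"
    using i isum prob_space by (subst Bochner_Integration.integral_add) auto
  have "\<bar>\<integral>z. phi \<delta> \<tau> n m (move n r x z) w - phi \<delta> \<tau> n m x w + (1 - \<tau>) * (\<Sum>a\<in>?A. k a * clip r (z (fst a))) \<partial>noise h n\<bar>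
      \<le> (\<integral>z. 4 * (real n * real m) * (spread n * r)\<^sup>2 \<partial>noise h n)"
  proof (rule order_trans[OF integral_abs_bound], rule integral_mono)
    show "\<bar>phi \<delta> \<tau> n m (move n r x z) w - phi \<delta> \<tau> n m x w + (1 - \<tau>) * (\<Sum>a\<in>?A. k a * clip r (z (fst a)))\<bar>
        \<le> 4 * (real n * real m) * (spread n * r)\<^sup>2" for z
    proof -
      have "\<bar>clip r (z j)\<bar> \<le> r" for j by (rule abs_clip_le[OF r])
      from phi_step[where \<xi> = "\<lambda>j. clip r (z j)", OF x w r this \<delta> nc]
      show ?thesis unfolding move_eq[symmetric] k_def[symmetric] .
    qed
    show "integrable (noise h n) (\<lambda>z. \<bar>phi \<delta> \<tau> n m (move n r x z) w - phi \<delta> \<tau> n m x w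
        + (1 - \<tau>) * (\<Sum>a\<in>?A. k a * clip r (z (fst a)))\<bar>)"
      by (intro integrable_abs Bochner_Integration.integrable_add isum Bochner_Integration.integrable_diff i) simp
  qed simp
  then show ?thesis unfolding eq const .
qed

end

section \<open>One-step duality error\<close>

definition near :: "real \<Rightarrow> real \<Rightarrow> real" where
  "near R u = indicat_real {- R..R} u"

lemma near_nonneg: "0 \<le> near R u" and near_le_1: "near R u \<le> 1"
  by (auto simp: near_def indicator_def)

lemma near_eq_1: "\<bar>u\<bar> \<le> R \<Longrightarrow> near R u = 1"
  by (auto simp: near_def indicator_def)

lemma measurable_near [measurable]: "near R \<in> borel_measurable borel"
  unfolding near_def by measurable

definition small_gap :: "nat \<Rightarrow> real \<Rightarrow> (nat \<Rightarrow> real) \<Rightarrow> real" where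
  "small_gap n R x = (\<Sum>j\<in>{1..<n}. near R (x j - x (Suc j)))"

definition offdiag :: "nat \<Rightarrow> (nat \<times> nat) set" where
  "offdiag n = {a \<in> {1..n} \<times> {1..n}. fst a \<noteq> snd a}"

text \<open>Written as a difference inside \<open>x\<close> plus a difference inside
  \<open>w\<close>: with one walk frozen, each term becomes the event that a difference of the other
  walk lies in an interval with shifted centre.\<close>

definition coincidences :: "nat \<Rightarrow> nat \<Rightarrow> real \<Rightarrow> (nat \<Rightarrow> real) \<Rightarrow> (nat \<Rightarrow> real) \<Rightarrow> real" where
  "coincidences n m R x w = (\<Sum>a\<in>offdiag n. \<Sum>b\<in>offdiag m.
     near R ((x (fst a) - x (snd a)) + (w (fst b) - w (snd b))))"

lemma finite_offdiag [simp]: "finite (offdiag n)"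
  by (simp add: offdiag_def)

lemma small_gap_nonneg: "0 \<le> small_gap n R x"
  by (simp add: small_gap_def sum_nonneg near_nonneg)

lemma coincidences_nonneg: "0 \<le> coincidences n m R x w"
  by (simp add: coincidences_def sum_nonneg near_nonneg)

lemma small_gap_ge_1:
  assumes "j \<in> {1..<n}" "weyl_minus n x" "x j - x (Suc j) \<le> R"
  shows "1 \<le> small_gap n R x"
proof -
  have "near R (x j - x (Suc j)) = 1"
    using assms by (intro near_eq_1) (auto simp: weyl_minus_def)
  moreover have "near R (x j - x (Suc j)) \<le> small_gap n R x"
    unfolding small_gap_def by (rule member_le_sum) (use assms in \<open>auto simp: near_nonneg\<close>)
  ultimately show ?thesis by simp
qed

lemma coincidences_ge_1:
  assumes "\<not> no_coincidence n m R x w"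
  shows "1 \<le> coincidences n m R x w"
proof -
  obtain j j' i i' where ji: "j \<in> {1..n}" "j' \<in> {1..n}" "i \<in> {1..m}" "i' \<in> {1..m}" "j \<noteq> j'" "i \<noteq> i'"
    "\<bar>(x j + w i) - (x j' + w i')\<bar> \<le> R"
    using assms unfolding no_coincidence_def by (auto simp: not_less)
  have a: "(j, j') \<in> offdiag n" "(i, i') \<in> offdiag m" using ji by (auto simp: offdiag_def)
  have "1 = near R ((x j - x j') + (w i - w i'))"
    using ji(7) by (intro near_eq_1[symmetric]) (simp add: algebra_simps)
  also have "\<dots> \<le> (\<Sum>b\<in>offdiag m. near R ((x j - x j') + (w (fst b) - w (snd b))))"
    using member_le_sum[OF a(2), of "\<lambda>b. near R ((x j - x j') + (w (fst b) - w (snd b)))"]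
    by (simp add: near_nonneg)
  also have "\<dots> \<le> coincidences n m R x w"
    unfolding coincidences_def
    using member_le_sum[OF a(1), of "\<lambda>a. \<Sum>b\<in>offdiag m. near R ((x (fst a) - x (snd a)) + (w (fst b) - w (snd b)))"]
    by (simp add: near_nonneg sum_nonneg)
  finally show ?thesis .
qed

lemma no_coincidence_mono: "no_coincidence n m R x w \<Longrightarrow> R' \<le> R \<Longrightarrow> no_coincidence n m R' x w"
  unfolding no_coincidence_def by (meson le_less_trans)

lemma no_coincidence_swap: "no_coincidence n m R x w \<Longrightarrow> no_coincidence m n R w x"
  unfolding no_coincidence_def by (metis add.commute)

text \<open>The Huber function: s^2 / 2 for |s| <= R and R |s| - R^2 / 2 beyond, with derivative
  \<open>clip R\<close>. It plays the part of the absolute value in Tanaka's formula, smoothed on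
  the scale of one step.\<close>

definition huber :: "real \<Rightarrow> real \<Rightarrow> real" where
  "huber R s = clip R s * s - (clip R s)\<^sup>2 / 2"

lemma measurable_huber [measurable]: "huber R \<in> borel_measurable borel"
  unfolding huber_def by measurable

text \<open>For fixed \<open>s\<close> the expression on the left is a concave parabola in \<theta>,
  maximal over [-R, R] at \<open>clip R s\<close>. So the Huber function is a supremum of affine
  functions of \<open>s\<close>, from which its Lipschitz bound and its supporting lines are read
  off.\<close>

lemma huber_ge:
  assumes "0 \<le> R" "\<bar>\<theta>\<bar> \<le> R"
  shows "\<theta> * s - \<theta>\<^sup>2 / 2 \<le> huber R s"
proof -
  have "0 \<le> (clip R s - \<theta>) * (2 * s - clip R s - \<theta>)"
  proof (cases "clip R s \<le> s")
    case True
    then have "\<theta> \<le> clip R s \<or> \<bar>s\<bar> \<le> R" using assms by (auto simp: clip_def)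
    then show ?thesis
    proof
      assume "\<bar>s\<bar> \<le> R"
      then show ?thesis by (simp add: clip_id algebra_simps power2_eq_square[symmetric])
    qed (use True in auto)
  next
    case False
    then have "clip R s = - R" "s < - R" using assms by (auto simp: clip_def split: if_splits)
    then show ?thesis using assms by (intro mult_nonpos_nonpos) auto
  qed
  then show ?thesis by (simp add: huber_def algebra_simps power2_eq_square)
qed

lemma huber_nonneg: "0 \<le> R \<Longrightarrow> 0 \<le> huber R s"
  using huber_ge[of R 0 s] by simp

lemma huber_Lipschitz:
  assumes "0 \<le> R"
  shows "\<bar>huber R s - huber R s'\<bar> \<le> R * \<bar>s - s'\<bar>"
proof -
  have *: "huber R s - huber R s' \<le> R * \<bar>s - s'\<bar>" for s s'
  proof -
    have "huber R s - huber R s' \<le> clip R s * (s - s')"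
      using huber_ge[OF assms abs_clip_le[OF assms], of s s'] by (simp add: huber_def algebra_simps)
    also have "\<dots> \<le> \<bar>clip R s\<bar> * \<bar>s - s'\<bar>" by (simp add: abs_mult[symmetric])
    also have "\<dots> \<le> R * \<bar>s - s'\<bar>" using abs_clip_le[OF assms] by (intro mult_right_mono) auto
    finally show ?thesis .
  qed
  show ?thesis using *[of s s'] *[of s' s] by (simp add: abs_le_iff abs_minus_commute)
qed

text \<open>For |s| <= R the margin 2 r keeps the whole step inside the quadratic region, where the
  expansion is exact. Elsewhere the supporting line suffices, since no second-order gain is claimed
  there.\<close>

lemma huber_convex:
  assumes "0 \<le> R" "0 \<le> r" "\<bar>\<zeta>\<bar> \<le> 2 * r"
  shows "huber (R + 2 * r) s + clip (R + 2 * r) s * \<zeta> + near R s * \<zeta>\<^sup>2 / 2 \<le> huber (R + 2 * r) (s + \<zeta>)"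
proof (cases "\<bar>s\<bar> \<le> R")
  case True
  then have "clip (R + 2 * r) s = s" "clip (R + 2 * r) (s + \<zeta>) = s + \<zeta>"
    using assms by (auto intro!: clip_id)
  then show ?thesis using near_eq_1[OF True] by (simp add: huber_def power2_eq_square field_simps)
next
  case False
  then have "near R s = 0" by (auto simp: near_def indicator_def)
  moreover have "clip (R + 2 * r) s * (s + \<zeta>) - (clip (R + 2 * r) s)\<^sup>2 / 2 \<le> huber (R + 2 * r) (s + \<zeta>)"
    using assms by (intro huber_ge abs_clip_le) auto
  ultimately show ?thesis by (simp add: huber_def algebra_simps)
qed

definition gap_energy :: "nat \<Rightarrow> (nat \<Rightarrow> real) \<Rightarrow> real" where
  "gap_energy n x = (\<Sum>j\<in>{1..<n}. (x j - x (Suc j))\<^sup>2)"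

text \<open>This is n x_1 minus the sum of all coordinates. A push lowers that sum by q - p times
  its size and never lowers x_1, so, apart from the noise, the growth of this quantity dominates the
  total pushing.\<close>

definition top_excess :: "nat \<Rightarrow> (nat \<Rightarrow> real) \<Rightarrow> real" where
  "top_excess n x = (\<Sum>j\<in>{1..n}. x 1 - x j)"

lemma gap_energy_nonneg: "0 \<le> gap_energy n x"
  by (simp add: gap_energy_def sum_nonneg)

lemma diameter_le:
  assumes x: "weyl_minus n x" and "i \<in> {1..n}" "j \<in> {1..n}"
  shows "\<bar>x i - x j\<bar> \<le> n + gap_energy n x"
proof -
  have *: "x i - x j \<le> n + gap_energy n x" if "i \<in> {1..n}" "j \<in> {1..n}" for i j
  proof -
    have "x i - x j \<le> x 1 - x n"
      using that weyl_minus_antimono[OF x, of 1 i] weyl_minus_antimono[OF x, of j n] by auto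
    also have "\<dots> = (\<Sum>j\<in>{1..<n}. x j - x (Suc j))"
      using that sum_Suc_diff'[of 1 n "\<lambda>j. - x j"] by auto
    also have "\<dots> \<le> (\<Sum>j\<in>{1..<n}. 1 + (x j - x (Suc j))\<^sup>2)"
    proof (rule sum_mono)
      have "d \<le> 1 + d\<^sup>2" for d :: real
        using sum_squares_bound[of 1 d] zero_le_power2[of d] unfolding one_power2 mult_1_right by linarith
      then show "x j - x (Suc j) \<le> 1 + (x j - x (Suc j))\<^sup>2" for j .
    qed
    also have "\<dots> = real (n - 1) + gap_energy n x" by (simp add: sum.distrib gap_energy_def)
    also have "\<dots> \<le> n + gap_energy n x" by simp
    finally show ?thesis .
  qed
  show ?thesis using *[OF assms(2,3)] *[OF assms(3,2)] by linarith
qed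

lemma top_excess_bounds:
  assumes x: "weyl_minus n x"
  shows "0 \<le> top_excess n x" "top_excess n x \<le> n * (n + gap_energy n x)"
proof -
  show "0 \<le> top_excess n x" unfolding top_excess_def
    using weyl_minus_antimono[OF x] by (intro sum_nonneg) auto
  have "top_excess n x \<le> (\<Sum>j\<in>{1..n}. n + gap_energy n x)"
    unfolding top_excess_def using diameter_le[OF x] by (intro sum_mono) (auto simp: abs_le_iff)
  then show "top_excess n x \<le> n * (n + gap_energy n x)" by simp
qed

context oblique
begin

lemma step_error:
  assumes h: "0 < h" and r: "0 \<le> r" and \<delta>: "0 \<le> \<delta>" "\<delta> \<le> 1"
    and x: "weyl_minus n x" and w: "weyl_minus m w"
  defines "s \<equiv> spread n + spread m"
  shows "\<bar>(\<integral>z. phi \<delta> \<tau> n m (move n r x z) w \<partial>noise h n) - (\<integral>z. phi \<delta> \<tau> n m x (move m r w z) \<partial>noise h m)\<bar>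
    \<le> (small_gap n (2 * (s * r)) x + small_gap m (2 * (s * r)) w) *
      (8 * (real n * real m) * (s * r)\<^sup>2 + 2 * (real n * real m) * (s * r) * coincidences n m (2 * (s * r)) x w)"
    (is "\<bar>?A - ?B\<bar> \<le> _")
proof -
  define R where "R = 2 * (s * r)"
  define g where "g = small_gap n R x + small_gap m R w"
  define C where "C = coincidences n m R x w"
  define nm where "nm = real n * real m"
  have g0: "0 \<le> g" by (simp add: g_def small_gap_nonneg)
  have C0: "0 \<le> C" by (simp add: C_def coincidences_nonneg)
  have nm: "0 \<le> nm" by (simp add: nm_def)
  have sn: "spread n * r \<le> s * r" "spread m * r \<le> s * r" "r \<le> s * r"
    and sp: "0 \<le> spread n * r" "0 \<le> spread m * r"
    using r spread_ge_1[of n] spread_ge_1[of m] mult_right_mono[of 1 s r]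
    by (auto simp: s_def intro!: mult_right_mono)
  have swap: "?B = (\<integral>z. phi \<delta> \<tau> m n (move m r w z) x \<partial>noise h m)" "phi \<delta> \<tau> n m x w = phi \<delta> \<tau> m n w x"
    by (simp_all add: phi_swap[of \<delta> \<tau> n m x])
  have crude: "\<bar>?A - ?B\<bar> \<le> 2 * nm * (s * r)"
  proof -
    have "\<bar>?A - phi \<delta> \<tau> n m x w\<bar> \<le> nm * (spread n * r)"
      using integral_phi_move_error[OF h r \<delta> x w] by (simp add: nm_def)
    moreover have "\<bar>?B - phi \<delta> \<tau> n m x w\<bar> \<le> nm * (spread m * r)"
      unfolding swap using integral_phi_move_error[OF h r \<delta> w x] by (simp add: nm_def mult.commute)
    moreover have "nm * (spread n * r) \<le> nm * (s * r)" "nm * (spread m * r) \<le> nm * (s * r)"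
      using sn nm by (auto intro!: mult_left_mono)
    ultimately show ?thesis by linarith
  qed
  have fine: "\<bar>?A - ?B\<bar> \<le> 8 * nm * (s * r)\<^sup>2" if nc: "no_coincidence n m R x w"
  proof -
    have "no_coincidence n m (2 * (spread n * r)) x w" "no_coincidence m n (2 * (spread m * r)) w x"
      using sn(1,2) nc no_coincidence_swap[OF nc] by (auto intro: no_coincidence_mono simp: R_def)
    then have "\<bar>?A - phi \<delta> \<tau> n m x w\<bar> \<le> 4 * nm * (spread n * r)\<^sup>2"
      "\<bar>?B - phi \<delta> \<tau> n m x w\<bar> \<le> 4 * nm * (spread m * r)\<^sup>2"
      unfolding swap using integral_phi_move_error_good[OF h r \<delta>(1) x w] integral_phi_move_error_good[OF h r \<delta>(1) w x]
      by (simp_all add: nm_def mult.commute swap(2)[symmetric])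
    moreover have "4 * nm * (spread n * r)\<^sup>2 \<le> 4 * nm * (s * r)\<^sup>2" "4 * nm * (spread m * r)\<^sup>2 \<le> 4 * nm * (s * r)\<^sup>2"
      using sn sp nm by (auto intro!: mult_left_mono power_mono)
    ultimately show ?thesis by linarith
  qed
  have s0: "0 \<le> s * r" using sn(1) sp(1) by linarith
  have "\<bar>?A - ?B\<bar> \<le> g * (8 * nm * (s * r)\<^sup>2 + 2 * nm * (s * r) * C)"
  proof (cases "(\<forall>j\<in>{1..<n}. 2 * r < x j - x (Suc j)) \<and> (\<forall>i\<in>{1..<m}. 2 * r < w i - w (Suc i))")
    case True
    then have "?A = ?B" by (intro integral_phi_move_symmetric[OF h r \<delta>(1) x _ w]) auto
    then show ?thesis using g0 C0 nm s0 by simp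
  next
    case False
    have "1 \<le> g"
    proof -
      consider j where "j \<in> {1..<n}" "x j - x (Suc j) \<le> 2 * r" | i where "i \<in> {1..<m}" "w i - w (Suc i) \<le> 2 * r"
        using False by (auto simp: not_less)
      then show ?thesis
      proof cases
        case 1
        then have "1 \<le> small_gap n R x" using sn by (intro small_gap_ge_1[OF _ x, of j]) (auto simp: R_def)
        then show ?thesis using small_gap_nonneg[of m R w] by (simp add: g_def)
      next
        case 2
        then have "1 \<le> small_gap m R w" using sn by (intro small_gap_ge_1[OF _ w, of i]) (auto simp: R_def)
        then show ?thesis using small_gap_nonneg[of n R x] by (simp add: g_def)
      qed
    qed
    moreover have "\<bar>?A - ?B\<bar> \<le> 8 * nm * (s * r)\<^sup>2 + 2 * nm * (s * r) * C"
    proof (cases "no_coincidence n m R x w")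
      case True
      have "0 \<le> 2 * nm * (s * r) * C" using nm s0 C0 by simp
      then show ?thesis using fine[OF True] by linarith
    next
      case False
      then have "2 * nm * (s * r) * 1 \<le> 2 * nm * (s * r) * C"
        using nm s0 by (intro mult_left_mono) (auto simp: C_def coincidences_ge_1)
      moreover have "0 \<le> 8 * nm * (s * r)\<^sup>2" using nm by simp
      ultimately show ?thesis using crude by linarith
    qed
    ultimately have "1 * \<bar>?A - ?B\<bar> \<le> g * (8 * nm * (s * r)\<^sup>2 + 2 * nm * (s * r) * C)"
      by (intro mult_mono) auto
    then show ?thesis by simp
  qed
  then show ?thesis unfolding g_def C_def R_def nm_def .
qed

end

section \<open>Occupation estimates\<close>

lemma noise_clip_moments:
  assumes h: "0 < h" and r: "0 \<le> r" and ij: "i \<in> {1..n}" "j \<in> {1..n}" "i \<noteq> j"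
  shows "integrable (noise h n) (\<lambda>z. clip r (z i))" "(\<integral>z. clip r (z i) \<partial>noise h n) = 0"
    and "integrable (noise h n) (\<lambda>z. (clip r (z i) - clip r (z j))\<^sup>2)"
    and "(\<integral>z. (clip r (z i) - clip r (z j))\<^sup>2 \<partial>noise h n) = 2 * clip_var h r"
proof -
  note m [measurable] = measurable_noise_coord[OF ij(1), of h] measurable_noise_coord[OF ij(2), of h]
  note c = abs_clip_le[OF r]
  have c2: "(clip r u)\<^sup>2 \<le> r\<^sup>2" for u using c[of u] r by (metis abs_le_square_iff abs_of_nonneg)
  show "integrable (noise h n) (\<lambda>z. clip r (z i))"
    by (rule integrable_prob_bounded[OF prob_space_noise[OF h], where B = r]) (auto simp: c)
  show "(\<integral>z. clip r (z i) \<partial>noise h n) = 0"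
    using noise_coord[OF h measurable_clip ij(1), of r] integral_clip[OF r, of h] by simp
  have isq: "integrable (noise h n) (\<lambda>z. (clip r (z k))\<^sup>2)" if "k \<in> {1..n}" for k
  proof -
    note [measurable] = measurable_noise_coord[OF that, of h]
    show ?thesis
      by (rule integrable_prob_bounded[OF prob_space_noise[OF h], where B = "r\<^sup>2"]) (auto simp: c2)
  qed
  have ipr: "integrable (noise h n) (\<lambda>z. clip r (z i) * clip r (z j))"
    by (rule integrable_prob_bounded[OF prob_space_noise[OF h], where B = "r * r"])
      (auto simp: c r abs_mult intro!: mult_mono)
  have eq: "(clip r (z i) - clip r (z j))\<^sup>2
      = (clip r (z i))\<^sup>2 + (clip r (z j))\<^sup>2 - 2 * (clip r (z i) * clip r (z j))" for z :: "nat \<Rightarrow> real"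
    by (simp add: power2_diff)
  show "integrable (noise h n) (\<lambda>z. (clip r (z i) - clip r (z j))\<^sup>2)"
    unfolding eq using isq[OF ij(1)] isq[OF ij(2)] ipr by simp
  have sq: "(\<integral>z. (clip r (z k))\<^sup>2 \<partial>noise h n) = clip_var h r" if "k \<in> {1..n}" for k
    unfolding clip_var_def by (rule noise_coord[OF h _ that]) simp
  have "(\<integral>z. clip r (z i) * clip r (z j) \<partial>noise h n) = 0"
    using noise_pair[OF h measurable_clip measurable_clip c c ij] integral_clip[OF r, of h] by simp
  then show "(\<integral>z. (clip r (z i) - clip r (z j))\<^sup>2 \<partial>noise h n) = 2 * clip_var h r"
    unfolding eq using isq[OF ij(1)] isq[OF ij(2)] ipr sq[OF ij(1)] sq[OF ij(2)] by simp
qed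

lemma measurable_gap_energy [measurable]:
  "gap_energy n \<in> borel_measurable (PiM {1..n} (\<lambda>_. borel))"
  unfolding gap_energy_def
proof (intro borel_measurable_sum)
  fix j assume j: "j \<in> {1..<n}"
  have [measurable]: "(\<lambda>x. x j) \<in> borel_measurable (PiM {1..n} (\<lambda>_. borel :: real measure))"
    "(\<lambda>x. x (Suc j)) \<in> borel_measurable (PiM {1..n} (\<lambda>_. borel :: real measure))"
    by (rule measurable_component_singleton, use j in auto)+
  show "(\<lambda>x. (x j - x (Suc j))\<^sup>2) \<in> borel_measurable (PiM {1..n} (\<lambda>_. borel :: real measure))"
    by measurable
qed

lemma measurable_top_excess [measurable]:
  "top_excess n \<in> borel_measurable (PiM {1..n} (\<lambda>_. borel))"
  unfolding top_excess_def
proof (intro borel_measurable_sum)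
  fix j assume j: "j \<in> {1..n}"
  have [measurable]: "(\<lambda>x. x j) \<in> borel_measurable (PiM {1..n} (\<lambda>_. borel :: real measure))"
    "(\<lambda>x. x 1) \<in> borel_measurable (PiM {1..n} (\<lambda>_. borel :: real measure))"
    by (rule measurable_component_singleton, use j in auto)+
  show "(\<lambda>x. x 1 - x j) \<in> borel_measurable (PiM {1..n} (\<lambda>_. borel :: real measure))"
    by measurable
qed

definition lyapunov :: "nat \<Rightarrow> nat \<Rightarrow> nat \<Rightarrow> real \<Rightarrow> real \<Rightarrow> real \<Rightarrow> (nat \<Rightarrow> real) \<Rightarrow> real" where
  "lyapunov n i j a R K x = huber R (x i - x j - a) + K * top_excess n x"

lemma measurable_lyapunov:
  assumes "i \<in> {1..n}" "j \<in> {1..n}"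
  shows "lyapunov n i j a R K \<in> borel_measurable (PiM {1..n} (\<lambda>_. borel))"
proof -
  have [measurable]: "(\<lambda>x. x i) \<in> borel_measurable (PiM {1..n} (\<lambda>_. borel :: real measure))"
    "(\<lambda>x. x j) \<in> borel_measurable (PiM {1..n} (\<lambda>_. borel :: real measure))"
    by (rule measurable_component_singleton, use assms in auto)+
  show ?thesis unfolding lyapunov_def by measurable
qed

lemma bounded_gap_energy:
  assumes "\<And>j. j \<in> {1..n} \<Longrightarrow> \<bar>x j\<bar> \<le> B"
  shows "gap_energy n x \<le> n * (2 * B)\<^sup>2"
proof -
  have "gap_energy n x \<le> (\<Sum>j\<in>{1..<n}. (2 * B)\<^sup>2)"
    unfolding gap_energy_def
  proof (rule sum_mono)
    fix j assume "j \<in> {1..<n}"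
    then have "\<bar>x j - x (Suc j)\<bar> \<le> \<bar>2 * B\<bar>" using assms[of j] assms[of "Suc j"] by auto
    then show "(x j - x (Suc j))\<^sup>2 \<le> (2 * B)\<^sup>2" by (simp add: abs_le_square_iff)
  qed
  also have "\<dots> \<le> n * (2 * B)\<^sup>2" by (simp add: mult_right_mono)
  finally show ?thesis .
qed

context oblique
begin

lemma move_bounded:
  assumes "weyl_minus n x" "0 \<le> r" "j \<in> {1..n}"
  shows "\<bar>move n r x z j - x j\<bar> \<le> spread n * r"
  unfolding move_eq
  by (rule reflect_step(2)[where \<xi> = "\<lambda>j. clip r (z j)", OF assms(1,2) abs_clip_le[OF assms(2)] assms(3)])

text \<open>Reflection does not enlarge any gap (\<open>reflect_gap_le\<close>), so each squared gap
  gains on average at most the variance of a difference of two independent noises, that is 2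
  \<open>clip_var h r\<close> <= 2 h.\<close>

lemma gap_energy_move:
  assumes h: "0 < h" and r: "0 < r" "6 * h \<le> r\<^sup>2" and x: "weyl_minus n x"
  shows "(\<integral>z. gap_energy n (move n r x z) \<partial>noise h n) \<le> gap_energy n x + 2 * n * h"
proof -
  have r0: "0 \<le> r" using r by simp
  define \<zeta> where "\<zeta> j z = clip r (z j) - clip r (z (Suc j))" for j and z :: "nat \<Rightarrow> real"
  have z1: "integrable (noise h n) (\<zeta> j)" "(\<integral>z. \<zeta> j z \<partial>noise h n) = 0"
    "integrable (noise h n) (\<lambda>z. (\<zeta> j z)\<^sup>2)" "(\<integral>z. (\<zeta> j z)\<^sup>2 \<partial>noise h n) = 2 * clip_var h r"
    if "j \<in> {1..<n}" for j
    using that noise_clip_moments[OF h r0, of j n "Suc j"] noise_clip_moments[OF h r0, of "Suc j" n j]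
    unfolding \<zeta>_def by auto
  have eq: "(x j - x (Suc j) + \<zeta> j z)\<^sup>2
      = (x j - x (Suc j))\<^sup>2 + 2 * (x j - x (Suc j)) * \<zeta> j z + (\<zeta> j z)\<^sup>2" for j z
    by (simp add: power2_eq_square algebra_simps)
  have i2: "integrable (noise h n) (\<lambda>z. (x j - x (Suc j) + \<zeta> j z)\<^sup>2)" if "j \<in> {1..<n}" for j
    unfolding eq using z1[OF that] prob_space_noise[OF h, of n]
    by (intro Bochner_Integration.integrable_add integrable_mult_right) (auto intro: integrable_prob_bounded)
  have e2: "(\<integral>z. (x j - x (Suc j) + \<zeta> j z)\<^sup>2 \<partial>noise h n) = (x j - x (Suc j))\<^sup>2 + 2 * clip_var h r"
    if "j \<in> {1..<n}" for j
  proof -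
    interpret prob_space "noise h n" by (rule prob_space_noise[OF h])
    show ?thesis unfolding eq using z1[OF that] prob_space by simp
  qed
  have "(\<integral>z. gap_energy n (move n r x z) \<partial>noise h n)
      \<le> (\<integral>z. (\<Sum>j\<in>{1..<n}. (x j - x (Suc j) + \<zeta> j z)\<^sup>2) \<partial>noise h n)"
  proof (rule integral_mono')
    show "integrable (noise h n) (\<lambda>z. (\<Sum>j\<in>{1..<n}. (x j - x (Suc j) + \<zeta> j z)\<^sup>2))"
      by (intro Bochner_Integration.integrable_sum i2)
    show "gap_energy n (move n r x z) \<le> (\<Sum>j\<in>{1..<n}. (x j - x (Suc j) + \<zeta> j z)\<^sup>2)" for z
      unfolding gap_energy_def
    proof (rule sum_mono)
      fix j assume j: "j \<in> {1..<n}"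
      have "\<bar>move n r x z j - move n r x z (Suc j)\<bar> \<le> \<bar>x j - x (Suc j) + \<zeta> j z\<bar>"
        using reflect_gap_le[OF j, of "\<lambda>j. x j + clip r (z j)"] by (simp add: move_eq \<zeta>_def algebra_simps)
      then show "(move n r x z j - move n r x z (Suc j))\<^sup>2 \<le> (x j - x (Suc j) + \<zeta> j z)\<^sup>2"
        by (simp add: abs_le_square_iff)
    qed
    show "0 \<le> (\<Sum>j\<in>{1..<n}. (x j - x (Suc j) + \<zeta> j z)\<^sup>2)" for z by (simp add: sum_nonneg)
  qed
  also have "\<dots> = (\<Sum>j\<in>{1..<n}. (x j - x (Suc j))\<^sup>2 + 2 * clip_var h r)"
    by (subst Bochner_Integration.integral_sum) (use i2 e2 in auto)
  also have "\<dots> = gap_energy n x + real (n - 1) * (2 * clip_var h r)"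
    by (simp add: sum.distrib gap_energy_def)
  also have "\<dots> \<le> gap_energy n x + n * (2 * h)"
    using clip_var_bounds[OF h r] h by (intro add_left_mono mult_mono) auto
  finally show ?thesis by (simp add: mult_ac)
qed

text \<open>By \<open>sum_push_shift\<close> with constant weights the pushes change the sum of the
  coordinates by q - p times their total, downwards, and the first particle itself is only pushed
  upwards.\<close>

lemma top_excess_move:
  fixes x z :: "nat \<Rightarrow> real" and r :: real
  assumes "1 \<le> n"
  defines "l \<equiv> \<lambda>z. push n (\<lambda>j. x j + clip r (z j))"
  shows "top_excess n x + (\<Sum>j\<in>{1..n}. clip r (z 1) - clip r (z j)) + (q - p) * (\<Sum>j\<in>{1..<n}. l z j)
    \<le> top_excess n (move n r x z)"
proof -
  have mv: "move n r x z j = x j + clip r (z j) + (p * l z j - q * l z (j - 1))" if "j \<in> {1..n}" for j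
    using that by (simp add: move_eq reflect_def l_def)
  have "top_excess n (move n r x z) = top_excess n x + (\<Sum>j\<in>{1..n}. clip r (z 1) - clip r (z j))
      + (real n * (p * l z 1 - q * l z 0) - (\<Sum>j\<in>{1..n}. 1 * (p * l z j - q * l z (j - 1))))"
    unfolding top_excess_def using assms(1)
    by (simp add: mv sum.distrib sum_subtractf algebra_simps)
  also have "(\<Sum>j\<in>{1..n}. 1 * (p * l z j - q * l z (j - 1))) = (\<Sum>j\<in>{1..<n}. l z j * (p * 1 - q * 1))"
    by (rule sum_push_shift) (auto simp: l_def push_outside)
  also have "\<dots> = - (q - p) * (\<Sum>j\<in>{1..<n}. l z j)"
    by (simp add: sum_distrib_left algebra_simps)
  finally have "top_excess n (move n r x z) = top_excess n x + (\<Sum>j\<in>{1..n}. clip r (z 1) - clip r (z j))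
      + (real n * (p * l z 1 - q * l z 0) - - (q - p) * (\<Sum>j\<in>{1..<n}. l z j))" .
  moreover have "0 \<le> real n * (p * l z 1 - q * l z 0)"
    using p_pos push_nonneg[of n _ 1] by (simp add: l_def push_outside)
  ultimately show ?thesis by (simp add: algebra_simps)
qed

text \<open>Discrete counterpart of Tanaka's formula: the excess of the top particle absorbs the pushing
  terms, so the Lyapunov function gains the variance of one step whenever the difference is near \<open>a\<close>.\<close>
lemma lyapunov_move:
  fixes a :: real
  assumes h: "0 < h" and r: "0 < r" "6 * h \<le> r\<^sup>2" and x: "weyl_minus n x"
    and ij: "i \<in> {1..n}" "j \<in> {1..n}" "i \<noteq> j" and R: "0 \<le> R"
  defines "f \<equiv> lyapunov n i j a (R + 2 * r) (2 * (R + 2 * r) / (q - p))"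
  shows "f x + h / 2 * near R (x i - x j - a) \<le> (\<integral>z. f (move n r x z) \<partial>noise h n)"
proof -
  interpret prob_space "noise h n" by (rule prob_space_noise[OF h])
  have r0: "0 \<le> r" and n: "1 \<le> n" using r ij by auto
  define R' where "R' = R + 2 * r"
  \<comment> \<open>With K (q - p) = 2 R' the pushing gain in \<open>top_excess\<close> pays for the
    loss in the Huber term: the pushes alter a difference of two coordinates by at most twice their
    total, and the Huber slope is at most R'.\<close>
  define K where "K = 2 * R' / (q - p)"
  have R': "0 \<le> R'" and K: "0 \<le> K" "K * (q - p) = 2 * R'"
    using R r q_minus_p by (auto simp: R'_def K_def)
  define l where "l z = push n (\<lambda>j. x j + clip r (z j))" for z
  define \<zeta> where "\<zeta> z = clip r (z i) - clip r (z j)" for z :: "nat \<Rightarrow> real"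
  define s where "s = x i - x j - a"
  \<comment> \<open>A pointwise lower bound for the new value, explicit in the noise. Its linear
    terms are centred, so in expectation only the quadratic one contributes.\<close>
  define g where "g z = f x + clip R' s * \<zeta> z + near R s / 2 * (\<zeta> z)\<^sup>2
    + K * (\<Sum>j\<in>{1..n}. clip r (z 1) - clip r (z j))" for z
  have ic: "integrable (noise h n) (\<lambda>z. clip r (z k))" "(\<integral>z. clip r (z k) \<partial>noise h n) = 0"
    if "k \<in> {1..n}" for k
  proof -
    have "k \<noteq> i \<or> k \<noteq> j" using ij by auto
    then show "integrable (noise h n) (\<lambda>z. clip r (z k))" "(\<integral>z. clip r (z k) \<partial>noise h n) = 0"
      using noise_clip_moments[OF h r0 that] ij by blast+
  qed
  have i\<zeta>: "integrable (noise h n) \<zeta>" "(\<integral>z. \<zeta> z \<partial>noise h n) = 0"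
    unfolding \<zeta>_def using ic[OF ij(1)] ic[OF ij(2)] by auto
  have i\<zeta>2: "integrable (noise h n) (\<lambda>z. (\<zeta> z)\<^sup>2)" "(\<integral>z. (\<zeta> z)\<^sup>2 \<partial>noise h n) = 2 * clip_var h r"
    unfolding \<zeta>_def using noise_clip_moments[OF h r0 ij] by auto
  have id: "integrable (noise h n) (\<lambda>z. clip r (z 1) - clip r (z k))"
    "(\<integral>z. clip r (z 1) - clip r (z k) \<partial>noise h n) = 0" if "k \<in> {1..n}" for k
    using ic[OF that] ic[of 1] n by auto
  have isum: "integrable (noise h n) (\<lambda>z. \<Sum>k\<in>{1..n}. clip r (z 1) - clip r (z k))"
    by (intro Bochner_Integration.integrable_sum id)
  have esum: "(\<integral>z. (\<Sum>k\<in>{1..n}. clip r (z 1) - clip r (z k)) \<partial>noise h n) = 0"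
    by (subst Bochner_Integration.integral_sum) (use id in auto)
  have ig: "integrable (noise h n) g"
    unfolding g_def by (intro Bochner_Integration.integrable_add integrable_mult_right isum i\<zeta> i\<zeta>2) simp
  have "(\<integral>z. g z \<partial>noise h n) = f x + near R s * clip_var h r"
    unfolding g_def using i\<zeta> i\<zeta>2 isum esum prob_space by simp
  moreover have "near R s * (h / 2) \<le> near R s * clip_var h r"
    using clip_var_bounds(1)[OF h r] near_nonneg by (intro mult_left_mono)
  moreover have "(\<integral>z. g z \<partial>noise h n) \<le> (\<integral>z. f (move n r x z) \<partial>noise h n)"
  proof (rule integral_mono[OF ig])
    define B where "B = (\<Sum>j\<in>{1..n}. \<bar>x j\<bar>) + spread n * r"
    have B: "\<bar>move n r x z k\<bar> \<le> B" if "k \<in> {1..n}" for z k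
    proof -
      have "\<bar>x k\<bar> \<le> (\<Sum>j\<in>{1..n}. \<bar>x j\<bar>)" by (rule member_le_sum) (use that in auto)
      then show ?thesis using move_bounded[OF x r0 that, of z] by (simp add: B_def)
    qed
    show "integrable (noise h n) (\<lambda>z. f (move n r x z))"
    proof (rule integrable_prob_bounded[OF prob_space_axioms])
      have "(\<lambda>z. move n r x z) \<in> noise h n \<rightarrow>\<^sub>M PiM {1..n} (\<lambda>_. borel)"
        by (rule measurable_move) (auto intro: measurable_noise_coord)
      then show "(\<lambda>z. f (move n r x z)) \<in> borel_measurable (noise h n)"
        unfolding f_def by (rule measurable_compose[OF _ measurable_lyapunov[OF ij(1,2)]])
      fix z
      have "\<bar>huber R' (move n r x z i - move n r x z j - a)\<bar> \<le> R' * (2 * B + \<bar>a\<bar>)"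
      proof -
        have "huber R' 0 = 0" using R' by (simp add: huber_def clip_def)
        then have "\<bar>huber R' (move n r x z i - move n r x z j - a)\<bar> \<le> R' * \<bar>move n r x z i - move n r x z j - a\<bar>"
          using huber_Lipschitz[OF R', of "move n r x z i - move n r x z j - a" 0] by simp
        also have "\<dots> \<le> R' * (2 * B + \<bar>a\<bar>)"
          using B[OF ij(1), of z] B[OF ij(2), of z] R' by (intro mult_left_mono) auto
        finally show ?thesis .
      qed
      moreover have "\<bar>K * top_excess n (move n r x z)\<bar> \<le> K * (n * (n + n * (2 * B)\<^sup>2))"
      proof -
        have "top_excess n (move n r x z) \<le> n * (n + gap_energy n (move n r x z))"
          by (rule top_excess_bounds[OF move_weyl])
        also have "\<dots> \<le> n * (n + n * (2 * B)\<^sup>2)"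
          using bounded_gap_energy[of n "move n r x z" B] B by (intro mult_left_mono add_left_mono) auto
        finally show ?thesis
          using top_excess_bounds(1)[OF move_weyl, of n r x z] K(1) by (simp add: abs_mult mult_left_mono)
      qed
      ultimately show "\<bar>f (move n r x z)\<bar> \<le> R' * (2 * B + \<bar>a\<bar>) + K * (n * (n + n * (2 * B)\<^sup>2))"
        unfolding f_def lyapunov_def R'_def[symmetric] K_def[symmetric] by linarith
    qed
    fix z
    define L where "L = (\<Sum>j\<in>{1..<n}. l z j)"
    have lL: "l z k \<le> L" "0 \<le> l z k" "0 \<le> L" for k
    proof -
      show "0 \<le> l z k" "0 \<le> L" by (auto simp: l_def L_def push_nonneg intro: sum_nonneg)
      then show "l z k \<le> L"
        unfolding L_def using push_outside[of k n] member_le_sum[of k "{1..<n}" "l z"]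
        by (cases "k \<in> {1..<n}") (auto simp: l_def push_nonneg)
    qed
    have mv: "move n r x z k = x k + clip r (z k) + (p * l z k - q * l z (k - 1))" if "k \<in> {1..n}" for k
      using that by (simp add: move_eq reflect_def l_def)
    have pq: "\<bar>p * l z k - q * l z k'\<bar> \<le> L" for k k'
    proof -
      have "p * l z k \<le> l z k" "q * l z k' \<le> l z k'"
        using lL(2) p_less_1 q_less_1 p_pos q_pos by (auto intro!: mult_left_le_one_le)
      moreover have "l z k \<le> L" "l z k' \<le> L" by (rule lL(1))+
      moreover have "0 \<le> p * l z k" "0 \<le> q * l z k'" using lL p_pos q_pos by auto
      ultimately show ?thesis by linarith
    qed
    have "\<bar>(move n r x z i - move n r x z j - a) - (s + \<zeta> z)\<bar> \<le> 2 * L"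
      using pq[of i "i - 1"] pq[of j "j - 1"] unfolding mv[OF ij(1)] mv[OF ij(2)] s_def \<zeta>_def by linarith
    then have "R' * \<bar>(move n r x z i - move n r x z j - a) - (s + \<zeta> z)\<bar> \<le> R' * (2 * L)"
      using R' by (intro mult_left_mono)
    then have "huber R' (s + \<zeta> z) - R' * (2 * L) \<le> huber R' (move n r x z i - move n r x z j - a)"
      using huber_Lipschitz[OF R', of "move n r x z i - move n r x z j - a" "s + \<zeta> z"] by linarith
    moreover have "huber R' s + clip R' s * \<zeta> z + near R s * (\<zeta> z)\<^sup>2 / 2 \<le> huber R' (s + \<zeta> z)"
      unfolding R'_def
      by (rule huber_convex[OF R r0]) (use abs_clip_le[OF r0, of "z i"] abs_clip_le[OF r0, of "z j"] in \<open>auto simp: \<zeta>_def\<close>)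
    moreover have "K * (top_excess n x + (\<Sum>j\<in>{1..n}. clip r (z 1) - clip r (z j)) + (q - p) * L)
        \<le> K * top_excess n (move n r x z)"
      unfolding L_def l_def by (intro mult_left_mono top_excess_move n K(1))
    moreover have "K * ((q - p) * L) = R' * (2 * L)" using K(2) by (metis mult.assoc mult.commute)
    ultimately show "g z \<le> f (move n r x z)"
      unfolding g_def f_def lyapunov_def R'_def[symmetric] K_def[symmetric] s_def[symmetric]
      by (simp add: distrib_left)
  qed
  ultimately show ?thesis unfolding s_def by (simp add: mult.commute)
qed

end

text \<open>The Markov property is recorded as the transition of expectations over one step,
  including integrability of the averaged function, so that inequalities can be integrated.
  Boundedness is uniform over paths for each fixed step count, as the truncated noise
  allows.\<close>

locale reflected_walk = oblique p q + prob_space M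
  for p q :: real and M :: "'a measure" +
  fixes n :: nat and h r :: real and x0 :: "nat \<Rightarrow> real" and X :: "nat \<Rightarrow> 'a \<Rightarrow> nat \<Rightarrow> real"
  assumes h_pos: "0 < h" and r_pos: "0 < r" and r_h: "6 * h \<le> r\<^sup>2"
    and X_0: "\<And>\<omega> j. j \<in> {1..n} \<Longrightarrow> X 0 \<omega> j = x0 j"
    and measurable_X [measurable]: "\<And>k. X k \<in> M \<rightarrow>\<^sub>M PiM {1..n} (\<lambda>_. borel)"
    and X_weyl: "\<And>k \<omega>. weyl_minus n (X k \<omega>)"
    and X_bounded: "\<And>k. \<exists>B. \<forall>\<omega>. \<forall>j\<in>{1..n}. \<bar>X k \<omega> j\<bar> \<le> B"
    and X_step: "\<And>k (f :: (nat \<Rightarrow> real) \<Rightarrow> real). f \<in> borel_measurable (PiM {1..n} (\<lambda>_. borel)) \<Longrightarrow>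
      integrable M (\<lambda>\<omega>. f (X (Suc k) \<omega>)) \<Longrightarrow>
      integrable M (\<lambda>\<omega>. \<integral>z. f (move n r (X k \<omega>) z) \<partial>noise h n) \<and>
      (\<integral>\<omega>. f (X (Suc k) \<omega>) \<partial>M) = (\<integral>\<omega>. (\<integral>z. f (move n r (X k \<omega>) z) \<partial>noise h n) \<partial>M)"
begin

lemma measurable_X_coord: "j \<in> {1..n} \<Longrightarrow> (\<lambda>\<omega>. X k \<omega> j) \<in> borel_measurable M"
  using measurable_compose[OF measurable_X measurable_component_singleton] .

lemma integrable_gap_energy: "integrable M (\<lambda>\<omega>. gap_energy n (X k \<omega>))"
proof -
  obtain B where B: "\<And>\<omega> j. j \<in> {1..n} \<Longrightarrow> \<bar>X k \<omega> j\<bar> \<le> B" using X_bounded by blast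
  show ?thesis
    by (rule integrable_prob_bounded[OF prob_space_axioms, where B = "real n * (2 * B)\<^sup>2"])
      (use bounded_gap_energy[of n _ B] B gap_energy_nonneg in auto)
qed

lemma gap_energy_0: "gap_energy n (X 0 \<omega>) = gap_energy n x0"
  unfolding gap_energy_def by (intro sum.cong) (auto simp: X_0)

lemma expectation_gap_energy:
  "(\<integral>\<omega>. gap_energy n (X k \<omega>) \<partial>M) \<le> gap_energy n x0 + 2 * real n * (real k * h)"
proof (induction k)
  case 0
  then show ?case by (simp add: gap_energy_0 prob_space)
next
  case (Suc k)
  note step = X_step[where k = k, OF measurable_gap_energy, OF integrable_gap_energy]
  have "(\<integral>\<omega>. gap_energy n (X (Suc k) \<omega>) \<partial>M)
      = (\<integral>\<omega>. (\<integral>z. gap_energy n (move n r (X k \<omega>) z) \<partial>noise h n) \<partial>M)"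
    using step by blast
  also have "\<dots> \<le> (\<integral>\<omega>. gap_energy n (X k \<omega>) + 2 * real n * h \<partial>M)"
  proof (rule integral_mono)
    show "integrable M (\<lambda>\<omega>. gap_energy n (X k \<omega>) + 2 * real n * h)"
      using integrable_gap_energy by simp
    show "(\<integral>z. gap_energy n (move n r (X k \<omega>) z) \<partial>noise h n) \<le> gap_energy n (X k \<omega>) + 2 * real n * h" for \<omega>
      by (rule gap_energy_move[OF h_pos r_pos r_h X_weyl])
  qed (use step in blast)
  also have "\<dots> = (\<integral>\<omega>. gap_energy n (X k \<omega>) \<partial>M) + 2 * real n * h"
    using integrable_gap_energy prob_space by simp
  also have "\<dots> \<le> gap_energy n x0 + 2 * real n * (real (Suc k) * h)" using Suc by (simp add: algebra_simps)
  finally show ?case .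
qed

text \<open>It depends on the horizon and the initial gaps but not on \<open>h\<close> or
  \<open>r\<close>; this uniformity is what survives the refinement of the mesh.\<close>

definition occ :: "real \<Rightarrow> real" where
  "occ T = 8 * (real n + (gap_energy n x0 + 2 * real n * T)) * (1 + real n / (q - p))"

lemma occ_nonneg: "0 \<le> T \<Longrightarrow> 0 \<le> occ T"
  using q_minus_p gap_energy_nonneg[of n x0] by (auto simp: occ_def)

text \<open>The one-step gains of \<open>lyapunov_move\<close> telescope. The Huber slope and the
  weight of \<open>top_excess\<close> are both of order R, so the total growth is \<open>R\<close>
  times a quantity controlled by the expected gap energy. The bound is uniform in the centre
  \<open>a\<close>, which the estimate for two walks relies on.\<close>

lemma occupation:
  assumes ij: "i \<in> {1..n}" "j \<in> {1..n}" "i \<noteq> j" and R: "2 * r \<le> R" and T: "real N * h \<le> T"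
  shows "h * (\<Sum>k<N. \<integral>\<omega>. near R (X k \<omega> i - X k \<omega> j - a) \<partial>M) \<le> R * occ T"
proof -
  have R0: "0 \<le> R" using R r_pos by simp
  define R' where "R' = R + 2 * r"
  define K where "K = 2 * R' / (q - p)"
  define f where "f = lyapunov n i j a R' K"
  \<comment> \<open>2 r <= R makes the widened threshold R + 2 r at most 2 R, so that the final
    bound is linear in \<open>R\<close>.\<close>
  have R': "0 \<le> R'" "R' \<le> 2 * R" and K: "0 \<le> K" "K \<le> 4 * R / (q - p)"
    using R r_pos q_minus_p by (auto simp: R'_def K_def intro!: divide_right_mono)
  note mf = measurable_lyapunov[OF ij(1,2), of a R' K, folded f_def]
  note mi = measurable_X_coord[OF ij(1)] measurable_X_coord[OF ij(2)]
  have diff: "f (X N \<omega>) - f (X 0 \<omega>) \<le> R' * (2 * real n + gap_energy n (X N \<omega>) + gap_energy n x0)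
      + K * (real n * (real n + gap_energy n (X N \<omega>)))" for N \<omega>
  proof -
    have "huber R' (X N \<omega> i - X N \<omega> j - a) - huber R' (X 0 \<omega> i - X 0 \<omega> j - a)
        \<le> R' * \<bar>(X N \<omega> i - X N \<omega> j - a) - (X 0 \<omega> i - X 0 \<omega> j - a)\<bar>"
      using huber_Lipschitz[OF R'(1), of "X N \<omega> i - X N \<omega> j - a" "X 0 \<omega> i - X 0 \<omega> j - a"] by linarith
    also have "\<dots> \<le> R' * (2 * real n + gap_energy n (X N \<omega>) + gap_energy n x0)"
      using diameter_le[OF X_weyl ij(1,2), of N \<omega>] diameter_le[OF X_weyl ij(1,2), of 0 \<omega>]
      unfolding gap_energy_0 by (intro mult_left_mono R') linarith
    finally have "huber R' (X N \<omega> i - X N \<omega> j - a) - huber R' (X 0 \<omega> i - X 0 \<omega> j - a)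
        \<le> R' * (2 * real n + gap_energy n (X N \<omega>) + gap_energy n x0)" .
    moreover have "K * top_excess n (X N \<omega>) \<le> K * (real n * (real n + gap_energy n (X N \<omega>)))"
      by (intro mult_left_mono K top_excess_bounds X_weyl)
    moreover have "0 \<le> K * top_excess n (X 0 \<omega>)"
      using K top_excess_bounds(1)[OF X_weyl] by simp
    ultimately show ?thesis unfolding f_def lyapunov_def by linarith
  qed
  have intf: "integrable M (\<lambda>\<omega>. f (X k \<omega>))" for k
  proof -
    obtain B where B: "\<And>\<omega> j. j \<in> {1..n} \<Longrightarrow> \<bar>X k \<omega> j\<bar> \<le> B" using X_bounded by blast
    show ?thesis
    proof (rule integrable_prob_bounded[OF prob_space_axioms])
      show "(\<lambda>\<omega>. f (X k \<omega>)) \<in> borel_measurable M" by (rule measurable_compose[OF measurable_X mf])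
      fix \<omega>
      have ge: "gap_energy n (X k \<omega>) \<le> real n * (2 * B)\<^sup>2" by (rule bounded_gap_energy) (rule B)
      have "f (X k \<omega>) \<le> f (X 0 \<omega>) + (R' * (2 * real n + gap_energy n (X k \<omega>) + gap_energy n x0)
        + K * (real n * (real n + gap_energy n (X k \<omega>))))" using diff[of k \<omega>] by linarith
      also have "\<dots> \<le> f (X 0 \<omega>) + (R' * (2 * real n + real n * (2 * B)\<^sup>2 + gap_energy n x0)
        + K * (real n * (real n + real n * (2 * B)\<^sup>2)))"
        using ge by (intro add_left_mono add_mono mult_left_mono R' K add_right_mono) auto
      also have "f (X 0 \<omega>) = f x0"
      proof -
        have "top_excess n (X 0 \<omega>) = top_excess n x0"
          unfolding top_excess_def by (intro sum.cong) (auto simp: X_0)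
        then show ?thesis using X_0[OF ij(1)] X_0[OF ij(2)] by (simp add: f_def lyapunov_def)
      qed
      finally have "f (X k \<omega>) \<le> f x0 + (R' * (2 * real n + real n * (2 * B)\<^sup>2 + gap_energy n x0)
        + K * (real n * (real n + real n * (2 * B)\<^sup>2)))" .
      moreover have "0 \<le> f (X k \<omega>)"
        unfolding f_def lyapunov_def using huber_nonneg[OF R'(1)] K(1) top_excess_bounds(1)[OF X_weyl] by simp
      ultimately show "\<bar>f (X k \<omega>)\<bar> \<le> f x0 + (R' * (2 * real n + real n * (2 * B)\<^sup>2 + gap_energy n x0)
        + K * (real n * (real n + real n * (2 * B)\<^sup>2)))" by simp
    qed
  qed
  have inr: "integrable M (\<lambda>\<omega>. near R (X k \<omega> i - X k \<omega> j - a))" for k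
  proof (rule integrable_prob_bounded[OF prob_space_axioms, where B = 1])
    note [measurable] = mi[of k]
    show "(\<lambda>\<omega>. near R (X k \<omega> i - X k \<omega> j - a)) \<in> borel_measurable M" by measurable
  qed (use near_nonneg near_le_1 in auto)
  have "h / 2 * (\<integral>\<omega>. near R (X k \<omega> i - X k \<omega> j - a) \<partial>M) \<le> (\<integral>\<omega>. f (X (Suc k) \<omega>) \<partial>M) - (\<integral>\<omega>. f (X k \<omega>) \<partial>M)" for k
  proof -
    note step = X_step[where k = k, OF mf, OF intf]
    have "(\<integral>\<omega>. f (X k \<omega>) + h / 2 * near R (X k \<omega> i - X k \<omega> j - a) \<partial>M)
        \<le> (\<integral>\<omega>. (\<integral>z. f (move n r (X k \<omega>) z) \<partial>noise h n) \<partial>M)"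
    proof (rule integral_mono)
      show "f (X k \<omega>) + h / 2 * near R (X k \<omega> i - X k \<omega> j - a)
          \<le> (\<integral>z. f (move n r (X k \<omega>) z) \<partial>noise h n)" for \<omega>
        unfolding f_def K_def R'_def
        by (rule lyapunov_move[OF h_pos r_pos r_h X_weyl ij R0])
    qed (use intf inr step in auto)
    then show ?thesis using step intf inr by simp
  qed
  then have "(\<Sum>k<N. h / 2 * (\<integral>\<omega>. near R (X k \<omega> i - X k \<omega> j - a) \<partial>M))
      \<le> (\<Sum>k<N. (\<integral>\<omega>. f (X (Suc k) \<omega>) \<partial>M) - (\<integral>\<omega>. f (X k \<omega>) \<partial>M))" by (intro sum_mono)
  also have "\<dots> = (\<integral>\<omega>. f (X N \<omega>) \<partial>M) - (\<integral>\<omega>. f (X 0 \<omega>) \<partial>M)" by (rule sum_lessThan_telescope)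
  also have "\<dots> = (\<integral>\<omega>. f (X N \<omega>) - f (X 0 \<omega>) \<partial>M)" using intf by simp
  also have "\<dots> \<le> (\<integral>\<omega>. R' * (2 * real n + gap_energy n (X N \<omega>) + gap_energy n x0)
      + K * (real n * (real n + gap_energy n (X N \<omega>))) \<partial>M)"
    using intf integrable_gap_energy by (intro integral_mono diff) auto
  also have "\<dots> = R' * (2 * real n + (\<integral>\<omega>. gap_energy n (X N \<omega>) \<partial>M) + gap_energy n x0)
      + K * (real n * (real n + (\<integral>\<omega>. gap_energy n (X N \<omega>) \<partial>M)))"
    using integrable_gap_energy prob_space by simp
  also have "\<dots> \<le> (2 * R) * (2 * real n + (gap_energy n x0 + 2 * real n * T) + (gap_energy n x0 + 2 * real n * T))
      + (4 * R / (q - p)) * (real n * (real n + (gap_energy n x0 + 2 * real n * T)))"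
  proof -
    have T0: "0 \<le> T" using T h_pos by (meson less_imp_le mult_nonneg_nonneg of_nat_0_le_iff order_trans)
    have "2 * real n * (real N * h) \<le> 2 * real n * T" using T by (intro mult_left_mono) auto
    then have e: "(\<integral>\<omega>. gap_energy n (X N \<omega>) \<partial>M) \<le> gap_energy n x0 + 2 * real n * T"
      using expectation_gap_energy[of N] by linarith
    have e0: "0 \<le> (\<integral>\<omega>. gap_energy n (X N \<omega>) \<partial>M)"
      by (intro Bochner_Integration.integral_nonneg gap_energy_nonneg)
    show ?thesis
      using e e0 T0 R' K gap_energy_nonneg[of n x0] R0
      by (intro add_mono mult_mono mult_left_mono add_left_mono) auto
  qed
  also have "\<dots> = R * occ T / 2" using q_minus_p by (simp add: occ_def field_simps)
  finally have "2 * (\<Sum>k<N. h / 2 * (\<integral>\<omega>. near R (X k \<omega> i - X k \<omega> j - a) \<partial>M)) \<le> R * occ T" by simp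
  then show ?thesis unfolding sum_distrib_left by simp
qed

lemma measurable_small_gap: "(\<lambda>\<omega>. small_gap n R (X k \<omega>)) \<in> borel_measurable M"
  unfolding small_gap_def
proof (intro borel_measurable_sum)
  fix j assume "j \<in> {1..<n}"
  then have [measurable]: "(\<lambda>\<omega>. X k \<omega> j) \<in> borel_measurable M" "(\<lambda>\<omega>. X k \<omega> (Suc j)) \<in> borel_measurable M"
    by (auto intro: measurable_X_coord)
  show "(\<lambda>\<omega>. near R (X k \<omega> j - X k \<omega> (Suc j))) \<in> borel_measurable M" by measurable
qed

lemma small_gap_le: "small_gap n R x \<le> n"
proof -
  have "small_gap n R x \<le> (\<Sum>j\<in>{1..<n}. 1)"
    unfolding small_gap_def by (intro sum_mono near_le_1)
  also have "\<dots> \<le> real n" by simp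
  finally show ?thesis .
qed

lemma integrable_small_gap: "integrable M (\<lambda>\<omega>. small_gap n R (X k \<omega>))"
  by (rule integrable_prob_bounded[OF prob_space_axioms measurable_small_gap, where B = n])
    (use small_gap_nonneg small_gap_le in auto)

lemma occupation_small_gap:
  assumes R: "2 * r \<le> R" and T: "real N * h \<le> T"
  shows "h * (\<Sum>k<N. \<integral>\<omega>. small_gap n R (X k \<omega>) \<partial>M) \<le> real n * (R * occ T)"
proof -
  have T0: "0 \<le> T" using T h_pos by (meson less_imp_le mult_nonneg_nonneg of_nat_0_le_iff order_trans)
  have i: "integrable M (\<lambda>\<omega>. near R (X k \<omega> j - X k \<omega> (Suc j)))" if "j \<in> {1..<n}" for j k
  proof (rule integrable_prob_bounded[OF prob_space_axioms, where B = 1])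
    have [measurable]: "(\<lambda>\<omega>. X k \<omega> j) \<in> borel_measurable M" "(\<lambda>\<omega>. X k \<omega> (Suc j)) \<in> borel_measurable M"
      using that by (auto intro: measurable_X_coord)
    show "(\<lambda>\<omega>. near R (X k \<omega> j - X k \<omega> (Suc j))) \<in> borel_measurable M" by measurable
  qed (use near_nonneg near_le_1 in auto)
  have "h * (\<Sum>k<N. \<integral>\<omega>. small_gap n R (X k \<omega>) \<partial>M)
      = h * (\<Sum>k<N. \<Sum>j\<in>{1..<n}. \<integral>\<omega>. near R (X k \<omega> j - X k \<omega> (Suc j)) \<partial>M)"
    unfolding small_gap_def by (subst Bochner_Integration.integral_sum) (use i in auto)
  also have "\<dots> = (\<Sum>j\<in>{1..<n}. h * (\<Sum>k<N. \<integral>\<omega>. near R (X k \<omega> j - X k \<omega> (Suc j) - 0) \<partial>M))"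
    by (subst sum.swap) (simp add: sum_distrib_left)
  also have "\<dots> \<le> (\<Sum>j\<in>{1..<n}. R * occ T)"
    by (intro sum_mono occupation R T) auto
  also have "\<dots> \<le> real n * (R * occ T)"
    using R r_pos occ_nonneg[OF T0] by (simp add: mult_right_mono)
  finally show ?thesis .
qed

end

section \<open>Two independent walks\<close>

locale two_walks = X: reflected_walk p q M n h r x0 X + W: reflected_walk p q N m h r w0 W
  for p q :: real and M :: "'a measure" and n and h r x0 X and N :: "'b measure" and m w0 W +
  fixes \<delta> :: real
  assumes \<delta>: "0 \<le> \<delta>" "\<delta> \<le> 1"
begin

sublocale P: pair_prob_space M N ..

abbreviation \<tau> :: real where "\<tau> \<equiv> p / q"

definition s :: real where "s = X.spread n + X.spread m"

lemma s_pos: "0 < s"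
  using X.spread_ge_1[of n] X.spread_ge_1[of m] by (simp add: s_def)

definition R :: real where "R = 2 * (s * r)"

lemma R_ge: "2 * r \<le> R" and R_pos: "0 < R"
  using X.spread_ge_1[of n] X.spread_ge_1[of m] X.r_pos mult_right_mono[of 1 s r] s_pos
  by (auto simp: R_def s_def)

text \<open>The product measure makes the walks independent, and each has its own step count.
  \<open>A K 0\<close> and \<open>A 0 K\<close> are the two sides of the duality at time K
  h.\<close>

definition A :: "nat \<Rightarrow> nat \<Rightarrow> real" where
  "A k l = (\<integral>y. phi \<delta> \<tau> n m (X k (fst y)) (W l (snd y)) \<partial>(M \<Otimes>\<^sub>M N))"

lemma measurable_X_fst: "j \<in> {1..n} \<Longrightarrow> (\<lambda>y. X k (fst y) j) \<in> borel_measurable (M \<Otimes>\<^sub>M N)"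
  using measurable_compose[OF measurable_fst X.measurable_X_coord] .

lemma measurable_W_snd: "i \<in> {1..m} \<Longrightarrow> (\<lambda>y. W l (snd y) i) \<in> borel_measurable (M \<Otimes>\<^sub>M N)"
  using measurable_compose[OF measurable_snd W.measurable_X_coord] .

lemma phi_abs_le: "\<bar>phi \<delta> \<tau> n m x w\<bar> \<le> (\<integral>c. tent \<delta> c \<partial>lborel)"
  using phi_bounds[of \<tau> \<delta> n m x w] X.tau \<delta> by simp

definition step_X :: "(nat \<Rightarrow> real) \<Rightarrow> (nat \<Rightarrow> real) \<Rightarrow> real" where
  "step_X x w = (\<integral>z. phi \<delta> \<tau> n m (X.move n r x z) w \<partial>noise h n)"

definition step_W :: "(nat \<Rightarrow> real) \<Rightarrow> (nat \<Rightarrow> real) \<Rightarrow> real" where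
  "step_W x w = (\<integral>z. phi \<delta> \<tau> n m x (X.move m r w z) \<partial>noise h m)"

lemma integrable_step_X: "integrable (M \<Otimes>\<^sub>M N) (\<lambda>y. step_X (X k (fst y)) (W l (snd y)))"
proof (rule integrable_prob_bounded[OF P.prob_space_axioms])
  interpret Z: prob_space "noise h n" by (rule prob_space_noise[OF X.h_pos])
  have "(\<lambda>u. phi \<delta> \<tau> n m (X.move n r (X k (fst (fst u))) (snd u)) (W l (snd (fst u))))
      \<in> borel_measurable ((M \<Otimes>\<^sub>M N) \<Otimes>\<^sub>M noise h n)"
    by (intro measurable_phi X.measurable_move_coord measurable_compose[OF measurable_fst measurable_X_fst]
        measurable_compose[OF measurable_fst measurable_W_snd]
        measurable_compose[OF measurable_snd measurable_noise_coord])
  then show "(\<lambda>y. step_X (X k (fst y)) (W l (snd y))) \<in> borel_measurable (M \<Otimes>\<^sub>M N)"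
    unfolding step_X_def by (intro Z.borel_measurable_lebesgue_integral) (simp add: case_prod_unfold)
  show "\<bar>step_X (X k (fst y)) (W l (snd y))\<bar> \<le> (\<integral>c. tent \<delta> c \<partial>lborel)" for y
    unfolding step_X_def by (rule integral_prob_abs_le[OF Z.prob_space_axioms phi_abs_le])
qed

lemma integrable_step_W: "integrable (M \<Otimes>\<^sub>M N) (\<lambda>y. step_W (X k (fst y)) (W l (snd y)))"
proof (rule integrable_prob_bounded[OF P.prob_space_axioms])
  interpret Z: prob_space "noise h m" by (rule prob_space_noise[OF X.h_pos])
  have "(\<lambda>u. phi \<delta> \<tau> n m (X k (fst (fst u))) (X.move m r (W l (snd (fst u))) (snd u)))
      \<in> borel_measurable ((M \<Otimes>\<^sub>M N) \<Otimes>\<^sub>M noise h m)"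
    by (intro measurable_phi X.measurable_move_coord measurable_compose[OF measurable_fst measurable_X_fst]
        measurable_compose[OF measurable_fst measurable_W_snd]
        measurable_compose[OF measurable_snd measurable_noise_coord])
  then show "(\<lambda>y. step_W (X k (fst y)) (W l (snd y))) \<in> borel_measurable (M \<Otimes>\<^sub>M N)"
    unfolding step_W_def by (intro Z.borel_measurable_lebesgue_integral) (simp add: case_prod_unfold)
  show "\<bar>step_W (X k (fst y)) (W l (snd y))\<bar> \<le> (\<integral>c. tent \<delta> c \<partial>lborel)" for y
    unfolding step_W_def by (rule integral_prob_abs_le[OF Z.prob_space_axioms phi_abs_le])
qed

lemma integrable_phi_XW: "integrable (M \<Otimes>\<^sub>M N) (\<lambda>y. phi \<delta> \<tau> n m (X k (fst y)) (W l (snd y)))"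
  by (rule integrable_prob_bounded[OF P.prob_space_axioms measurable_phi phi_abs_le])
    (auto intro: measurable_X_fst measurable_W_snd)

lemma measurable_phi_coords:
  "(\<lambda>x. phi \<delta> \<tau> n m x w) \<in> borel_measurable (PiM {1..n} (\<lambda>_. borel))"
  "(\<lambda>w. phi \<delta> \<tau> n m x w) \<in> borel_measurable (PiM {1..m} (\<lambda>_. borel))"
  by (intro measurable_phi measurable_component_singleton; simp)+

text \<open>Fubini freezes the path of \<open>W\<close>; for each such path \<open>phi\<close> is a
  function of the state of \<open>X\<close> alone, to which the transition identity applies.\<close>

lemma A_Suc_left: "A (Suc k) l = (\<integral>y. step_X (X k (fst y)) (W l (snd y)) \<partial>(M \<Otimes>\<^sub>M N))"
proof -
  have "A (Suc k) l = (\<integral>\<omega>'. (\<integral>\<omega>. phi \<delta> \<tau> n m (X (Suc k) \<omega>) (W l \<omega>') \<partial>M) \<partial>N)"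
    unfolding A_def using P.integral_snd[of "\<lambda>\<omega> \<omega>'. phi \<delta> \<tau> n m (X (Suc k) \<omega>) (W l \<omega>')"]
      integrable_phi_XW[of "Suc k" l] by (simp add: case_prod_unfold)
  also have "\<dots> = (\<integral>\<omega>'. (\<integral>\<omega>. step_X (X k \<omega>) (W l \<omega>') \<partial>M) \<partial>N)"
  proof (rule Bochner_Integration.integral_cong[OF refl])
    fix \<omega>'
    have "integrable M (\<lambda>\<omega>. phi \<delta> \<tau> n m (X (Suc k) \<omega>) (W l \<omega>'))"
      by (rule integrable_prob_bounded[OF X.prob_space_axioms measurable_phi phi_abs_le])
        (auto intro: X.measurable_X_coord)
    then show "(\<integral>\<omega>. phi \<delta> \<tau> n m (X (Suc k) \<omega>) (W l \<omega>') \<partial>M) = (\<integral>\<omega>. step_X (X k \<omega>) (W l \<omega>') \<partial>M)"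
      using X.X_step[where k = k, OF measurable_phi_coords(1)[of "W l \<omega>'"]] by (simp add: step_X_def)
  qed
  also have "\<dots> = (\<integral>y. step_X (X k (fst y)) (W l (snd y)) \<partial>(M \<Otimes>\<^sub>M N))"
    using P.integral_snd[of "\<lambda>\<omega> \<omega>'. step_X (X k \<omega>) (W l \<omega>')"] integrable_step_X[of k l]
    by (simp add: case_prod_unfold)
  finally show ?thesis .
qed

lemma A_Suc_right: "A k (Suc l) = (\<integral>y. step_W (X k (fst y)) (W l (snd y)) \<partial>(M \<Otimes>\<^sub>M N))"
proof -
  have "A k (Suc l) = (\<integral>\<omega>. (\<integral>\<omega>'. phi \<delta> \<tau> n m (X k \<omega>) (W (Suc l) \<omega>') \<partial>N) \<partial>M)"
    unfolding A_def using P.integral_fst[of "\<lambda>\<omega> \<omega>'. phi \<delta> \<tau> n m (X k \<omega>) (W (Suc l) \<omega>')"]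
      integrable_phi_XW[of k "Suc l"] by (simp add: case_prod_unfold)
  also have "\<dots> = (\<integral>\<omega>. (\<integral>\<omega>'. step_W (X k \<omega>) (W l \<omega>') \<partial>N) \<partial>M)"
  proof (rule Bochner_Integration.integral_cong[OF refl])
    fix \<omega>
    have "integrable N (\<lambda>\<omega>'. phi \<delta> \<tau> n m (X k \<omega>) (W (Suc l) \<omega>'))"
      by (rule integrable_prob_bounded[OF W.prob_space_axioms measurable_phi phi_abs_le])
        (auto intro: W.measurable_X_coord)
    then show "(\<integral>\<omega>'. phi \<delta> \<tau> n m (X k \<omega>) (W (Suc l) \<omega>') \<partial>N) = (\<integral>\<omega>'. step_W (X k \<omega>) (W l \<omega>') \<partial>N)"
      using W.X_step[where k = l, OF measurable_phi_coords(2)[of "X k \<omega>"]] by (simp add: step_W_def)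
  qed
  also have "\<dots> = (\<integral>y. step_W (X k (fst y)) (W l (snd y)) \<partial>(M \<Otimes>\<^sub>M N))"
    using P.integral_fst[of "\<lambda>\<omega> \<omega>'. step_W (X k \<omega>) (W l \<omega>')"] integrable_step_W[of k l]
    by (simp add: case_prod_unfold)
  finally show ?thesis .
qed

definition err :: "nat \<Rightarrow> nat \<Rightarrow> 'a \<times> 'b \<Rightarrow> real" where
  "err k l y = (small_gap n R (X k (fst y)) + small_gap m R (W l (snd y))) *
    (8 * (real n * real m) * (s * r)\<^sup>2 + 2 * (real n * real m) * (s * r) * coincidences n m R (X k (fst y)) (W l (snd y)))"

lemma measurable_small_gaps:
  "(\<lambda>y. small_gap n R (X k (fst y))) \<in> borel_measurable (M \<Otimes>\<^sub>M N)"
  "(\<lambda>y. small_gap m R (W l (snd y))) \<in> borel_measurable (M \<Otimes>\<^sub>M N)"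
  using measurable_compose[OF measurable_fst X.measurable_small_gap]
    measurable_compose[OF measurable_snd W.measurable_small_gap] by auto

abbreviation meet :: "nat \<Rightarrow> nat \<Rightarrow> nat \<times> nat \<Rightarrow> nat \<times> nat \<Rightarrow> 'a \<times> 'b \<Rightarrow> real" where
  "meet k l a b y \<equiv> near R ((X k (fst y) (fst a) - X k (fst y) (snd a)) + (W l (snd y) (fst b) - W l (snd y) (snd b)))"

lemma near_pair_measurable:
  assumes "a \<in> offdiag n" "b \<in> offdiag m"
  shows "(\<lambda>y. meet k l a b y)
    \<in> borel_measurable (M \<Otimes>\<^sub>M N)"
proof -
  have [measurable]: "(\<lambda>y. X k (fst y) (fst a)) \<in> borel_measurable (M \<Otimes>\<^sub>M N)"
    "(\<lambda>y. X k (fst y) (snd a)) \<in> borel_measurable (M \<Otimes>\<^sub>M N)"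
    "(\<lambda>y. W l (snd y) (fst b)) \<in> borel_measurable (M \<Otimes>\<^sub>M N)"
    "(\<lambda>y. W l (snd y) (snd b)) \<in> borel_measurable (M \<Otimes>\<^sub>M N)"
    by ((intro measurable_X_fst measurable_W_snd; use assms in \<open>auto simp: offdiag_def\<close>)+)
  show ?thesis by measurable
qed

lemma integrable_gap_near:
  assumes "a \<in> offdiag n" "b \<in> offdiag m"
  shows "integrable (M \<Otimes>\<^sub>M N) (\<lambda>y. small_gap n R (X k (fst y)) *
      meet k l a b y)"
    and "integrable (M \<Otimes>\<^sub>M N) (\<lambda>y. small_gap m R (W l (snd y)) *
      meet k l a b y)"
proof -
  have le: "\<bar>u * near R v\<bar> \<le> B" if "0 \<le> u" "u \<le> B" for u v B
    using that mult_left_le[OF near_le_1[of R v] that(1)] near_nonneg[of R v] by (simp add: abs_mult)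
  show "integrable (M \<Otimes>\<^sub>M N) (\<lambda>y. small_gap n R (X k (fst y)) *
      meet k l a b y)"
    by (rule integrable_prob_bounded[OF P.prob_space_axioms
          borel_measurable_times[OF measurable_small_gaps(1) near_pair_measurable[OF assms]]
          le[OF small_gap_nonneg X.small_gap_le]])
  show "integrable (M \<Otimes>\<^sub>M N) (\<lambda>y. small_gap m R (W l (snd y)) *
      meet k l a b y)"
    by (rule integrable_prob_bounded[OF P.prob_space_axioms
          borel_measurable_times[OF measurable_small_gaps(2) near_pair_measurable[OF assms]]
          le[OF small_gap_nonneg W.small_gap_le]])
qed

lemma integrable_small_gaps:
  "integrable (M \<Otimes>\<^sub>M N) (\<lambda>y. small_gap n R (X k (fst y)))"
  "integrable (M \<Otimes>\<^sub>M N) (\<lambda>y. small_gap m R (W l (snd y)))"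
proof -
  show "integrable (M \<Otimes>\<^sub>M N) (\<lambda>y. small_gap n R (X k (fst y)))"
    using measurable_small_gaps(1)
    by (rule integrable_prob_bounded[OF P.prob_space_axioms, where B = "real n"])
      (use small_gap_nonneg X.small_gap_le in auto)
  show "integrable (M \<Otimes>\<^sub>M N) (\<lambda>y. small_gap m R (W l (snd y)))"
    using measurable_small_gaps(2)
    by (rule integrable_prob_bounded[OF P.prob_space_axioms, where B = "real m"])
      (use small_gap_nonneg W.small_gap_le in auto)
qed

lemma integral_small_gaps:
  "(\<integral>y. small_gap n R (X k (fst y)) \<partial>(M \<Otimes>\<^sub>M N)) = (\<integral>\<omega>. small_gap n R (X k \<omega>) \<partial>M)"
  "(\<integral>y. small_gap m R (W l (snd y)) \<partial>(M \<Otimes>\<^sub>M N)) = (\<integral>\<omega>. small_gap m R (W l \<omega>) \<partial>N)"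
proof -
  show "(\<integral>y. small_gap n R (X k (fst y)) \<partial>(M \<Otimes>\<^sub>M N)) = (\<integral>\<omega>. small_gap n R (X k \<omega>) \<partial>M)"
    using P.integral_fst[of "\<lambda>\<omega> \<omega>'. small_gap n R (X k \<omega>)"] integrable_small_gaps(1)[of k]
    by (simp add: case_prod_unfold W.prob_space)
  show "(\<integral>y. small_gap m R (W l (snd y)) \<partial>(M \<Otimes>\<^sub>M N)) = (\<integral>\<omega>. small_gap m R (W l \<omega>) \<partial>N)"
    using P.integral_snd[of "\<lambda>\<omega> \<omega>'. small_gap m R (W l \<omega>')"] integrable_small_gaps(2)[of l]
    by (simp add: case_prod_unfold X.prob_space)
qed

text \<open>Freeze the walk whose small gaps are counted: the coincidence then says that a
  difference of the other walk lies within \<open>R\<close> of a fixed number, and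
  \<open>occupation\<close> bounds the time sum of this uniformly in that number. What remains is
  the occupation of small gaps by the first walk. The two sums separate because \<open>k\<close> and
  \<open>l\<close> vary independently.\<close>

lemma double_occupation:
  assumes a: "a \<in> offdiag n" and b: "b \<in> offdiag m" and T: "real L * h \<le> T"
  shows "h\<^sup>2 * (\<Sum>k<L. \<Sum>l<L. \<integral>y. small_gap n R (X k (fst y)) *
      meet k l a b y \<partial>(M \<Otimes>\<^sub>M N))
    \<le> real n * (R * X.occ T) * (R * W.occ T)" (is "_ * (\<Sum>k<L. \<Sum>l<L. ?I k l) \<le> _")
    and "h\<^sup>2 * (\<Sum>k<L. \<Sum>l<L. \<integral>y. small_gap m R (W l (snd y)) *
      meet k l a b y \<partial>(M \<Otimes>\<^sub>M N))
    \<le> real m * (R * W.occ T) * (R * X.occ T)" (is "_ * (\<Sum>k<L. \<Sum>l<L. ?J k l) \<le> _")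
proof -
  define dX where "dX k \<omega> = X k \<omega> (fst a) - X k \<omega> (snd a)" for k \<omega>
  define dW where "dW l \<omega> = W l \<omega> (fst b) - W l \<omega> (snd b)" for l \<omega>
  have ab: "fst a \<in> {1..n}" "snd a \<in> {1..n}" "fst a \<noteq> snd a" "fst b \<in> {1..m}" "snd b \<in> {1..m}" "fst b \<noteq> snd b"
    using a b by (auto simp: offdiag_def)
  have T0: "0 \<le> T" using T X.h_pos by (meson less_imp_le mult_nonneg_nonneg of_nat_0_le_iff order_trans)
  have h: "0 < h" by (rule X.h_pos)
  have [measurable]: "(\<lambda>\<omega>. dX k \<omega>) \<in> borel_measurable M" for k
    unfolding dX_def by (intro borel_measurable_diff X.measurable_X_coord ab)
  have [measurable]: "(\<lambda>\<omega>. dW k \<omega>) \<in> borel_measurable N" for k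
    unfolding dW_def by (intro borel_measurable_diff W.measurable_X_coord ab)
  have iN: "integrable N (\<lambda>\<omega>'. near R (u + dW l \<omega>'))" for u l
    by (rule integrable_prob_bounded[OF W.prob_space_axioms, where B = 1]) (use near_nonneg near_le_1 in auto)
  have iM: "integrable M (\<lambda>\<omega>. near R (dX k \<omega> + u))" for u k
    by (rule integrable_prob_bounded[OF X.prob_space_axioms, where B = 1]) (use near_nonneg near_le_1 in auto)
  have oN: "h * (\<Sum>l<L. \<integral>\<omega>'. near R (u + dW l \<omega>') \<partial>N) \<le> R * W.occ T" for u
    using W.occupation[OF ab(4,5,6) R_ge T, of "- u"] by (simp add: dW_def add.commute)
  have oM: "h * (\<Sum>k<L. \<integral>\<omega>. near R (dX k \<omega> + u) \<partial>M) \<le> R * X.occ T" for u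
    using X.occupation[OF ab(1,2,3) R_ge T, of "- u"] by (simp add: dX_def)
  have I: "?I k l = (\<integral>\<omega>. small_gap n R (X k \<omega>) * (\<integral>\<omega>'. near R (dX k \<omega> + dW l \<omega>') \<partial>N) \<partial>M)" 
    and iI: "integrable M (\<lambda>\<omega>. small_gap n R (X k \<omega>) * (\<integral>\<omega>'. near R (dX k \<omega> + dW l \<omega>') \<partial>N))" for k l
  proof -
    note i = integrable_gap_near(1)[OF a b, of k l, folded dX_def dW_def]
    show "?I k l = (\<integral>\<omega>. small_gap n R (X k \<omega>) * (\<integral>\<omega>'. near R (dX k \<omega> + dW l \<omega>') \<partial>N) \<partial>M)"
      using P.integral_fst[of "\<lambda>\<omega> \<omega>'. small_gap n R (X k \<omega>) * near R (dX k \<omega> + dW l \<omega>')"] i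
      by (simp add: case_prod_unfold dX_def dW_def)
    show "integrable M (\<lambda>\<omega>. small_gap n R (X k \<omega>) * (\<integral>\<omega>'. near R (dX k \<omega> + dW l \<omega>') \<partial>N))"
      using P.integrable_fst[of "\<lambda>\<omega> \<omega>'. small_gap n R (X k \<omega>) * near R (dX k \<omega> + dW l \<omega>')"] i
      by (simp add: case_prod_unfold)
  qed
  have J: "?J k l = (\<integral>\<omega>'. small_gap m R (W l \<omega>') * (\<integral>\<omega>. near R (dX k \<omega> + dW l \<omega>') \<partial>M) \<partial>N)" 
    and iJ: "integrable N (\<lambda>\<omega>'. small_gap m R (W l \<omega>') * (\<integral>\<omega>. near R (dX k \<omega> + dW l \<omega>') \<partial>M))" for k l
  proof -
    note i = integrable_gap_near(2)[OF a b, of l k, folded dX_def dW_def]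
    show "?J k l = (\<integral>\<omega>'. small_gap m R (W l \<omega>') * (\<integral>\<omega>. near R (dX k \<omega> + dW l \<omega>') \<partial>M) \<partial>N)"
      using P.integral_snd[of "\<lambda>\<omega> \<omega>'. small_gap m R (W l \<omega>') * near R (dX k \<omega> + dW l \<omega>')"] i
      by (simp add: case_prod_unfold dX_def dW_def)
    show "integrable N (\<lambda>\<omega>'. small_gap m R (W l \<omega>') * (\<integral>\<omega>. near R (dX k \<omega> + dW l \<omega>') \<partial>M))"
      using P.integrable_snd[of "\<lambda>\<omega> \<omega>'. small_gap m R (W l \<omega>') * near R (dX k \<omega> + dW l \<omega>')"] i
      by (simp add: case_prod_unfold)
  qed
  have "h * (\<Sum>l<L. ?I k l) \<le> (\<integral>\<omega>. small_gap n R (X k \<omega>) \<partial>M) * (R * W.occ T)" for k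
  proof -
    have "h * (\<Sum>l<L. ?I k l) = (\<integral>\<omega>. h * (\<Sum>l<L. small_gap n R (X k \<omega>) * (\<integral>\<omega>'. near R (dX k \<omega> + dW l \<omega>') \<partial>N)) \<partial>M)"
      unfolding I using iI by simp
    also have "\<dots> \<le> (\<integral>\<omega>. small_gap n R (X k \<omega>) * (R * W.occ T) \<partial>M)"
    proof (rule integral_mono)
      show "h * (\<Sum>l<L. small_gap n R (X k \<omega>) * (\<integral>\<omega>'. near R (dX k \<omega> + dW l \<omega>') \<partial>N))
          \<le> small_gap n R (X k \<omega>) * (R * W.occ T)" for \<omega>
        using mult_left_mono[OF oN[of "dX k \<omega>"] small_gap_nonneg[of n R "X k \<omega>"]]
        by (simp add: sum_distrib_left mult_ac)
    qed (use iI X.integrable_small_gap in auto)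
    finally show ?thesis by simp
  qed
  then have "h * (\<Sum>k<L. h * (\<Sum>l<L. ?I k l)) \<le> h * (\<Sum>k<L. (\<integral>\<omega>. small_gap n R (X k \<omega>) \<partial>M) * (R * W.occ T))"
    using h by (intro mult_left_mono sum_mono) auto
  also have "\<dots> = (h * (\<Sum>k<L. \<integral>\<omega>. small_gap n R (X k \<omega>) \<partial>M)) * (R * W.occ T)"
    by (simp add: sum_distrib_right mult.assoc)
  also have "\<dots> \<le> real n * (R * X.occ T) * (R * W.occ T)"
    using X.occupation_small_gap[OF R_ge T] W.occ_nonneg[OF T0] R_pos by (intro mult_right_mono) auto
  finally show "h\<^sup>2 * (\<Sum>k<L. \<Sum>l<L. ?I k l) \<le> real n * (R * X.occ T) * (R * W.occ T)"
    by (simp add: sum_distrib_left power2_eq_square mult.assoc)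
  have "h * (\<Sum>k<L. ?J k l) \<le> (\<integral>\<omega>. small_gap m R (W l \<omega>) \<partial>N) * (R * X.occ T)" for l
  proof -
    have "h * (\<Sum>k<L. ?J k l) = (\<integral>\<omega>'. h * (\<Sum>k<L. small_gap m R (W l \<omega>') * (\<integral>\<omega>. near R (dX k \<omega> + dW l \<omega>') \<partial>M)) \<partial>N)"
      unfolding J using iJ by simp
    also have "\<dots> \<le> (\<integral>\<omega>'. small_gap m R (W l \<omega>') * (R * X.occ T) \<partial>N)"
    proof (rule integral_mono)
      show "h * (\<Sum>k<L. small_gap m R (W l \<omega>') * (\<integral>\<omega>. near R (dX k \<omega> + dW l \<omega>') \<partial>M))
          \<le> small_gap m R (W l \<omega>') * (R * X.occ T)" for \<omega>'
        using mult_left_mono[OF oM[of "dW l \<omega>'"] small_gap_nonneg[of m R "W l \<omega>'"]]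
        by (simp add: sum_distrib_left mult_ac)
    qed (use iJ W.integrable_small_gap in auto)
    finally show ?thesis by simp
  qed
  then have "h * (\<Sum>l<L. h * (\<Sum>k<L. ?J k l)) \<le> h * (\<Sum>l<L. (\<integral>\<omega>. small_gap m R (W l \<omega>) \<partial>N) * (R * X.occ T))"
    using h by (intro mult_left_mono sum_mono) auto
  also have "\<dots> = (h * (\<Sum>l<L. \<integral>\<omega>. small_gap m R (W l \<omega>) \<partial>N)) * (R * X.occ T)"
    by (simp add: sum_distrib_right mult.assoc)
  also have "\<dots> \<le> real m * (R * W.occ T) * (R * X.occ T)"
    using W.occupation_small_gap[OF R_ge T] X.occ_nonneg[OF T0] R_pos by (intro mult_right_mono) auto
  finally show "h\<^sup>2 * (\<Sum>k<L. \<Sum>l<L. ?J k l) \<le> real m * (R * W.occ T) * (R * X.occ T)"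
    by (subst sum.swap) (simp add: sum_distrib_left power2_eq_square mult.assoc)
qed

end

lemma card_offdiag_le: "card (offdiag n) \<le> n * n"
proof -
  have "card (offdiag n) \<le> card ({1..n} \<times> {1..n})" unfolding offdiag_def by (rule card_mono) auto
  then show ?thesis by simp
qed

text \<open>Moving one step at a time from W to X telescopes from \<open>A 0 (Suc K)\<close> to
  \<open>A (Suc K) 0\<close>. The index pairs used for K satisfy k + l = K, so together they fill a
  triangle inside the square.\<close>

lemma sum_telescope_antidiagonal:
  fixes A :: "nat \<Rightarrow> nat \<Rightarrow> real"
  shows "(\<Sum>K<L. \<bar>A (Suc K) 0 - A 0 (Suc K)\<bar>) \<le> (\<Sum>k<L. \<Sum>l<L. \<bar>A (Suc k) l - A k (Suc l)\<bar>)"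
proof -
  let ?D = "\<lambda>k l. \<bar>A (Suc k) l - A k (Suc l)\<bar>"
  have "\<bar>A (Suc K) 0 - A 0 (Suc K)\<bar> \<le> (\<Sum>k\<le>K. ?D k (K - k))" for K
  proof -
    have "A (Suc K) 0 - A 0 (Suc K) = (\<Sum>k<Suc K. A (Suc k) (Suc K - Suc k) - A k (Suc K - k))"
      using sum_lessThan_telescope[of "\<lambda>k. A k (Suc K - k)" "Suc K"] by simp
    also have "\<dots> = (\<Sum>k\<le>K. A (Suc k) (K - k) - A k (Suc (K - k)))"
      by (intro sum.cong) (auto simp: Suc_diff_le less_Suc_eq_le)
    finally show ?thesis by (simp only: sum_abs)
  qed
  then have "(\<Sum>K<L. \<bar>A (Suc K) 0 - A 0 (Suc K)\<bar>) \<le> (\<Sum>K<L. \<Sum>k\<le>K. ?D k (K - k))"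
    by (intro sum_mono)
  also have "\<dots> = (\<Sum>(k, l)\<in>{(k, l). k + l < L}. ?D k l)" by (rule sum.triangle_reindex[symmetric])
  also have "\<dots> \<le> (\<Sum>(k, l)\<in>{..<L} \<times> {..<L}. ?D k l)"
    by (intro sum_mono2) auto
  also have "\<dots> = (\<Sum>k<L. \<Sum>l<L. ?D k l)" by (simp add: sum.cartesian_product)
  finally show ?thesis .
qed

context two_walks
begin

lemma err_eq: "err k l y = 8 * (real n * real m) * (s * r)\<^sup>2 * (small_gap n R (X k (fst y)) + small_gap m R (W l (snd y)))
    + 2 * (real n * real m) * (s * r) * (\<Sum>a\<in>offdiag n. \<Sum>b\<in>offdiag m.
      small_gap n R (X k (fst y)) *
        meet k l a b y +
      small_gap m R (W l (snd y)) *
        meet k l a b y)"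
proof -
  have *: "(g1 + g2) * (c1 + c2 * C) = c1 * (g1 + g2) + c2 * (g1 * C + g2 * C)" for g1 g2 c1 c2 C :: real
    by (simp add: algebra_simps)
  show ?thesis
    unfolding err_def * coincidences_def sum_distrib_left[of "small_gap n R _"] sum_distrib_left[of "small_gap m R _"]
    by (simp only: sum.distrib)
qed

lemma integrable_err: "integrable (M \<Otimes>\<^sub>M N) (err k l)"
  unfolding err_eq
  by (intro Bochner_Integration.integrable_add integrable_mult_right Bochner_Integration.integrable_sum
      integrable_small_gaps integrable_gap_near)

lemma A_diff_le: "\<bar>A (Suc k) l - A k (Suc l)\<bar> \<le> (\<integral>y. err k l y \<partial>(M \<Otimes>\<^sub>M N))"
proof -
  have "A (Suc k) l - A k (Suc l)
      = (\<integral>y. step_X (X k (fst y)) (W l (snd y)) - step_W (X k (fst y)) (W l (snd y)) \<partial>(M \<Otimes>\<^sub>M N))"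
    unfolding A_Suc_left A_Suc_right using integrable_step_X integrable_step_W by simp
  moreover have "\<bar>\<integral>y. step_X (X k (fst y)) (W l (snd y)) - step_W (X k (fst y)) (W l (snd y)) \<partial>(M \<Otimes>\<^sub>M N)\<bar>
      \<le> (\<integral>y. err k l y \<partial>(M \<Otimes>\<^sub>M N))"
  proof (rule order_trans[OF integral_abs_bound], rule integral_mono)
    show "integrable (M \<Otimes>\<^sub>M N) (\<lambda>y. \<bar>step_X (X k (fst y)) (W l (snd y)) - step_W (X k (fst y)) (W l (snd y))\<bar>)"
      using integrable_step_X integrable_step_W by simp
    show "integrable (M \<Otimes>\<^sub>M N) (err k l)" by (rule integrable_err)
    show "\<bar>step_X (X k (fst y)) (W l (snd y)) - step_W (X k (fst y)) (W l (snd y))\<bar> \<le> err k l y" for y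
      unfolding step_X_def step_W_def err_def R_def s_def
      by (rule X.step_error[OF X.h_pos less_imp_le[OF X.r_pos] \<delta> X.X_weyl W.X_weyl])
  qed
  ultimately show ?thesis by simp
qed

text \<open>Free of \<open>h\<close> and \<open>r\<close>: outside the locale it depends only on p,
  q, the two initial configurations, their sizes and the horizon, so one constant serves all
  meshes.\<close>

definition total_const :: "real \<Rightarrow> real" where
  "total_const T = 16 * (real n * real m) * s ^ 3 * T * (real n * X.occ T + real m * W.occ T)
    + 8 * (real n * real m) * s ^ 3 * (real (n * n) * real (m * m)) * ((real n + real m) * (X.occ T * W.occ T))"

text \<open>Power count with R = 2 s r: a second-order step error meets one occupation of order R,
  and a first-order step error meets two of them, so both parts are of order r^3. Each of the two
  time sums uses up one factor \<open>h\<close>.\<close>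

lemma sum_err_le:
  assumes T: "real L * h \<le> T"
  shows "h\<^sup>2 * (\<Sum>k<L. \<Sum>l<L. \<integral>y. err k l y \<partial>(M \<Otimes>\<^sub>M N)) \<le> total_const T * r ^ 3"
proof -
  have h: "0 < h" by (rule X.h_pos)
  have T0: "0 \<le> T" using T h by (meson less_imp_le mult_nonneg_nonneg of_nat_0_le_iff order_trans)
  define nm where "nm = real n * real m"
  define gX where "gX k = (\<integral>\<omega>. small_gap n R (X k \<omega>) \<partial>M)" for k
  define gW where "gW l = (\<integral>\<omega>. small_gap m R (W l \<omega>) \<partial>N)" for l
  define I where "I k l a b = (\<integral>y. small_gap n R (X k (fst y)) *
      meet k l a b y \<partial>(M \<Otimes>\<^sub>M N))" for k l a b
  define J where "J k l a b = (\<integral>y. small_gap m R (W l (snd y)) *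
      meet k l a b y \<partial>(M \<Otimes>\<^sub>M N))" for k l a b
  define oX oW where "oX = X.occ T" and "oW = W.occ T"
  have o: "0 \<le> oX" "0 \<le> oW" by (auto simp: oX_def oW_def X.occ_nonneg[OF T0] W.occ_nonneg[OF T0])
  have e: "(\<integral>y. err k l y \<partial>(M \<Otimes>\<^sub>M N)) = 8 * nm * (s * r)\<^sup>2 * (gX k + gW l)
      + 2 * nm * (s * r) * (\<Sum>a\<in>offdiag n. \<Sum>b\<in>offdiag m. I k l a b + J k l a b)" for k l
    unfolding err_eq nm_def[symmetric]
    by (simp add: integrable_small_gaps integrable_gap_near integral_small_gaps gX_def gW_def I_def J_def
        Bochner_Integration.integral_sum Bochner_Integration.integrable_sum)
  have part1: "h\<^sup>2 * (\<Sum>k<L. \<Sum>l<L. gX k + gW l) \<le> T * (real n * (R * oX) + real m * (R * oW))"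
  proof -
    have "h\<^sup>2 * (\<Sum>k<L. \<Sum>l<L. gX k + gW l) = (real L * h) * (h * (\<Sum>k<L. gX k) + h * (\<Sum>l<L. gW l))"
      by (simp add: sum.distrib sum_distrib_left power2_eq_square algebra_simps)
    also have "\<dots> \<le> (real L * h) * (real n * (R * oX) + real m * (R * oW))"
      unfolding gX_def gW_def oX_def oW_def
      using X.occupation_small_gap[OF R_ge T] W.occupation_small_gap[OF R_ge T] h
      by (intro mult_left_mono add_mono) auto
    also have "\<dots> \<le> T * (real n * (R * oX) + real m * (R * oW))"
      using T o R_pos by (intro mult_right_mono) auto
    finally show ?thesis .
  qed
  have part2: "h\<^sup>2 * (\<Sum>k<L. \<Sum>l<L. \<Sum>a\<in>offdiag n. \<Sum>b\<in>offdiag m. I k l a b + J k l a b)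
      \<le> real (n * n) * real (m * m) * ((real n + real m) * (R * oX * (R * oW)))"
  proof -
    have "h\<^sup>2 * (\<Sum>k<L. \<Sum>l<L. \<Sum>a\<in>offdiag n. \<Sum>b\<in>offdiag m. I k l a b + J k l a b)
        = h\<^sup>2 * (\<Sum>a\<in>offdiag n. \<Sum>b\<in>offdiag m. \<Sum>k<L. \<Sum>l<L. I k l a b + J k l a b)"
      unfolding sum.swap[of _ "offdiag n" "{..<L}"] sum.swap[of _ "offdiag m" "{..<L}"] ..
    also have "\<dots> = (\<Sum>a\<in>offdiag n. \<Sum>b\<in>offdiag m. h\<^sup>2 * (\<Sum>k<L. \<Sum>l<L. I k l a b) + h\<^sup>2 * (\<Sum>k<L. \<Sum>l<L. J k l a b))"
      by (simp add: sum_distrib_left sum.distrib distrib_left)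
    also have "\<dots> \<le> (\<Sum>a\<in>offdiag n. \<Sum>b\<in>offdiag m. real n * (R * oX) * (R * oW) + real m * (R * oW) * (R * oX))"
      unfolding I_def J_def oX_def oW_def
      by (intro sum_mono add_mono double_occupation T)
    also have "\<dots> = real (card (offdiag n)) * real (card (offdiag m)) * ((real n + real m) * (R * oX * (R * oW)))"
      by (simp add: algebra_simps)
    also have "\<dots> \<le> real (n * n) * real (m * m) * ((real n + real m) * (R * oX * (R * oW)))"
      using card_offdiag_le[of n] card_offdiag_le[of m] o R_pos
      by (intro mult_right_mono mult_mono of_nat_mono) auto
    finally show ?thesis .
  qed
  have c: "0 \<le> 8 * nm * (s * r)\<^sup>2" "0 \<le> 2 * nm * (s * r)"
    using s_pos X.r_pos by (auto simp: nm_def)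
  have "h\<^sup>2 * (\<Sum>k<L. \<Sum>l<L. \<integral>y. err k l y \<partial>(M \<Otimes>\<^sub>M N))
      = 8 * nm * (s * r)\<^sup>2 * (h\<^sup>2 * (\<Sum>k<L. \<Sum>l<L. gX k + gW l))
      + 2 * nm * (s * r) * (h\<^sup>2 * (\<Sum>k<L. \<Sum>l<L. \<Sum>a\<in>offdiag n. \<Sum>b\<in>offdiag m. I k l a b + J k l a b))"
    unfolding e by (simp only: sum.distrib[of "\<lambda>l. 8 * nm * (s * r)\<^sup>2 * _ l"] sum.distrib
        sum_distrib_left[symmetric] distrib_left mult.left_commute[of "h\<^sup>2"])
  also have "\<dots> \<le> 8 * nm * (s * r)\<^sup>2 * (T * (real n * (R * oX) + real m * (R * oW)))
      + 2 * nm * (s * r) * (real (n * n) * real (m * m) * ((real n + real m) * (R * oX * (R * oW))))"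
    by (intro add_mono mult_left_mono part1 part2 c)
  also have "\<dots> = total_const T * r ^ 3"
    unfolding total_const_def R_def oX_def[symmetric] oW_def[symmetric] nm_def[symmetric]
    by (simp add: power2_eq_square power3_eq_cube algebra_simps)
  finally show ?thesis .
qed

text \<open>Only one time sum survives, as an average over the final time, so one of the two factors
  \<open>h\<close> has to be divided out.\<close>

lemma duality_error:
  assumes T: "real L * h \<le> T"
  shows "h * (\<Sum>K<L. \<bar>A (Suc K) 0 - A 0 (Suc K)\<bar>) \<le> total_const T * r ^ 3 / h"
proof -
  have h: "0 < h" by (rule X.h_pos)
  have "(\<Sum>K<L. \<bar>A (Suc K) 0 - A 0 (Suc K)\<bar>) \<le> (\<Sum>k<L. \<Sum>l<L. \<bar>A (Suc k) l - A k (Suc l)\<bar>)"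
    by (rule sum_telescope_antidiagonal)
  also have "\<dots> \<le> (\<Sum>k<L. \<Sum>l<L. \<integral>y. err k l y \<partial>(M \<Otimes>\<^sub>M N))"
    by (intro sum_mono A_diff_le)
  finally have "h\<^sup>2 * (\<Sum>K<L. \<bar>A (Suc K) 0 - A 0 (Suc K)\<bar>) \<le> h\<^sup>2 * (\<Sum>k<L. \<Sum>l<L. \<integral>y. err k l y \<partial>(M \<Otimes>\<^sub>M N))"
    using h by (intro mult_left_mono) auto
  also have "\<dots> \<le> total_const T * r ^ 3" by (rule sum_err_le[OF T])
  finally show ?thesis using h by (simp add: pos_le_divide_eq power2_eq_square mult_ac)
qed

lemma A_left: "A k 0 = (\<integral>\<omega>. phi \<delta> \<tau> n m (X k \<omega>) w0 \<partial>M)"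
proof -
  have "A k 0 = (\<integral>y. phi \<delta> \<tau> n m (X k (fst y)) w0 \<partial>(M \<Otimes>\<^sub>M N))"
    unfolding A_def by (intro Bochner_Integration.integral_cong refl phi_cong) (auto simp: W.X_0)
  also have "\<dots> = (\<integral>\<omega>. (\<integral>\<omega>'. phi \<delta> \<tau> n m (X k \<omega>) w0 \<partial>N) \<partial>M)"
  proof -
    have "integrable (M \<Otimes>\<^sub>M N) (\<lambda>y. phi \<delta> \<tau> n m (X k (fst y)) w0)"
      by (rule integrable_prob_bounded[OF P.prob_space_axioms measurable_phi phi_abs_le])
        (auto intro: measurable_X_fst)
    then show ?thesis
      using P.integral_fst[of "\<lambda>\<omega> \<omega>'. phi \<delta> \<tau> n m (X k \<omega>) w0"] by (simp add: case_prod_unfold)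
  qed
  finally show ?thesis by (simp add: W.prob_space)
qed

lemma A_right: "A 0 l = (\<integral>\<omega>. phi \<delta> \<tau> n m x0 (W l \<omega>) \<partial>N)"
proof -
  have "A 0 l = (\<integral>y. phi \<delta> \<tau> n m x0 (W l (snd y)) \<partial>(M \<Otimes>\<^sub>M N))"
    unfolding A_def by (intro Bochner_Integration.integral_cong refl phi_cong) (auto simp: X.X_0)
  also have "\<dots> = (\<integral>\<omega>'. (\<integral>\<omega>. phi \<delta> \<tau> n m x0 (W l \<omega>') \<partial>M) \<partial>N)"
  proof -
    have "integrable (M \<Otimes>\<^sub>M N) (\<lambda>y. phi \<delta> \<tau> n m x0 (W l (snd y)))"
      by (rule integrable_prob_bounded[OF P.prob_space_axioms measurable_phi phi_abs_le])
        (auto intro: measurable_W_snd)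
    then show ?thesis
      using P.integral_snd[of "\<lambda>\<omega> \<omega>'. phi \<delta> \<tau> n m x0 (W l \<omega>')"] by (simp add: case_prod_unfold)
  qed
  finally show ?thesis by (simp add: X.prob_space)
qed

end

section \<open>The walk driven by Brownian increments\<close>

lemma indep_std_BMsD:
  assumes "indep_std_BMs M J B"
  shows "prob_space M" "j \<in> J \<Longrightarrow> 0 \<le> t \<Longrightarrow> B j t \<in> borel_measurable M"
    and "AE \<omega> in M. \<forall>j\<in>J. B j 0 \<omega> = 0 \<and> continuous_on {0..} (\<lambda>t. B j t \<omega>)"
    and "0 < h \<Longrightarrow> prob_space.indep_vars M (\<lambda>_. borel)
      (\<lambda>(j, k) \<omega>. B j (real (Suc k) * h) \<omega> - B j (real k * h) \<omega>) (J \<times> {..<N})"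
    and "0 < h \<Longrightarrow> j \<in> J \<Longrightarrow> distr M borel (\<lambda>\<omega>. B j (real (Suc k) * h) \<omega> - B j (real k * h) \<omega>) = gauss h"
proof -
  show "prob_space M" "j \<in> J \<Longrightarrow> 0 \<le> t \<Longrightarrow> B j t \<in> borel_measurable M"
    "AE \<omega> in M. \<forall>j\<in>J. B j 0 \<omega> = 0 \<and> continuous_on {0..} (\<lambda>t. B j t \<omega>)"
    using assms by (auto simp: indep_std_BMs_def)
  have *: "prob_space.indep_vars M (\<lambda>_. borel)
      (\<lambda>(j, k) \<omega>. B j (real (Suc k) * h) \<omega> - B j (real k * h) \<omega>) (J \<times> {..<N}) \<and>
    (\<forall>j\<in>J. \<forall>k<N. distributed M lborel (\<lambda>\<omega>. B j (real (Suc k) * h) \<omega> - B j (real k * h) \<omega>)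
      (normal_density 0 (sqrt (real (Suc k) * h - real k * h))))" if "0 < h" for N
  proof -
    have all: "\<forall>(ts :: nat \<Rightarrow> real) (N :: nat). ts 0 = 0 \<and> (\<forall>k<N. ts k < ts (Suc k)) \<longrightarrow>
        prob_space.indep_vars M (\<lambda>_. borel)
          (\<lambda>(j, k) \<omega>. B j (ts (Suc k)) \<omega> - B j (ts k) \<omega>) (J \<times> {..<N}) \<and>
        (\<forall>j\<in>J. \<forall>k<N. distributed M lborel (\<lambda>\<omega>. B j (ts (Suc k)) \<omega> - B j (ts k) \<omega>)
                        (normal_density 0 (sqrt (ts (Suc k) - ts k))))"
      using assms unfolding indep_std_BMs_def by (elim conjE)
    show ?thesis
      by (rule all[THEN spec, of "\<lambda>k. real k * h", THEN spec, THEN mp]) (use that in simp)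
  qed
  show "0 < h \<Longrightarrow> prob_space.indep_vars M (\<lambda>_. borel)
      (\<lambda>(j, k) \<omega>. B j (real (Suc k) * h) \<omega> - B j (real k * h) \<omega>) (J \<times> {..<N})"
    using * by blast
  show "distr M borel (\<lambda>\<omega>. B j (real (Suc k) * h) \<omega> - B j (real k * h) \<omega>) = gauss h" if "0 < h" "j \<in> J"
  proof -
    have "distributed M lborel (\<lambda>\<omega>. B j (real (Suc k) * h) \<omega> - B j (real k * h) \<omega>)
        (normal_density 0 (sqrt (real (Suc k) * h - real k * h)))"
      using *[OF that(1), of "Suc k"] that(2) by blast
    moreover have "real (Suc k) * h - real k * h = h" by (simp add: algebra_simps)
    ultimately have "distr M lborel (\<lambda>\<omega>. B j (real (Suc k) * h) \<omega> - B j (real k * h) \<omega>) = gauss h"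
      by (simp add: distributed_def gauss_def)
    moreover have "distr M borel f = distr M lborel f" for f :: "'a \<Rightarrow> real"
      by (rule distr_cong) auto
    ultimately show ?thesis by simp
  qed
qed

context oblique
begin

primrec chain :: "nat \<Rightarrow> real \<Rightarrow> (nat \<Rightarrow> real) \<Rightarrow> (nat \<Rightarrow> nat \<Rightarrow> real) \<Rightarrow> nat \<Rightarrow> nat \<Rightarrow> real" where
  "chain n r x0 \<xi> 0 = restrict x0 {1..n}"
| "chain n r x0 \<xi> (Suc k) = move n r (chain n r x0 \<xi> k) (\<xi> k)"

lemma move_cong: "(\<And>j. j \<in> {1..n} \<Longrightarrow> z j = z' j) \<Longrightarrow> move n r x z = move n r x z'"
  unfolding move_def by (intro reflect_cong) simp

text \<open>Adaptedness in functional form; it lets the state be factored through the increments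
  before step \<open>k\<close>, and so be independent of the increment of step
  \<open>k\<close>.\<close>

lemma chain_cong:
  "(\<And>k' j. k' < k \<Longrightarrow> j \<in> {1..n} \<Longrightarrow> \<xi> k' j = \<xi>' k' j) \<Longrightarrow> chain n r x0 \<xi> k = chain n r x0 \<xi>' k"
proof (induction k)
  case (Suc k)
  then have "chain n r x0 \<xi> k = chain n r x0 \<xi>' k" by simp
  moreover have "move n r x (\<xi> k) = move n r x (\<xi>' k)" for x using Suc.prems by (intro move_cong) auto
  ultimately show ?case by simp
qed simp

lemma chain_weyl: "weyl_minus n x0 \<Longrightarrow> weyl_minus n (chain n r x0 \<xi> k)"
  by (cases k) (auto simp: move_weyl, auto simp: weyl_minus_def)

lemma chain_bounded:
  assumes "weyl_minus n x0" "0 \<le> r" "j \<in> {1..n}"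
  shows "\<bar>chain n r x0 \<xi> k j\<bar> \<le> (\<Sum>j\<in>{1..n}. \<bar>x0 j\<bar>) + k * (spread n * r)"
proof (induction k)
  case 0
  have "\<bar>x0 j\<bar> \<le> (\<Sum>j\<in>{1..n}. \<bar>x0 j\<bar>)" by (rule member_le_sum) (use assms in auto)
  then show ?case using assms by simp
next
  case (Suc k)
  then show ?case
    using move_bounded[OF chain_weyl[OF assms(1)] assms(2,3), of r \<xi> k "\<xi> k"]
    by (auto simp: algebra_simps)
qed

lemma measurable_chain:
  assumes "\<And>k' j. k' < k \<Longrightarrow> j \<in> {1..n} \<Longrightarrow> (\<lambda>\<omega>. \<xi> \<omega> k' j) \<in> borel_measurable M"
  shows "(\<lambda>\<omega>. chain n r x0 (\<xi> \<omega>) k) \<in> M \<rightarrow>\<^sub>M PiM {1..n} (\<lambda>_. borel)"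
  using assms
proof (induction k)
  case 0
  show ?case unfolding chain.simps by (intro measurable_restrict) auto
next
  case (Suc k)
  then have "(\<lambda>\<omega>. chain n r x0 (\<xi> \<omega>) k) \<in> M \<rightarrow>\<^sub>M PiM {1..n} (\<lambda>_. borel)" by simp
  from measurable_compose[OF this measurable_component_singleton]
  show ?case unfolding chain.simps(2)
    by (intro measurable_move Suc.prems) auto
qed

text \<open>The state after k steps is a measurable function of the increments before time k h,
  hence independent of the next increment vector, whose law is \<open>noise h n\<close>. The
  transition identity is then Fubini for the product of the two laws.\<close>

lemma BM_chain_reflected_walk:
  assumes BM: "indep_std_BMs M {1..n} B" and n: "1 \<le> n" and h: "0 < h" and r: "0 < r" "6 * h \<le> r\<^sup>2"
    and x0: "weyl_minus n x0"
  defines "inc \<equiv> \<lambda>\<omega> k j. B j (real (Suc k) * h) \<omega> - B j (real k * h) \<omega>"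
  shows "reflected_walk p q M n h r x0 (\<lambda>k \<omega>. chain n r x0 (inc \<omega>) k)"
proof -
  let ?S = "PiM {1..n} (\<lambda>_. borel :: real measure)"
  interpret prob_space M by (rule indep_std_BMsD(1)[OF BM])
  have minc: "(\<lambda>\<omega>. inc \<omega> k j) \<in> borel_measurable M" if "j \<in> {1..n}" for k j
    unfolding inc_def using h that by (intro borel_measurable_diff indep_std_BMsD(2)[OF BM]) auto
  have mX: "(\<lambda>\<omega>. chain n r x0 (inc \<omega>) k) \<in> M \<rightarrow>\<^sub>M ?S" for k
    by (rule measurable_chain) (rule minc)
  define Z where "Z k \<omega> = (\<lambda>j\<in>{1..n}. inc \<omega> k j)" for k \<omega>
  have ind: "indep_vars (\<lambda>_. borel) (\<lambda>(j, k) \<omega>. inc \<omega> k j) ({1..n} \<times> {..<L})" for L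
    unfolding inc_def by (rule indep_std_BMsD(4)[OF BM h])
  \<comment> \<open>The increments are indexed by pairs (j, k). Independence gives a product law
    over the pairs with this \<open>k\<close>, and the index set is then renamed to
    \<open>{1..n}\<close>.\<close>
  have lawZ: "distr M ?S (Z k) = noise h n" for k
  proof -
    let ?I = "{1..n} \<times> {k}"
    have ik: "indep_vars (\<lambda>_. borel) (\<lambda>(j, k) \<omega>. inc \<omega> k j) ?I"
      by (rule indep_vars_subset[OF ind[of "Suc k"]]) auto
    have rv: "random_variable borel (case i of (j, k) \<Rightarrow> \<lambda>\<omega>. inc \<omega> k j)" if "i \<in> ?I" for i
      using that minc by auto
    have "distr M (PiM ?I (\<lambda>_. borel)) (\<lambda>\<omega>. \<lambda>i\<in>?I. (case i of (j, k) \<Rightarrow> \<lambda>\<omega>. inc \<omega> k j) \<omega>)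
        = PiM ?I (\<lambda>i. distr M borel (case i of (j, k) \<Rightarrow> \<lambda>\<omega>. inc \<omega> k j))"
      using indep_vars_iff_distr_eq_PiM'[of ?I "\<lambda>(j, k) \<omega>. inc \<omega> k j" "\<lambda>_. borel"] ik rv n by auto
    also have "\<dots> = PiM ?I (\<lambda>_. gauss h)"
      by (intro PiM_cong refl) (auto simp: inc_def intro!: indep_std_BMsD(5)[OF BM h, simplified])
    finally have D: "distr M (PiM ?I (\<lambda>_. borel)) (\<lambda>\<omega>. \<lambda>i\<in>?I. (case i of (j, k) \<Rightarrow> \<lambda>\<omega>. inc \<omega> k j) \<omega>)
      = PiM ?I (\<lambda>_. gauss h)" .
    have "noise h n = distr (PiM ?I (\<lambda>_. gauss h)) (PiM {1..n} (\<lambda>_. gauss h)) (\<lambda>\<omega>. \<lambda>j\<in>{1..n}. \<omega> (j, k))"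
      unfolding noise_def
      using distr_PiM_reindex[of ?I "\<lambda>_. gauss h" "\<lambda>j. (j, k)" "{1..n}"] prob_space_gauss[OF h]
      by (auto simp: inj_on_def)
    also have "\<dots> = distr (PiM ?I (\<lambda>_. gauss h)) ?S (\<lambda>\<omega>. \<lambda>j\<in>{1..n}. \<omega> (j, k))"
      by (intro distr_cong refl sets_PiM_cong) auto
    also have "\<dots> = distr M ?S ((\<lambda>\<omega>. \<lambda>j\<in>{1..n}. \<omega> (j, k)) \<circ> (\<lambda>\<omega>. \<lambda>i\<in>?I. (case i of (j, k) \<Rightarrow> \<lambda>\<omega>. inc \<omega> k j) \<omega>))"
      unfolding D[symmetric]
    proof (rule distr_distr)
      show "(\<lambda>\<omega>. \<lambda>j\<in>{1..n}. \<omega> (j, k)) \<in> PiM ?I (\<lambda>_. borel) \<rightarrow>\<^sub>M ?S"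
        by (intro measurable_restrict measurable_component_singleton) auto
      show "(\<lambda>\<omega>. \<lambda>i\<in>?I. (case i of (j, k) \<Rightarrow> \<lambda>\<omega>. inc \<omega> k j) \<omega>) \<in> M \<rightarrow>\<^sub>M PiM ?I (\<lambda>_. borel)"
        by (intro measurable_restrict rv)
    qed
    also have "\<dots> = distr M ?S (Z k)"
      by (intro distr_cong refl) (auto simp: Z_def o_def)
    finally show ?thesis by simp
  qed
  have indep: "indep_var ?S (\<lambda>\<omega>. chain n r x0 (inc \<omega>) k) ?S (Z k)" for k
  proof -
    let ?I = "{1..n} \<times> {..<k}" and ?J = "{1..n} \<times> {k}"
    let ?Y = "\<lambda>(j, k) \<omega>. inc \<omega> k j"
    have "indep_var (PiM ?I (\<lambda>_. borel)) (\<lambda>\<omega>. restrict (\<lambda>i. ?Y i \<omega>) ?I) (PiM ?J (\<lambda>_. borel)) (\<lambda>\<omega>. restrict (\<lambda>i. ?Y i \<omega>) ?J)"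
      by (rule indep_var_restrict[OF ind[of "Suc k"]]) auto
    moreover have "(\<lambda>v. chain n r x0 (\<lambda>k j. v (j, k)) k) \<in> PiM ?I (\<lambda>_. borel) \<rightarrow>\<^sub>M ?S"
      by (intro measurable_chain measurable_component_singleton) auto
    moreover have "(\<lambda>v. \<lambda>j\<in>{1..n}. v (j, k)) \<in> PiM ?J (\<lambda>_. borel) \<rightarrow>\<^sub>M ?S"
      by (intro measurable_restrict measurable_component_singleton) auto
    ultimately have "indep_var ?S ((\<lambda>v. chain n r x0 (\<lambda>k j. v (j, k)) k) \<circ> (\<lambda>\<omega>. restrict (\<lambda>i. ?Y i \<omega>) ?I))
        ?S ((\<lambda>v. \<lambda>j\<in>{1..n}. v (j, k)) \<circ> (\<lambda>\<omega>. restrict (\<lambda>i. ?Y i \<omega>) ?J))"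
      by (rule indep_var_compose)
    moreover have "(\<lambda>v. chain n r x0 (\<lambda>k j. v (j, k)) k) \<circ> (\<lambda>\<omega>. restrict (\<lambda>i. ?Y i \<omega>) ?I)
        = (\<lambda>\<omega>. chain n r x0 (inc \<omega>) k)"
      unfolding o_def by (intro ext chain_cong) auto
    moreover have "(\<lambda>v. \<lambda>j\<in>{1..n}. v (j, k)) \<circ> (\<lambda>\<omega>. restrict (\<lambda>i. ?Y i \<omega>) ?J) = Z k"
      by (auto simp: o_def Z_def fun_eq_iff)
    ultimately show ?thesis by simp
  qed
  show ?thesis
  proof unfold_locales
    show "0 < h" "0 < r" "6 * h \<le> r\<^sup>2" by fact+
    show "chain n r x0 (inc \<omega>) 0 j = x0 j" if "j \<in> {1..n}" for \<omega> j using that by simp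
    show "(\<lambda>\<omega>. chain n r x0 (inc \<omega>) k) \<in> M \<rightarrow>\<^sub>M ?S" for k by (rule mX)
    show "weyl_minus n (chain n r x0 (inc \<omega>) k)" for k \<omega> by (rule chain_weyl[OF x0])
    show "\<exists>B. \<forall>\<omega>. \<forall>j\<in>{1..n}. \<bar>chain n r x0 (inc \<omega>) k j\<bar> \<le> B" for k
      using chain_bounded[OF x0] r by (meson less_imp_le)
  next
    fix k and f :: "(nat \<Rightarrow> real) \<Rightarrow> real"
    assume f: "f \<in> borel_measurable ?S" and i: "integrable M (\<lambda>\<omega>. f (chain n r x0 (inc \<omega>) (Suc k)))"
    let ?X = "\<lambda>\<omega>. chain n r x0 (inc \<omega>) k"
    let ?F = "\<lambda>u. f (move n r (fst u) (snd u))"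
    have XZ: "distr M ?S ?X \<Otimes>\<^sub>M noise h n = distr M (?S \<Otimes>\<^sub>M ?S) (\<lambda>\<omega>. (?X \<omega>, Z k \<omega>))"
      and mZ: "Z k \<in> M \<rightarrow>\<^sub>M ?S"
      using indep[of k] unfolding indep_var_distribution_eq lawZ by auto
    have mXZ: "(\<lambda>\<omega>. (?X \<omega>, Z k \<omega>)) \<in> M \<rightarrow>\<^sub>M ?S \<Otimes>\<^sub>M ?S" using mX mZ by (rule measurable_Pair)
    have mF: "?F \<in> borel_measurable (?S \<Otimes>\<^sub>M ?S)"
      by (intro measurable_compose[OF measurable_move f] measurable_compose[OF measurable_fst measurable_component_singleton]
          measurable_compose[OF measurable_snd measurable_component_singleton])
    have FX: "?F (?X \<omega>, Z k \<omega>) = f (chain n r x0 (inc \<omega>) (Suc k))" for \<omega>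
      using move_cong[of n "Z k \<omega>" "inc \<omega> k" r "?X \<omega>"] by (simp add: Z_def)
    interpret D: prob_space "distr M ?S ?X" by (rule prob_space_distr[OF mX])
    interpret Z: prob_space "noise h n" by (rule prob_space_noise[OF h])
    interpret DZ: pair_sigma_finite "distr M ?S ?X" "noise h n" ..
    have iF: "integrable (distr M ?S ?X \<Otimes>\<^sub>M noise h n) ?F"
      unfolding XZ by (subst integrable_distr_eq[OF mXZ mF]) (use i FX in simp)
    have i1: "integrable (distr M ?S ?X) (\<lambda>x. \<integral>z. f (move n r x z) \<partial>noise h n)"
      using DZ.integrable_fst[of "\<lambda>x z. f (move n r x z)"] iF by (simp add: case_prod_unfold)
    have m1: "(\<lambda>x. \<integral>z. f (move n r x z) \<partial>noise h n) \<in> borel_measurable ?S"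
      using borel_measurable_integrable[OF i1] by simp
    have "integrable M (\<lambda>\<omega>. \<integral>z. f (move n r (?X \<omega>) z) \<partial>noise h n)"
      using i1 by (subst (asm) integrable_distr_eq[OF mX m1])
    moreover have "(\<integral>\<omega>. f (chain n r x0 (inc \<omega>) (Suc k)) \<partial>M) = (\<integral>u. ?F u \<partial>(distr M ?S ?X \<Otimes>\<^sub>M noise h n))"
      unfolding XZ integral_distr[OF mXZ mF] FX ..
    moreover have "\<dots> = (\<integral>x. (\<integral>z. f (move n r x z) \<partial>noise h n) \<partial>distr M ?S ?X)"
      using DZ.integral_fst[of "\<lambda>x z. f (move n r x z)"] iF by (simp add: case_prod_unfold)
    moreover have "\<dots> = (\<integral>\<omega>. (\<integral>z. f (move n r (?X \<omega>) z) \<partial>noise h n) \<partial>M)"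
      by (rule integral_distr[OF mX m1])
    ultimately show "integrable M (\<lambda>\<omega>. \<integral>z. f (move n r (?X \<omega>) z) \<partial>noise h n) \<and>
        (\<integral>\<omega>. f (chain n r x0 (inc \<omega>) (Suc k)) \<partial>M) = (\<integral>\<omega>. (\<integral>z. f (move n r (?X \<omega>) z) \<partial>noise h n) \<partial>M)"
      by simp
  qed
qed

end

section \<open>Convergence to the reflected path\<close>

text \<open>Let s1 be the first time at which \<open>L\<close> takes its value at \<open>s\<close>;
  it is positive because that value is not 0. \<open>L\<close> increases on every interval [u, s1]
  with u < s1, so each of them contains a zero of \<open>Z\<close>, and since the zero set is
  closed, s1 is itself a zero.\<close>

lemma collision_last_zero:
  assumes ct: "collision_local_time L Z" and contZ: "continuous_on {0..} Z"
    and "0 \<le> s" "L s \<noteq> 0"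
  shows "\<exists>u\<in>{0..s}. L u = L s \<and> Z u = 0"
proof -
  have L: "L 0 = 0" "continuous_on {0..} L" "mono_on {0..} L"
    and hit: "\<And>s t. 0 \<le> s \<Longrightarrow> s \<le> t \<Longrightarrow> L s < L t \<Longrightarrow> \<exists>u\<in>{s..t}. Z u = 0"
    using ct unfolding collision_local_time_def by blast+
  define S where "S = {u \<in> {0..s}. L u = L s}"
  have "closed S" unfolding S_def
    using continuous_on_subset[OF L(2)] by (intro continuous_closed_preimage_constant) auto
  moreover have sS: "s \<in> S" using assms by (auto simp: S_def)
  moreover have bS: "bdd_below S" by (auto simp: S_def intro: bdd_belowI[of _ 0])
  ultimately have "Inf S \<in> S" using closed_contains_Inf by blast
  then obtain s1 where s1: "s1 = Inf S" "0 \<le> s1" "s1 \<le> s" "L s1 = L s" by (auto simp: S_def)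
  have "s1 \<noteq> 0" using s1 L(1) assms(4) by auto
  then have s1_pos: "0 < s1" using s1 by simp
  have less: "L u < L s1" if "0 \<le> u" "u < s1" for u
  proof -
    have "u \<notin> S" using cInf_lower[OF _ bS, of u] that s1 by auto
    then have "L u \<noteq> L s" using that s1 by (auto simp: S_def)
    moreover have "L u \<le> L s1" using L(3) that s1 by (auto elim!: mono_onD)
    ultimately show ?thesis using s1 by simp
  qed
  define Q where "Q = {v \<in> {0..s1}. Z v = 0}"
  have "closed Q" unfolding Q_def
    using continuous_on_subset[OF contZ] by (intro continuous_closed_preimage_constant) auto
  moreover have "Q \<noteq> {}" using hit[of 0 s1] less[of 0] s1_pos by (auto simp: Q_def)
  moreover have bQ: "bdd_above Q" by (auto simp: Q_def intro: bdd_aboveI[of _ s1])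
  ultimately have vQ: "Sup Q \<in> Q" using closed_contains_Sup by blast
  have "Sup Q = s1"
  proof (rule ccontr)
    assume "Sup Q \<noteq> s1"
    then have lt: "0 \<le> Sup Q" "Sup Q < s1" using vQ by (auto simp: Q_def)
    define u where "u = (Sup Q + s1) / 2"
    have u: "0 \<le> u" "u < s1" "Sup Q < u" using lt s1_pos by (auto simp: u_def)
    then obtain v where "v \<in> {u..s1}" "Z v = 0" using hit[of u s1] less[of u] by auto
    then have "v \<in> Q" using u by (auto simp: Q_def)
    then have "v \<le> Sup Q" using bQ by (rule cSup_upper)
    then show False using \<open>v \<in> {u..s1}\<close> u by auto
  qed
  then show ?thesis using vQ s1 by (auto simp: Q_def intro!: bexI[of _ s1])
qed

definition grid :: "real \<Rightarrow> real \<Rightarrow> nat" where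
  "grid h s = nat \<lfloor>s / h\<rfloor>"

lemma grid_bounds:
  assumes "0 < h" "0 \<le> s"
  shows "real (grid h s) * h \<le> s" "s - h < real (grid h s) * h"
proof -
  have "real (grid h s) = of_int \<lfloor>s / h\<rfloor>" using assms by (simp add: grid_def)
  then have "real (grid h s) \<le> s / h" "s / h < real (grid h s) + 1" by linarith+
  then show "real (grid h s) * h \<le> s" "s - h < real (grid h s) * h"
    using assms by (auto simp: field_simps)
qed

lemma grid_mult: "0 < h \<Longrightarrow> grid h (real k * h) = k"
  by (simp add: grid_def)

lemma grid_mono: "0 < h \<Longrightarrow> s \<le> t \<Longrightarrow> grid h s \<le> grid h t"
  unfolding grid_def by (intro nat_mono floor_mono divide_right_mono) auto

context oblique
begin

definition gap_input :: "(nat \<Rightarrow> real) \<Rightarrow> (nat \<Rightarrow> real \<Rightarrow> real) \<Rightarrow> nat \<Rightarrow> real \<Rightarrow> real" where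
  "gap_input x0 b j s = (x0 j - x0 (Suc j)) + (b j s - b (Suc j) s)"

lemma gap_identity:
  assumes eq: "\<And>j. j \<in> {1..n} \<Longrightarrow> x j = x0 j + c j + p * L j - q * L (j - 1)" and j: "j \<in> {1..<n}"
  shows "x j - x (Suc j) = (x0 j - x0 (Suc j)) + (c j - c (Suc j)) + L j - q * L (j - 1) - p * L (Suc j)"
proof -
  have "p * L j + q * L j = L j" using p_q_sum by (metis distrib_right mult_1)
  then show ?thesis using eq[of j] eq[of "Suc j"] j by simp
qed

text \<open>The family \<open>l\<close> is cut off to \<open>L\<close> because the equations leave
  it unspecified outside \<open>{1..<n}\<close>, where \<open>skorokhod\<close> asks for 0.
  Complementarity in the required form comes from \<open>collision_last_zero\<close>.\<close>

lemma BMPI_down_skorokhod: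
  fixes b x l :: "nat \<Rightarrow> real \<Rightarrow> real"
  assumes eq: "\<forall>j\<in>{1..n}. \<forall>t\<ge>0. x j t = x0 j + b j t
        + p * (if j < n then l j t else 0) - q * (if 1 < j then l (j - 1) t else 0)"
    and ct: "\<forall>j\<in>{1..<n}. collision_local_time (l j) (\<lambda>t. x j t - x (Suc j) t)"
    and cont: "\<And>j. j \<in> {1..n} \<Longrightarrow> continuous_on {0..} (b j)"
  defines "L \<equiv> \<lambda>j s. if j \<in> {1..<n} then l j s else 0"
  shows "\<And>j t. j \<in> {1..n} \<Longrightarrow> 0 \<le> t \<Longrightarrow> x j t = x0 j + b j t + p * L j t - q * L (j - 1) t"
    and "skorokhod p q n T (gap_input x0 b) L"
    and "\<And>j. j \<in> {1..n} \<Longrightarrow> continuous_on {0..} (x j)"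
proof -
  show xe: "x j t = x0 j + b j t + p * L j t - q * L (j - 1) t" if "j \<in> {1..n}" "0 \<le> t" for j t
    using eq that by (auto simp: L_def)
  have cl: "continuous_on {0..} (L j)" for j
    using ct by (cases "j \<in> {1..<n}") (auto simp: L_def collision_local_time_def)
  show cx: "continuous_on {0..} (x j)" if "j \<in> {1..n}" for j
  proof (rule continuous_on_eq)
    show "continuous_on {0..} (\<lambda>t. x0 j + b j t + p * L j t - q * L (j - 1) t)"
      by (intro continuous_intros cont that cl)
  qed (use xe[OF that] in auto)
  have gap: "x j t - x (Suc j) t = gap_input x0 b j t + L j t - q * L (j - 1) t - p * L (Suc j) t"
    if "j \<in> {1..<n}" "0 \<le> t" for j t
    unfolding gap_input_def by (rule gap_identity[OF _ that(1)]) (use xe that(2) in auto)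
  show "skorokhod p q n T (gap_input x0 b) L"
    unfolding skorokhod_def
  proof (intro conjI allI ballI impI)
    show "L j s = 0" if "j \<notin> {1..<n}" for j s unfolding L_def using that by (rule if_not_P)
    fix j assume j: "j \<in> {1..<n}"
    have c: "collision_local_time (L j) (\<lambda>t. x j t - x (Suc j) t)"
      using ct j by (simp add: L_def)
    then have L: "L j 0 = 0" "mono_on {0..} (L j)" "\<And>t. 0 \<le> t \<Longrightarrow> 0 \<le> x j t - x (Suc j) t"
      by (auto simp: collision_local_time_def)
    show "mono_on {0..T} (L j)" using L(2) by (rule mono_on_subset) auto
    fix s assume s: "s \<in> {0..T}"
    show "0 \<le> L j s" using mono_onD[OF L(2), of 0 s] s L(1) by simp
    show "0 \<le> gap_input x0 b j s + L j s - q * L (j - 1) s - p * L (Suc j) s"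
      using L(3)[of s] gap[OF j, of s] s by simp
    show "L j s = 0 \<or> (\<exists>u\<in>{0..s}. L j u = L j s \<and>
        gap_input x0 b j u + L j u - q * L (j - 1) u - p * L (Suc j) u = 0)"
    proof (cases "L j s = 0")
      case False
      have "continuous_on {0..} (\<lambda>t. x j t - x (Suc j) t)"
        using j by (intro continuous_on_diff cx) auto
      then obtain u where "u \<in> {0..s}" "L j u = L j s" "x j u - x (Suc j) u = 0"
        using collision_last_zero[OF c _ _ False] s by auto
      then show ?thesis using gap[OF j, of u] by (intro disjI2 bexI[of _ u]) auto
    qed simp
  qed
qed

text \<open>Under \<open>small\<close> the truncation is inactive up to \<open>T\<close>, so the
  walk follows the sampled path exactly, and the partial sums of its pushes act as a piecewise
  constant local time.\<close>

lemma chain_skorokhod: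
  fixes b :: "nat \<Rightarrow> real \<Rightarrow> real"
  assumes h: "0 < h" and x0: "weyl_minus n x0" and b0: "\<And>j. j \<in> {1..n} \<Longrightarrow> b j 0 = 0"
    and small: "\<And>k j. k < grid h T \<Longrightarrow> j \<in> {1..n} \<Longrightarrow> \<bar>b j (real (Suc k) * h) - b j (real k * h)\<bar> \<le> r"
  defines "inc \<equiv> \<lambda>k j. b j (real (Suc k) * h) - b j (real k * h)"
  defines "D \<equiv> \<lambda>j K. \<Sum>k<K. push n (\<lambda>i\<in>{1..n}. chain n r x0 inc k i + clip r (inc k i)) j"
  shows "\<And>k j. k \<le> grid h T \<Longrightarrow> j \<in> {1..n} \<Longrightarrow>
      chain n r x0 inc k j = x0 j + b j (real k * h) + p * D j k - q * D (j - 1) k"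
    and "skorokhod p q n T (\<lambda>j s. gap_input x0 b j (real (grid h s) * h)) (\<lambda>j s. D j (grid h s))"
proof -
  show ch: "chain n r x0 inc k j = x0 j + b j (real k * h) + p * D j k - q * D (j - 1) k"
    if "k \<le> grid h T" "j \<in> {1..n}" for k j
    using that(1)
  proof (induction k)
    case 0
    then show ?case using that b0 by (simp add: D_def)
  next
    case (Suc k)
    have "clip r (inc k j) = inc k j" using small[of k j] Suc.prems that by (intro clip_id) (auto simp: inc_def)
    then have "chain n r x0 inc (Suc k) j = chain n r x0 inc k j + inc k j
        + p * (D j (Suc k) - D j k) - q * (D (j - 1) (Suc k) - D (j - 1) k)"
      using that(2) by (simp add: move_def reflect_def D_def)
    then show ?case using Suc by (simp add: inc_def algebra_simps)
  qed
  have gap: "chain n r x0 inc k j - chain n r x0 inc k (Suc j)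
      = gap_input x0 b j (real k * h) + D j k - q * D (j - 1) k - p * D (Suc j) k"
    if "k \<le> grid h T" "j \<in> {1..<n}" for k j
    unfolding gap_input_def by (rule gap_identity[OF _ that(2)]) (use ch that(1) in auto)
  have Dmono: "D j k \<le> D j k'" if "k \<le> k'" for j k k'
    unfolding D_def by (rule sum_mono2) (use that in \<open>auto simp: push_nonneg\<close>)
  have D0: "0 \<le> D j k" for j k by (simp add: D_def sum_nonneg push_nonneg)
  show "skorokhod p q n T (\<lambda>j s. gap_input x0 b j (real (grid h s) * h)) (\<lambda>j s. D j (grid h s))"
    unfolding skorokhod_def
  proof (intro conjI allI ballI impI)
    show "D j (grid h s) = 0" if "j \<notin> {1..<n}" for j s
      using that by (simp add: D_def push_outside)
    fix j assume j: "j \<in> {1..<n}"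
    show "mono_on {0..T} (\<lambda>s. D j (grid h s))"
      by (intro mono_onI Dmono grid_mono h)
    fix s assume s: "s \<in> {0..T}"
    have gs: "grid h s \<le> grid h T" using s by (intro grid_mono h) auto
    show "0 \<le> D j (grid h s)" by (rule D0)
    have "chain n r x0 inc (grid h s) (Suc j) \<le> chain n r x0 inc (grid h s) j"
      using chain_weyl[OF x0, of r inc "grid h s"] j by (auto simp: weyl_minus_def)
    then show "0 \<le> gap_input x0 b j (real (grid h s) * h) + D j (grid h s)
        - q * D (j - 1) (grid h s) - p * D (Suc j) (grid h s)"
      using gap[OF gs j] by simp
    show "D j (grid h s) = 0 \<or> (\<exists>u\<in>{0..s}. D j (grid h u) = D j (grid h s) \<and>
        gap_input x0 b j (real (grid h u) * h) + D j (grid h u) - q * D (j - 1) (grid h u) - p * D (Suc j) (grid h u) = 0)"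
    proof (cases "D j (grid h s) = 0")
      case False
      define ps where "ps k = push n (\<lambda>i\<in>{1..n}. chain n r x0 inc k i + clip r (inc k i)) j" for k
      have Dp: "D j K = (\<Sum>k<K. ps k)" for K by (simp add: D_def ps_def)
      have ex: "\<exists>k. k < grid h s \<and> ps k \<noteq> 0"
        using False unfolding Dp by (metis (no_types, lifting) lessThan_iff sum.neutral)
      \<comment> \<open>The last step before \<open>s\<close> with a nonzero push.
        \<open>D j K\<close> sums the steps before K, so this push is first counted at
        \<open>Suc k\<close>, where the gap is 0 by complementarity of the reflection; from then on
        \<open>D j\<close> is constant up to \<open>s\<close>.\<close>
      define k where "k = Max {k. k < grid h s \<and> ps k \<noteq> 0}"
      have "k \<in> {k. k < grid h s \<and> ps k \<noteq> 0}" unfolding k_def using ex by (intro Max_in) auto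
      then have k: "k < grid h s" "ps k \<noteq> 0" by auto
      have after: "ps k' = 0" if "k < k'" "k' < grid h s" for k'
        using that Max_ge[of "{k. k < grid h s \<and> ps k \<noteq> 0}" k'] unfolding k_def[symmetric] by force
      have Deq: "D j (Suc k) = D j (grid h s)"
        unfolding Dp by (rule sum.mono_neutral_left) (use k after in auto)
      have "chain n r x0 inc (Suc k) j - chain n r x0 inc (Suc k) (Suc j) = 0"
        using reflect_gap_eq_0[OF j k(2)[unfolded ps_def]] by (simp add: move_def)
      moreover have "Suc k \<le> grid h T" using k gs by simp
      ultimately have z: "gap_input x0 b j (real (Suc k) * h) + D j (Suc k) - q * D (j - 1) (Suc k) - p * D (Suc j) (Suc k) = 0"
        using gap[OF _ j, of "Suc k"] by simp
      have "real (Suc k) * h \<le> real (grid h s) * h" using k h by (intro mult_right_mono) auto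
      also have "\<dots> \<le> s" using grid_bounds(1)[OF h] s by auto
      finally have u: "real (Suc k) * h \<in> {0..s}" using h by simp
      show ?thesis
        by (intro disjI2 bexI[OF _ u]) (simp only: grid_mult[OF h], intro conjI Deq z)
    qed simp
  qed
qed

text \<open>Both paths solve Skorokhod problems with gap inputs within 2\<epsilon> of each other,
  \<epsilon> from each coordinate. \<open>skorokhod_compare\<close> bounds the pushing terms, and p
  + q = 1 combines the two of them without a further factor.\<close>

lemma chain_close:
  fixes b x l :: "nat \<Rightarrow> real \<Rightarrow> real"
  assumes eq: "\<forall>j\<in>{1..n}. \<forall>t\<ge>0. x j t = x0 j + b j t
        + p * (if j < n then l j t else 0) - q * (if 1 < j then l (j - 1) t else 0)"
    and ct: "\<forall>j\<in>{1..<n}. collision_local_time (l j) (\<lambda>t. x j t - x (Suc j) t)"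
    and cont: "\<And>j. j \<in> {1..n} \<Longrightarrow> continuous_on {0..} (b j)"
    and b0: "\<And>j. j \<in> {1..n} \<Longrightarrow> b j 0 = 0"
    and h: "0 < h" and x0: "weyl_minus n x0"
    and small: "\<And>k j. k < grid h T \<Longrightarrow> j \<in> {1..n} \<Longrightarrow> \<bar>b j (real (Suc k) * h) - b j (real k * h)\<bar> \<le> r"
    and osc: "\<And>j s. j \<in> {1..n} \<Longrightarrow> s \<in> {0..T} \<Longrightarrow> \<bar>b j s - b j (real (grid h s) * h)\<bar> \<le> \<epsilon>"
    and s: "s \<in> {0..T}" and j: "j \<in> {1..n}"
  shows "\<bar>x j s - chain n r x0 (\<lambda>k j. b j (real (Suc k) * h) - b j (real k * h)) (grid h s) j\<bar>
    \<le> \<epsilon> * (1 + 2 * real n / (q - p))"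
proof -
  define inc where "inc = (\<lambda>k j. b j (real (Suc k) * h) - b j (real k * h))"
  define D where "D = (\<lambda>j K. \<Sum>k<K. push n (\<lambda>i\<in>{1..n}. chain n r x0 inc k i + clip r (inc k i)) j)"
  define L where "L = (\<lambda>j s. if j \<in> {1..<n} then l j s else 0)"
  have bs1: "x j t = x0 j + b j t + p * L j t - q * L (j - 1) t" if "j \<in> {1..n}" "0 \<le> t" for j t
    unfolding L_def by (rule BMPI_down_skorokhod(1)[where b = b, OF eq ct cont that])
  have bs2: "skorokhod p q n T (gap_input x0 b) L"
    unfolding L_def by (rule BMPI_down_skorokhod(2)[where b = b, OF eq ct cont])
  have cs1: "chain n r x0 inc k j = x0 j + b j (real k * h) + p * D j k - q * D (j - 1) k"
    if "k \<le> grid h T" "j \<in> {1..n}" for k j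
    unfolding D_def inc_def by (rule chain_skorokhod(1)[where b = b, OF h x0 b0 small that])
  have cs2: "skorokhod p q n T (\<lambda>j s. gap_input x0 b j (real (grid h s) * h)) (\<lambda>j s. D j (grid h s))"
    unfolding D_def inc_def by (rule chain_skorokhod(2)[where b = b, OF h x0 b0 small])
  have \<epsilon>: "0 \<le> \<epsilon>" using osc[OF j s] by linarith
  have cmp: "\<bar>L i s - D i (grid h s)\<bar> \<le> 2 * \<epsilon> * real n / (q - p)" for i
  proof (cases "i \<in> {1..<n}")
    case True
    have "\<bar>L i s - D i (grid h s)\<bar> \<le> 2 * \<epsilon> * real i / (q - p)"
    proof (rule skorokhod_compare[where L' = "\<lambda>j s. D j (grid h s)", OF bs2 cs2 _ _ s])
      fix i s assume i: "i \<in> {1..<n}" and s: "s \<in> {0..T}"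
      show "\<bar>gap_input x0 b i s - gap_input x0 b i (real (grid h s) * h)\<bar> \<le> 2 * \<epsilon>"
        using osc[of i s] osc[of "Suc i" s] i s by (auto simp: gap_input_def abs_le_iff)
    qed (use \<epsilon> in auto)
    also have "\<dots> \<le> 2 * \<epsilon> * real n / (q - p)"
      using True \<epsilon> q_minus_p by (intro divide_right_mono mult_left_mono) auto
    finally show ?thesis .
  next
    case False
    then have "L i s = 0" "D i (grid h s) = 0" by (auto simp: L_def D_def push_outside)
    then show ?thesis using \<epsilon> q_minus_p by simp
  qed
  define E where "E = 2 * \<epsilon> * real n / (q - p)"
  have gs: "grid h s \<le> grid h T" using s by (intro grid_mono h) auto
  have "x j s - chain n r x0 inc (grid h s) j = (b j s - b j (real (grid h s) * h))
      + p * (L j s - D j (grid h s)) - q * (L (j - 1) s - D (j - 1) (grid h s))"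
    using bs1[OF j, of s] cs1[OF gs j] s by (simp add: algebra_simps)
  moreover have "\<bar>p * (L j s - D j (grid h s))\<bar> \<le> p * E" "\<bar>q * (L (j - 1) s - D (j - 1) (grid h s))\<bar> \<le> q * E"
    unfolding abs_mult abs_of_pos[OF p_pos] abs_of_pos[OF q_pos] E_def
    by (intro mult_left_mono cmp less_imp_le[OF p_pos] less_imp_le[OF q_pos])+
  moreover have "p * E + q * E = E" using p_q_sum by (metis distrib_right mult_1)
  ultimately have "\<bar>x j s - chain n r x0 inc (grid h s) j\<bar> \<le> \<epsilon> + E"
    using osc[OF j s] by linarith
  also have "\<dots> = \<epsilon> * (1 + 2 * real n / (q - p))" by (simp add: E_def algebra_simps)
  finally show ?thesis unfolding inc_def .
qed

text \<open>Uniform continuity of the driving paths on the compact time interval makes their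
  oscillation over one cell of the grid tend to 0.\<close>

lemma chain_tendsto:
  fixes b x l :: "nat \<Rightarrow> real \<Rightarrow> real" and h r :: "nat \<Rightarrow> real"
  assumes eq: "\<forall>j\<in>{1..n}. \<forall>t\<ge>0. x j t = x0 j + b j t
        + p * (if j < n then l j t else 0) - q * (if 1 < j then l (j - 1) t else 0)"
    and ct: "\<forall>j\<in>{1..<n}. collision_local_time (l j) (\<lambda>t. x j t - x (Suc j) t)"
    and cont: "\<And>j. j \<in> {1..n} \<Longrightarrow> continuous_on {0..} (b j)"
    and b0: "\<And>j. j \<in> {1..n} \<Longrightarrow> b j 0 = 0" and x0: "weyl_minus n x0"
    and h: "\<And>i. 0 < h i" "h \<longlonglongrightarrow> 0"
    and small: "\<forall>\<^sub>F i in sequentially. \<forall>k<grid (h i) T. \<forall>j\<in>{1..n}.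
      \<bar>b j (real (Suc k) * h i) - b j (real k * h i)\<bar> \<le> r i"
    and s: "s \<in> {0..T}" and j: "j \<in> {1..n}"
  shows "(\<lambda>i. chain n (r i) x0 (\<lambda>k j. b j (real (Suc k) * h i) - b j (real k * h i)) (grid (h i) s) j) \<longlonglongrightarrow> x j s"
proof (rule LIMSEQ_I)
  fix e :: real assume e: "0 < e"
  define C where "C = 1 + 2 * real n / (q - p)"
  have C: "0 < C" using q_minus_p by (auto simp: C_def intro!: add_pos_nonneg)
  define \<epsilon> where "\<epsilon> = e / (2 * C)"
  have \<epsilon>: "0 < \<epsilon>" using e C by (simp add: \<epsilon>_def)
  have "\<exists>d>0. \<forall>u\<in>{0..T}. \<forall>v\<in>{0..T}. dist v u < d \<longrightarrow> dist (b j v) (b j u) < \<epsilon>" if "j \<in> {1..n}" for j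
  proof -
    have "continuous_on {0..T} (b j)" using cont[OF that] by (rule continuous_on_subset) auto
    then have "uniformly_continuous_on {0..T} (b j)" by (rule compact_uniformly_continuous) simp
    then show ?thesis using \<epsilon> unfolding uniformly_continuous_on_def by blast
  qed
  then obtain d where d: "\<And>j. j \<in> {1..n} \<Longrightarrow> 0 < d j"
    "\<And>j u v. j \<in> {1..n} \<Longrightarrow> u \<in> {0..T} \<Longrightarrow> v \<in> {0..T} \<Longrightarrow> dist v u < d j \<Longrightarrow> dist (b j v) (b j u) < \<epsilon>"
    by metis
  define d0 where "d0 = Min (d ` {1..n})"
  have d0: "0 < d0" "\<And>j. j \<in> {1..n} \<Longrightarrow> d0 \<le> d j" using d(1) j by (auto simp: d0_def)
  have "\<forall>\<^sub>F i in sequentially. h i < d0" using order_tendstoD(2)[OF h(2) d0(1)] .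
  with small have "\<forall>\<^sub>F i in sequentially. \<bar>x j s - chain n (r i) x0
      (\<lambda>k j. b j (real (Suc k) * h i) - b j (real k * h i)) (grid (h i) s) j\<bar> \<le> \<epsilon> * C"
  proof eventually_elim
    case (elim i)
    show ?case unfolding C_def
    proof (rule chain_close[where b = b and T = T, OF eq ct cont b0 h(1) x0 _ _ s j])
      fix j s assume j: "j \<in> {1..n}" and s: "s \<in> {0..T}"
      have g: "real (grid (h i) s) * h i \<le> s" "s - h i < real (grid (h i) s) * h i"
        using grid_bounds[OF h(1), of s i] s by auto
      have "dist (b j s) (b j (real (grid (h i) s) * h i)) < \<epsilon>"
        using g s elim(2) d0(2)[OF j] less_imp_le[OF h(1)[of i]]
        by (intro d(2)[OF j]) (auto simp: dist_real_def)
      then show "\<bar>b j s - b j (real (grid (h i) s) * h i)\<bar> \<le> \<epsilon>" by (simp add: dist_real_def)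
    qed (use elim(1) in auto)
  qed
  then obtain i0 where "\<And>i. i0 \<le> i \<Longrightarrow> \<bar>x j s - chain n (r i) x0
      (\<lambda>k j. b j (real (Suc k) * h i) - b j (real k * h i)) (grid (h i) s) j\<bar> \<le> \<epsilon> * C"
    unfolding eventually_sequentially by blast
  moreover have "\<epsilon> * C < e" using e C by (simp add: \<epsilon>_def)
  ultimately show "\<exists>i0. \<forall>i\<ge>i0. norm (chain n (r i) x0
      (\<lambda>k j. b j (real (Suc k) * h i) - b j (real k * h i)) (grid (h i) s) j - x j s) < e"
    unfolding real_norm_def abs_minus_commute[of _ "x j s"] by (meson le_less_trans)
qed

end

section \<open>Mesh and cutoff, and why truncation is eventually inactive\<close>

lemma gauss_tail:
  assumes h: "0 < h" and r: "0 < r"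
  shows "measure (gauss h) {u. r < \<bar>u\<bar>} \<le> 945 * h ^ 5 / r ^ 10"
proof -
  interpret prob_space "gauss h" by (rule prob_space_gauss[OF h])
  \<comment> \<open>The tenth Gaussian moment is 1 * 3 * 5 * 7 * 9 = 945 times h^5; division by r^10
    is then Markov's inequality.\<close>
  have m: "integrable (gauss h) (\<lambda>u. u ^ 10)" "(\<integral>u. u ^ 10 \<partial>gauss h) = 945 * h ^ 5"
    using gauss_moment_even[OF h, of 5] h by (auto simp: fact_numeral power_divide)
  have "measure (gauss h) {u. r < \<bar>u\<bar>} = (\<integral>u. indicator {u. r < \<bar>u\<bar>} u \<partial>gauss h)" by simp
  also have "\<dots> \<le> (\<integral>u. u ^ 10 / r ^ 10 \<partial>gauss h)"
  proof (rule integral_mono)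
    show "integrable (gauss h) (indicator {u. r < \<bar>u\<bar>} :: real \<Rightarrow> real)"
      by (rule integrable_prob_bounded[OF prob_space_axioms, where B = 1]) (auto simp: indicator_def)
    show "indicator {u. r < \<bar>u\<bar>} u \<le> u ^ 10 / r ^ 10" for u :: real
    proof (cases "r < \<bar>u\<bar>")
      case True
      then have "r ^ 10 \<le> \<bar>u\<bar> ^ 10" using r by (intro power_mono) auto
      then show ?thesis using True r by (simp add: power_even_abs)
    qed (use r in \<open>simp add: zero_le_even_power\<close>)
  qed (use m in simp)
  also have "\<dots> = 945 * h ^ 5 / r ^ 10" using m by simp
  finally show ?thesis .
qed

text \<open>The exponents make the total error \<open>r\<^sup>3 / h\<close> vanish while the tenth-moment bound
  \<open>h\<^sup>4 / r\<^sup>1\<^sup>0\<close> for the probability of a truncated increment stays summable.\<close>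
definition mesh :: "nat \<Rightarrow> real" where "mesh i = (1 / 256) ^ (i + 2)"

definition cutoff :: "nat \<Rightarrow> real" where "cutoff i = (1 / 8) ^ (i + 2)"

lemma mesh_pos: "0 < mesh i" and cutoff_pos: "0 < cutoff i"
  by (simp_all add: mesh_def cutoff_def)

text \<open>The quotient of the squared cutoff by the mesh is 4^(i + 2); the shift by 2 in both
  exponents makes it at least 16 from the start.\<close>

lemma mesh_cutoff: "6 * mesh i \<le> (cutoff i)\<^sup>2"
proof -
  have "(cutoff i)\<^sup>2 = (1 / 64) ^ (i + 2)"
    unfolding cutoff_def power_mult[symmetric] by (subst mult.commute) (simp add: power_mult power2_eq_square)
  also have "\<dots> = mesh i * 4 ^ (i + 2)"
    unfolding mesh_def power_mult_distrib[symmetric] by simp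
  finally have "(cutoff i)\<^sup>2 = mesh i * (16 * 4 ^ i)" by simp
  moreover have "(6::real) \<le> 16 * 4 ^ i" using one_le_power[of "4::real" i] by linarith
  ultimately show ?thesis using mult_left_mono[of 6 "16 * 4 ^ i" "mesh i"] mesh_pos[of i] by simp
qed

lemma mesh_tendsto: "mesh \<longlonglongrightarrow> 0"
  unfolding mesh_def by (intro LIMSEQ_ignore_initial_segment LIMSEQ_realpow_zero) auto

lemma mesh_cutoff_tail: "mesh i ^ 4 / cutoff i ^ 10 = (1 / 4) ^ (i + 2)"
proof -
  have "mesh i ^ 4 = ((1 / 256) ^ 4) ^ (i + 2)" "cutoff i ^ 10 = ((1 / 8) ^ 10) ^ (i + 2)"
    unfolding mesh_def cutoff_def power_mult[symmetric] by (simp_all add: mult.commute)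
  then show ?thesis by (simp only: power_divide[symmetric]) (simp add: power_divide)
qed

lemma mesh_cutoff_cube: "cutoff i ^ 3 / mesh i = (1 / 2) ^ (i + 2)"
proof -
  have "cutoff i ^ 3 = ((1 / 8) ^ 3) ^ (i + 2)"
    unfolding cutoff_def power_mult[symmetric] by (simp add: mult.commute)
  then show ?thesis unfolding mesh_def by (simp only: power_divide[symmetric]) (simp add: power_divide)
qed

context oblique
begin

text \<open>Borel-Cantelli: at most T / h steps in \<open>n\<close> coordinates, each exceeding the
  cutoff with probability at most 945 h^5 / r^10, give the summable bound 945 T n (1/4)^(i + 2). So
  on almost every path truncation changes nothing up to time \<open>T\<close> for all large
  \<open>i\<close>.\<close>

lemma BM_increments_small:
  assumes BM: "indep_std_BMs M {1..n} B" and T: "0 \<le> T"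
  shows "AE \<omega> in M. \<forall>\<^sub>F i in sequentially. \<forall>k<grid (mesh i) T. \<forall>j\<in>{1..n}.
    \<bar>B j (real (Suc k) * mesh i) \<omega> - B j (real k * mesh i) \<omega>\<bar> \<le> cutoff i"
proof -
  interpret prob_space M by (rule indep_std_BMsD(1)[OF BM])
  define inc where "inc i k j \<omega> = B j (real (Suc k) * mesh i) \<omega> - B j (real k * mesh i) \<omega>" for i k j \<omega>
  have [measurable]: "inc i k j \<in> borel_measurable M" if "j \<in> {1..n}" for i k j
    unfolding inc_def using mesh_pos[of i] that
    by (intro borel_measurable_diff indep_std_BMsD(2)[OF BM]) auto
  define E where "E i a = {\<omega> \<in> space M. cutoff i < \<bar>inc i (fst a) (snd a) \<omega>\<bar>}" for i a
  define A where "A i = (\<Union>a\<in>{..<grid (mesh i) T} \<times> {1..n}. E i a)" for i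
  have E: "E i a \<in> sets M" if "snd a \<in> {1..n}" for i a
    unfolding E_def using that by measurable
  have A: "A i \<in> sets M" for i
    unfolding A_def by (intro sets.finite_UN E) auto
  have mE: "measure M (E i a) \<le> 945 * mesh i ^ 5 / cutoff i ^ 10" if "snd a \<in> {1..n}" for i a
  proof -
    have "measure M (E i a) = measure (distr M borel (inc i (fst a) (snd a))) {u. cutoff i < \<bar>u\<bar>}"
      using that by (subst measure_distr) (auto simp: E_def intro!: arg_cong[where f = "measure M"])
    also have "distr M borel (inc i (fst a) (snd a)) = gauss (mesh i)"
      unfolding inc_def using indep_std_BMsD(5)[OF BM mesh_pos that] by simp
    finally show ?thesis using gauss_tail[OF mesh_pos cutoff_pos] by simp
  qed
  have mA: "measure M (A i) \<le> 945 * T * n * (1 / 4) ^ (i + 2)" for i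
  proof -
    have "measure M (A i) \<le> (\<Sum>a\<in>{..<grid (mesh i) T} \<times> {1..n}. measure M (E i a))"
      unfolding A_def by (rule finite_measure_subadditive_finite) (auto intro!: E)
    also have "\<dots> \<le> (\<Sum>a\<in>{..<grid (mesh i) T} \<times> {1..n}. 945 * mesh i ^ 5 / cutoff i ^ 10)"
      by (intro sum_mono mE) auto
    also have "\<dots> = 945 * (real (grid (mesh i) T) * mesh i) * n * (mesh i ^ 4 / cutoff i ^ 10)"
      by (simp add: power_Suc[symmetric] mult_ac numeral_eq_Suc)
    also have "\<dots> \<le> 945 * T * n * (mesh i ^ 4 / cutoff i ^ 10)"
      using grid_bounds(1)[OF mesh_pos T, of i] mesh_pos[of i] cutoff_pos[of i]
      by (intro mult_right_mono mult_left_mono) auto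
    finally show ?thesis by (simp only: mesh_cutoff_tail)
  qed
  have "AE \<omega> in M. \<forall>\<^sub>F i in sequentially. \<omega> \<in> space M - A i"
  proof (rule borel_cantelli_AE1)
    show "emeasure M (A i) < \<infinity>" for i by (simp add: emeasure_eq_measure)
    have "summable (\<lambda>i. 945 * T * n * ((1 / 4) ^ i * (1 / 4)\<^sup>2))"
      by (intro summable_mult summable_mult2 summable_geometric) simp
    then have "summable (\<lambda>i. 945 * T * n * (1 / 4) ^ (i + 2))" by (simp only: power_add)
    then show "summable (\<lambda>i. measure M (A i))"
      by (rule summable_comparison_test'[where N = 0]) (use mA in simp)
  qed (rule A)
  then show ?thesis
  proof (rule AE_mp, intro AE_I2 impI)
    fix \<omega> assume "\<omega> \<in> space M" and ev: "\<forall>\<^sub>F i in sequentially. \<omega> \<in> space M - A i"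
    from ev show "\<forall>\<^sub>F i in sequentially. \<forall>k<grid (mesh i) T. \<forall>j\<in>{1..n}.
        \<bar>B j (real (Suc k) * mesh i) \<omega> - B j (real k * mesh i) \<omega>\<bar> \<le> cutoff i"
    proof eventually_elim
      case (elim i)
      then show ?case by (force simp: A_def E_def inc_def not_less)
    qed
  qed
qed

lemma phi_tendsto:
  assumes \<delta>: "0 \<le> \<delta>" "\<delta> \<le> 1" and x: "\<And>j. j \<in> {1..n} \<Longrightarrow> (\<lambda>i. x i j) \<longlonglongrightarrow> y j"
  shows "(\<lambda>i. phi \<delta> \<tau> n m (x i) w) \<longlonglongrightarrow> phi \<delta> \<tau> n m y w"
proof (rule Lim_null[THEN iffD2], rule Lim_null_comparison)
  show "\<forall>\<^sub>F i in sequentially. norm (phi \<delta> \<tau> n m (x i) w - phi \<delta> \<tau> n m y w) \<le> real m * (\<Sum>j\<in>{1..n}. \<bar>x i j - y j\<bar>)"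
    using phi_Lipschitz[of \<tau> \<delta> n m _ w] tau \<delta> by (intro always_eventually) auto
  have "(\<lambda>i. real m * (\<Sum>j\<in>{1..n}. \<bar>x i j - y j\<bar>)) \<longlonglongrightarrow> real m * (\<Sum>j\<in>{1..n}. \<bar>y j - y j\<bar>)"
    by (intro tendsto_intros x)
  then show "(\<lambda>i. real m * (\<Sum>j\<in>{1..n}. \<bar>x i j - y j\<bar>)) \<longlonglongrightarrow> 0" by simp
qed

definition BM_chain :: "nat \<Rightarrow> (nat \<Rightarrow> real) \<Rightarrow> (nat \<Rightarrow> real \<Rightarrow> 'a \<Rightarrow> real) \<Rightarrow> nat \<Rightarrow> nat \<Rightarrow> 'a \<Rightarrow> nat \<Rightarrow> real" where
  "BM_chain n x0 B i k \<omega> = chain n (cutoff i) x0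
     (\<lambda>k j. B j (real (Suc k) * mesh i) \<omega> - B j (real k * mesh i) \<omega>) k"

lemma BM_chain_walk:
  assumes "indep_std_BMs M {1..n} B" "1 \<le> n" "weyl_minus n x0"
  shows "reflected_walk p q M n (mesh i) (cutoff i) x0 (BM_chain n x0 B i)"
  unfolding BM_chain_def
  by (rule BM_chain_reflected_walk[OF assms(1,2) mesh_pos cutoff_pos mesh_cutoff assms(3)])

end

section \<open>The limit process along its own Brownian paths\<close>

locale BMPI = oblique p q + prob_space M
  for p q :: real and M :: "'a measure" +
  fixes n :: nat and x0 :: "nat \<Rightarrow> real" and B X L :: "nat \<Rightarrow> real \<Rightarrow> 'a \<Rightarrow> real"
  assumes n_pos: "1 \<le> n" and x0: "weyl_minus n x0" and BM: "indep_std_BMs M {1..n} B"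
    and measurable_X: "\<And>j s. j \<in> {1..n} \<Longrightarrow> 0 \<le> s \<Longrightarrow> X j s \<in> borel_measurable M"
    and SDE: "AE \<omega> in M. BMPI_down p q n x0 B X L \<omega>"
begin

lemma continuous_paths:
  "AE \<omega> in M. \<forall>j\<in>{1..n}. continuous_on {0..} (\<lambda>s. X j s \<omega>)"
  using SDE indep_std_BMsD(3)[OF BM]
proof eventually_elim
  case (elim \<omega>)
  have eq: "\<forall>j\<in>{1..n}. \<forall>t\<ge>0. X j t \<omega> = x0 j + B j t \<omega>
        + p * (if j < n then L j t \<omega> else 0) - q * (if 1 < j then L (j - 1) t \<omega> else 0)"
    and ct: "\<forall>j\<in>{1..<n}. collision_local_time (\<lambda>t. L j t \<omega>) (\<lambda>t. X j t \<omega> - X (Suc j) t \<omega>)"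
    using elim(1) unfolding BMPI_down_def by blast+
  show ?case
  proof (intro ballI)
    fix j assume j: "j \<in> {1..n}"
    show "continuous_on {0..} (\<lambda>s. X j s \<omega>)"
      by (rule BMPI_down_skorokhod(3)[where b = "\<lambda>j t. B j t \<omega>" and x = "\<lambda>j t. X j t \<omega>", OF eq ct _ j])
        (use elim(2) in blast)
  qed
qed

lemma measurable_phi_X: "0 \<le> s \<Longrightarrow> (\<lambda>\<omega>. phi \<delta> \<tau> n m (\<lambda>j. X j s \<omega>) w) \<in> borel_measurable M"
  by (intro measurable_phi measurable_X) auto

lemma measurable_phi_chain: "(\<lambda>\<omega>. phi \<delta> \<tau> n m (BM_chain n x0 B i k \<omega>) w) \<in> borel_measurable M"
proof -
  interpret W: reflected_walk p q M n "mesh i" "cutoff i" x0 "BM_chain n x0 B i"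
    by (rule BM_chain_walk[OF BM n_pos x0])
  show ?thesis by (intro measurable_phi W.measurable_X_coord) auto
qed

lemma phi_abs: "0 \<le> \<delta> \<Longrightarrow> norm (phi \<delta> \<tau> n m x w) \<le> (\<integral>c. tent \<delta> c \<partial>lborel)"
  using phi_bounds[of \<tau> \<delta> n m x w] tau by simp

text \<open>The walk is driven by the same Brownian path as the process, so the convergence is
  almost sure, and the mass of the tent dominates \<open>phi\<close>.\<close>

lemma expectation_chain_tendsto:
  assumes \<delta>: "0 \<le> \<delta>" "\<delta> \<le> 1" and s: "0 \<le> s"
  shows "(\<lambda>i. \<integral>\<omega>. phi \<delta> \<tau> n m (BM_chain n x0 B i (grid (mesh i) s) \<omega>) w \<partial>M)
    \<longlonglongrightarrow> (\<integral>\<omega>. phi \<delta> \<tau> n m (\<lambda>j. X j s \<omega>) w \<partial>M)"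
proof (rule integral_dominated_convergence[where w = "\<lambda>_. \<integral>c. tent \<delta> c \<partial>lborel"])
  show "AE \<omega> in M. (\<lambda>i. phi \<delta> \<tau> n m (BM_chain n x0 B i (grid (mesh i) s) \<omega>) w)
      \<longlonglongrightarrow> phi \<delta> \<tau> n m (\<lambda>j. X j s \<omega>) w"
    using SDE indep_std_BMsD(3)[OF BM] BM_increments_small[OF BM s]
  proof eventually_elim
    case (elim \<omega>)
    show ?case
    proof (rule phi_tendsto[OF \<delta>])
      fix j assume j: "j \<in> {1..n}"
      show "(\<lambda>i. BM_chain n x0 B i (grid (mesh i) s) \<omega> j) \<longlonglongrightarrow> X j s \<omega>"
        unfolding BM_chain_def
      proof (rule chain_tendsto[where b = "\<lambda>j t. B j t \<omega>" and x = "\<lambda>j t. X j t \<omega>"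
            and l = "\<lambda>j t. L j t \<omega>" and T = s])
        show "\<forall>j\<in>{1..n}. \<forall>t\<ge>0. X j t \<omega> = x0 j + B j t \<omega>
            + p * (if j < n then L j t \<omega> else 0) - q * (if 1 < j then L (j - 1) t \<omega> else 0)"
          "\<forall>j\<in>{1..<n}. collision_local_time (\<lambda>t. L j t \<omega>) (\<lambda>t. X j t \<omega> - X (Suc j) t \<omega>)"
          using elim(1) unfolding BMPI_down_def by blast+
      qed (use elim(2,3) x0 mesh_pos mesh_tendsto s j in auto)
    qed
  qed
qed (use \<delta> s phi_abs measurable_phi_X measurable_phi_chain in auto)

lemma continuous_expectation:
  assumes \<delta>: "0 \<le> \<delta>" "\<delta> \<le> 1"
  shows "continuous_on {0..} (\<lambda>s. \<integral>\<omega>. phi \<delta> \<tau> n m (\<lambda>j. X j s \<omega>) w \<partial>M)"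
  unfolding continuous_on_sequentially o_def
proof (intro allI ballI impI, elim conjE)
  fix u :: "nat \<Rightarrow> real" and s :: real
  assume u: "\<forall>i. u i \<in> {0..}" "u \<longlonglongrightarrow> s" and s: "s \<in> {0..}"
  show "(\<lambda>i. \<integral>\<omega>. phi \<delta> \<tau> n m (\<lambda>j. X j (u i) \<omega>) w \<partial>M) \<longlonglongrightarrow> (\<integral>\<omega>. phi \<delta> \<tau> n m (\<lambda>j. X j s \<omega>) w \<partial>M)"
  proof (rule integral_dominated_convergence[where w = "\<lambda>_. \<integral>c. tent \<delta> c \<partial>lborel"])
    show "AE \<omega> in M. (\<lambda>i. phi \<delta> \<tau> n m (\<lambda>j. X j (u i) \<omega>) w) \<longlonglongrightarrow> phi \<delta> \<tau> n m (\<lambda>j. X j s \<omega>) w"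
      using continuous_paths
    proof eventually_elim
      case (elim \<omega>)
      show ?case
      proof (rule phi_tendsto[OF \<delta>])
        fix j assume "j \<in> {1..n}"
        then have "continuous_on {0..} (\<lambda>s. X j s \<omega>)" using elim by blast
        then show "(\<lambda>i. X j (u i) \<omega>) \<longlonglongrightarrow> X j s \<omega>"
          using u s unfolding continuous_on_sequentially o_def by blast
      qed
    qed
  qed (use \<delta> s u phi_abs measurable_phi_X in auto)
qed

end

section \<open>Duality in the limit\<close>

text \<open>The substitution c = \<delta> u gives one factor \<delta> from the measure and another
  from the homogeneity of the tent.\<close>

lemma phi_rescale:
  assumes "0 < \<delta>"
  shows "phi \<delta> \<tau> n m x w / \<delta>\<^sup>2 = (\<integral>u. tent 1 u * G \<tau> n m (\<delta> * u) x w \<partial>lborel)"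
proof -
  have "tent \<delta> (\<delta> * u) = \<delta> * tent 1 u" for u
  proof -
    have "\<bar>\<delta> * (u - 1)\<bar> = \<delta> * \<bar>u - 1\<bar>" using assms by (simp add: abs_mult)
    then have "\<bar>\<delta> * u - \<delta>\<bar> = \<delta> * \<bar>u - 1\<bar>" by (simp add: right_diff_distrib)
    then show ?thesis using assms by (simp add: tent_def max_mult_distrib_left right_diff_distrib)
  qed
  moreover have "phi \<delta> \<tau> n m x w = \<delta> * (\<integral>u. tent \<delta> (\<delta> * u) * G \<tau> n m (\<delta> * u) x w \<partial>lborel)"
    unfolding phi_def using assms by (subst lborel_integral_real_affine[where c = \<delta> and t = 0]) auto
  ultimately show ?thesis using assms by (simp add: mult.assoc power2_eq_square)
qed

lemma tent_mass_pos: "0 < (\<integral>u. tent 1 u \<partial>lborel)"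
proof -
  have "(\<integral>u. 1 / 2 * indicator {1 / 2..3 / 2 :: real} u \<partial>lborel) \<le> (\<integral>u. tent 1 u \<partial>lborel)"
  proof (rule integral_mono)
    show "integrable lborel (tent 1)" using integrable_tent_mult[of "\<lambda>_. 1" 1] by simp
    show "1 / 2 * indicator {1 / 2..3 / 2 :: real} u \<le> tent 1 u" for u
      by (auto simp: tent_def indicator_def abs_if max_def)
  qed simp
  then show ?thesis by simp
qed

lemma G_tendsto_0:
  assumes "0 \<le> u"
  shows "(\<lambda>i. G \<tau> n m (1 / Suc i * u) x w) \<longlonglongrightarrow> G \<tau> n m 0 x w"
proof -
  have lim: "(\<lambda>i. 1 / Suc i * u) \<longlonglongrightarrow> 0"
    using tendsto_mult_right[OF LIMSEQ_Suc[OF lim_1_over_n], of u] by simp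
  have "(\<lambda>i. \<tau> ^ theta (v - 1 / Suc i * u)) \<longlonglongrightarrow> \<tau> ^ theta (v - 0)" for v :: real
  proof (rule tendsto_eventually)
    show "\<forall>\<^sub>F i in sequentially. \<tau> ^ theta (v - 1 / Suc i * u) = \<tau> ^ theta (v - 0)"
    proof (cases "0 < v")
      case True
      have "\<forall>\<^sub>F i in sequentially. 1 / Suc i * u < v" by (rule order_tendstoD(2)[OF lim True])
      then show ?thesis
      proof eventually_elim
        case (elim i)
        then show ?case using True by (simp add: theta_def)
      qed
    next
      case False
      \<comment> \<open>A value v <= 0, in particular a tie v = 0, is sure to stay nonpositive
        because the level approaches 0 from the right.\<close>
      have "0 \<le> 1 / Suc i * u" for i using assms by simp
      then have "\<not> 0 < v - 1 / Suc i * u" for i using False by (smt (verit))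
      then show ?thesis using False by (simp add: theta_def)
    qed
  qed
  then show ?thesis unfolding G_def by (intro tendsto_prod)
qed

lemma phi_rescaled_tendsto:
  assumes \<tau>: "0 \<le> \<tau>" "\<tau> \<le> 1"
  shows "(\<lambda>i. phi (1 / Suc i) \<tau> n m x w / (1 / Suc i)\<^sup>2) \<longlonglongrightarrow> G \<tau> n m 0 x w * (\<integral>u. tent 1 u \<partial>lborel)"
proof -
  have "(\<lambda>i. \<integral>u. tent 1 u * G \<tau> n m (1 / Suc i * u) x w \<partial>lborel) \<longlonglongrightarrow> (\<integral>u. tent 1 u * G \<tau> n m 0 x w \<partial>lborel)"
  proof (rule integral_dominated_convergence[where w = "tent 1"])
    show "integrable lborel (tent 1)" using integrable_tent_mult[of "\<lambda>_. 1" 1] by simp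
    have "(\<lambda>i. tent 1 u * G \<tau> n m (1 / Suc i * u) x w) \<longlonglongrightarrow> tent 1 u * G \<tau> n m 0 x w" for u
    proof (cases "0 \<le> u")
      case True
      then show ?thesis by (intro tendsto_mult_left G_tendsto_0)
    qed (simp add: tent_eq_0)
    then show "AE u in lborel. (\<lambda>i. tent 1 u * G \<tau> n m (1 / Suc i * u) x w) \<longlonglongrightarrow> tent 1 u * G \<tau> n m 0 x w"
      by simp
    have "\<bar>tent 1 u * G \<tau> n m c x w\<bar> \<le> tent 1 u" for u c
      using mult_left_le[OF G_le_1[OF \<tau>, of n m c x w] tent_nonneg[of 1 u]] G_nonneg[OF \<tau>(1), of n m c x w] tent_nonneg[of 1 u]
      by (simp add: abs_mult)
    then show "AE u in lborel. norm (tent 1 u * G \<tau> n m (1 / Suc i * u) x w) \<le> tent 1 u" for i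
      by simp
  qed measurable
  then show ?thesis
    by (subst phi_rescale) (simp_all add: mult.commute)
qed

lemma continuous_zero_of_integral_zero:
  fixes f :: "real \<Rightarrow> real"
  assumes cont: "continuous_on {0..T} f" and "0 < T" and nn: "\<And>s. 0 \<le> f s"
    and zero: "(\<integral>s. indicator {0..T} s * f s \<partial>lborel) = 0" and s: "s \<in> {0..T}"
  shows "f s = 0"
proof -
  have int: "set_integrable lborel {0..T} f" by (rule borel_integrable_atLeastAtMost'[OF cont])
  have "integral {0..T} f = (LINT s:{0..T}|lborel. f s)"
    by (rule set_borel_integral_eq_integral(2)[OF int, symmetric])
  also have "\<dots> = 0" using zero by (simp add: set_lebesgue_integral_def)
  finally show ?thesis
    using integral_eq_0_iff[OF cont \<open>0 < T\<close> nn] s by blast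
qed

text \<open>On the cell of index K the integrand has the constant value \<open>F K\<close>. The
  first cell contributes nothing since \<open>F 0 = 0\<close>, which shifts the sum into the form of
  \<open>duality_error\<close>; the last cell may reach beyond \<open>T\<close>, which only enlarges
  the bound as \<open>F\<close> is nonnegative.\<close>

lemma grid_step_le:
  fixes F :: "nat \<Rightarrow> real"
  assumes h: "0 < h" and F: "\<And>K. 0 \<le> F K" "F 0 = 0" and T: "0 \<le> T"
  shows "(\<integral>s. indicator {0..T} s * F (grid h s) \<partial>lborel) \<le> h * (\<Sum>K<grid h T. F (Suc K))"
proof -
  have i: "integrable lborel (\<lambda>s. F K * indicator {real K * h..<real (Suc K) * h} s)"
    and e: "(\<integral>s. F K * indicator {real K * h..<real (Suc K) * h} s \<partial>lborel) = h * F K" for K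
  proof -
    have "real K * h \<le> real (Suc K) * h" using h by (intro mult_right_mono) auto
    then show "integrable lborel (\<lambda>s. F K * indicator {real K * h..<real (Suc K) * h} s)"
      "(\<integral>s. F K * indicator {real K * h..<real (Suc K) * h} s \<partial>lborel) = h * F K"
      by (simp_all add: algebra_simps)
  qed
  have "(\<integral>s. indicator {0..T} s * F (grid h s) \<partial>lborel)
      \<le> (\<integral>s. (\<Sum>K<Suc (grid h T). F K * indicator {real K * h..<real (Suc K) * h} s) \<partial>lborel)"
  proof (rule Bochner_Integration.integral_mono')
    show "integrable lborel (\<lambda>s. \<Sum>K<Suc (grid h T). F K * indicator {real K * h..<real (Suc K) * h} s)"
      by (intro Bochner_Integration.integrable_sum i)
    fix s
    show nn: "0 \<le> (\<Sum>K<Suc (grid h T). F K * indicator {real K * h..<real (Suc K) * h} s)"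
      using F by (intro sum_nonneg) auto
    show "indicator {0..T} s * F (grid h s) \<le> (\<Sum>K<Suc (grid h T). F K * indicator {real K * h..<real (Suc K) * h} s)"
    proof (cases "s \<in> {0..T}")
      case True
      have "s \<in> {real (grid h s) * h..<real (Suc (grid h s)) * h}"
        using grid_bounds[OF h, of s] True by (auto simp: algebra_simps)
      then have "indicator {0..T} s * F (grid h s) = F (grid h s) * indicator {real (grid h s) * h..<real (Suc (grid h s)) * h} s"
        using True by simp
      also have "\<dots> \<le> (\<Sum>K<Suc (grid h T). F K * indicator {real K * h..<real (Suc K) * h} s)"
        using F grid_mono[OF h, of s T] True
        by (intro member_le_sum[of "grid h s" _ "\<lambda>K. F K * indicator {real K * h..<real (Suc K) * h} s"]) auto
      finally show ?thesis .
    qed (use nn in simp)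
  qed
  also have "\<dots> = (\<Sum>K<Suc (grid h T). h * F K)"
    by (simp only: Bochner_Integration.integral_sum i e)
  also have "\<dots> = h * (\<Sum>K<grid h T. F (Suc K))"
    unfolding sum.lessThan_Suc_shift by (simp add: F(2) sum_distrib_left)
  finally show ?thesis .
qed

locale dual_pair = X: BMPI p q M n x0 BX X LX + W: BMPI p q N m w0 BW W LW
  for p q :: real and M :: "'a measure" and n x0 BX X LX and N :: "'b measure" and m w0 BW W LW
begin

abbreviation \<tau> :: real where "\<tau> \<equiv> p / q"

text \<open>Naming \<open>two_walks.total_const\<close> with explicit parameters shows that the
  constant does not depend on \<open>i\<close>; the remaining factor is
  \<open>mesh_cutoff_cube\<close>. Two separate \<open>BM_chain\<close> walks with the same mesh and
  cutoff instantiate \<open>two_walks\<close>.\<close>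

lemma chain_duality_error:
  assumes \<delta>: "0 \<le> \<delta>" "\<delta> \<le> 1" and T: "0 \<le> T"
  defines "F \<equiv> \<lambda>i K. \<bar>(\<integral>\<omega>. phi \<delta> \<tau> n m (X.BM_chain n x0 BX i K \<omega>) w0 \<partial>M)
    - (\<integral>\<omega>. phi \<delta> \<tau> n m x0 (X.BM_chain m w0 BW i K \<omega>) \<partial>N)\<bar>"
  shows "mesh i * (\<Sum>K<grid (mesh i) T. F i (Suc K))
      \<le> two_walks.total_const p q n x0 m w0 T * (1 / 2) ^ (i + 2)"
    and "F i 0 = 0"
proof -
  interpret A: two_walks p q M n "mesh i" "cutoff i" x0 "X.BM_chain n x0 BX i" N m w0 "X.BM_chain m w0 BW i" \<delta>
    using X.BM_chain_walk[OF X.BM X.n_pos X.x0, of i] X.BM_chain_walk[OF W.BM W.n_pos W.x0, of i] \<delta>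
    by (simp add: two_walks_def two_walks_axioms_def)
  have F: "F i K = \<bar>A.A K 0 - A.A 0 K\<bar>" for K
    unfolding F_def A.A_left A.A_right ..
  show "F i 0 = 0" by (simp add: F)
  show "mesh i * (\<Sum>K<grid (mesh i) T. F i (Suc K))
      \<le> two_walks.total_const p q n x0 m w0 T * (1 / 2) ^ (i + 2)"
    using A.duality_error[OF grid_bounds(1)[OF mesh_pos T]]
    unfolding F mesh_cutoff_cube[symmetric] by simp
qed

lemma phi_duality:
  assumes \<delta>: "0 \<le> \<delta>" "\<delta> \<le> 1" and t: "0 \<le> t"
  shows "(\<integral>\<omega>. phi \<delta> \<tau> n m (\<lambda>j. X j t \<omega>) w0 \<partial>M) = (\<integral>\<omega>. phi \<delta> \<tau> n m x0 (\<lambda>i. W i t \<omega>) \<partial>N)"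
proof -
  \<comment> \<open>One unit beyond \<open>t\<close>, so that the interval is nondegenerate even for
    t = 0.\<close>
  define T where "T = t + 1"
  have T: "0 < T" "t \<in> {0..T}" using t by (auto simp: T_def)
  define a where "a s = (\<integral>\<omega>. phi \<delta> \<tau> n m (\<lambda>j. X j s \<omega>) w0 \<partial>M)" for s
  define b where "b s = (\<integral>\<omega>. phi \<delta> \<tau> n m x0 (\<lambda>i. W i s \<omega>) \<partial>N)" for s
  define F where "F i K = \<bar>(\<integral>\<omega>. phi \<delta> \<tau> n m (X.BM_chain n x0 BX i K \<omega>) w0 \<partial>M)
    - (\<integral>\<omega>. phi \<delta> \<tau> n m x0 (X.BM_chain m w0 BW i K \<omega>) \<partial>N)\<bar>" for i K
  define f where "f s = \<bar>a s - b s\<bar>" for s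
  define C where "C = two_walks.total_const p q n x0 m w0 T"
  define \<Phi> where "\<Phi> = (\<integral>c. tent \<delta> c \<partial>lborel)"
  have F_small: "mesh i * (\<Sum>K<grid (mesh i) T. F i (Suc K)) \<le> C * (1 / 2) ^ (i + 2)"
    and F0: "F i 0 = 0" for i
    unfolding F_def C_def using chain_duality_error[OF \<delta> less_imp_le[OF T(1)], of i] by auto
  have cont: "continuous_on {0..} f"
    unfolding f_def a_def b_def phi_swap[of \<delta> \<tau> n m x0]
    by (intro continuous_intros X.continuous_expectation W.continuous_expectation \<delta>)
  have lim: "(\<lambda>i. F i (grid (mesh i) s)) \<longlonglongrightarrow> f s" if "0 \<le> s" for s
    unfolding f_def a_def b_def F_def phi_swap[of \<delta> \<tau> n m x0]
    by (intro tendsto_intros X.expectation_chain_tendsto W.expectation_chain_tendsto \<delta> that)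
  have F_bound: "0 \<le> F i K" "F i K \<le> 2 * \<Phi>" for i K
  proof -
    have ph: "\<bar>phi \<delta> \<tau> n m x w\<bar> \<le> \<Phi>" for x w
      using phi_bounds[of \<tau> \<delta> n m x w] X.tau \<delta> by (simp add: \<Phi>_def)
    have "\<bar>\<integral>\<omega>. phi \<delta> \<tau> n m (X.BM_chain n x0 BX i K \<omega>) w0 \<partial>M\<bar> \<le> \<Phi>"
      "\<bar>\<integral>\<omega>. phi \<delta> \<tau> n m x0 (X.BM_chain m w0 BW i K \<omega>) \<partial>N\<bar> \<le> \<Phi>"
      by (rule integral_prob_abs_le X.prob_space_axioms W.prob_space_axioms ph)+
    then show "F i K \<le> 2 * \<Phi>" unfolding F_def by linarith
    show "0 \<le> F i K" by (simp add: F_def)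
  qed
  \<comment> \<open>These averages over \<open>{0..T}\<close> tend to the integral of
    \<open>f\<close> by dominated convergence and to 0 by the error bound. As \<open>f\<close> is
    continuous and nonnegative, it vanishes at the single time \<open>t\<close>.\<close>
  have "(\<lambda>i. \<integral>s. indicator {0..T} s * F i (grid (mesh i) s) \<partial>lborel) \<longlonglongrightarrow> (\<integral>s. indicator {0..T} s * f s \<partial>lborel)"
  proof (rule integral_dominated_convergence[where w = "\<lambda>s. indicator {0..T} s * (2 * \<Phi>)"])
    show "integrable lborel (\<lambda>s. indicator {0..T} s * (2 * \<Phi>))" using T by simp
    have "(\<lambda>s. indicator {0..T} s *\<^sub>R f s) \<in> borel_measurable borel"
      by (rule borel_measurable_continuous_on_indicator[OF _ continuous_on_subset[OF cont]]) auto
    then show "(\<lambda>s. indicator {0..T} s * f s) \<in> borel_measurable lborel" by simp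
    have [measurable]: "grid (mesh i) \<in> borel \<rightarrow>\<^sub>M count_space UNIV" for i
      unfolding grid_def by measurable
    show "(\<lambda>s. indicator {0..T} s * F i (grid (mesh i) s)) \<in> borel_measurable lborel" for i
      by measurable
    show "AE s in lborel. (\<lambda>i. indicator {0..T} s * F i (grid (mesh i) s)) \<longlonglongrightarrow> indicator {0..T} s * f s"
      using lim by (intro AE_I2) (auto simp: indicator_def)
    show "AE s in lborel. norm (indicator {0..T} s * F i (grid (mesh i) s)) \<le> indicator {0..T} s * (2 * \<Phi>)" for i
      using F_bound by (intro AE_I2) (auto simp: indicator_def)
  qed
  moreover have "(\<lambda>i. \<integral>s. indicator {0..T} s * F i (grid (mesh i) s) \<partial>lborel) \<longlonglongrightarrow> 0"
  proof (rule tendsto_sandwich)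
    show "\<forall>\<^sub>F i in sequentially. 0 \<le> (\<integral>s. indicator {0..T} s * F i (grid (mesh i) s) \<partial>lborel)"
      using F_bound by (intro always_eventually allI Bochner_Integration.integral_nonneg) simp
    show "\<forall>\<^sub>F i in sequentially. (\<integral>s. indicator {0..T} s * F i (grid (mesh i) s) \<partial>lborel) \<le> C * (1 / 2) ^ (i + 2)"
    proof (intro always_eventually allI)
      fix i
      show "(\<integral>s. indicator {0..T} s * F i (grid (mesh i) s) \<partial>lborel) \<le> C * (1 / 2) ^ (i + 2)"
        using grid_step_le[where F = "F i", OF mesh_pos F_bound(1) F0 less_imp_le[OF T(1)]] F_small[of i]
        by (rule order_trans)
    qed
    have "(\<lambda>i. C * (1 / 2) ^ (i + 2)) \<longlonglongrightarrow> C * 0"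
      by (intro tendsto_mult_left LIMSEQ_ignore_initial_segment LIMSEQ_realpow_zero) auto
    then show "(\<lambda>i. C * (1 / 2) ^ (i + 2)) \<longlonglongrightarrow> 0" by simp
  qed simp
  ultimately have zero: "(\<integral>s. indicator {0..T} s * f s \<partial>lborel) = 0"
    by (rule LIMSEQ_unique)
  have "f t = 0"
    by (rule continuous_zero_of_integral_zero[OF continuous_on_subset[OF cont] T(1) _ zero T(2)]) (auto simp: f_def)
  then show ?thesis by (simp add: f_def a_def b_def)
qed

text \<open>After division by \<delta>^2 the tents all have the same mass \<open>c\<close>, which
  bounds the integrands and appears as a common nonzero factor of both limits.\<close>

lemma G_duality:
  assumes t: "0 \<le> t"
  shows "(\<integral>\<omega>. G \<tau> n m 0 (\<lambda>j. X j t \<omega>) w0 \<partial>M) = (\<integral>\<omega>. G \<tau> n m 0 x0 (\<lambda>i. W i t \<omega>) \<partial>N)"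
proof -
  define c where "c = (\<integral>u. tent 1 u \<partial>lborel)"
  define \<delta> :: "nat \<Rightarrow> real" where "\<delta> i = 1 / Suc i" for i
  have \<tau>: "0 \<le> \<tau>" "\<tau> \<le> 1" using X.tau by auto
  have \<delta>: "0 < \<delta> i" "0 \<le> \<delta> i" "\<delta> i \<le> 1" for i by (auto simp: \<delta>_def)
  have bound: "\<bar>phi (\<delta> i) \<tau> n m x w / (\<delta> i)\<^sup>2\<bar> \<le> c" for i x w
    unfolding phi_rescale[OF \<delta>(1)] c_def
  proof (rule order_trans[OF integral_abs_bound], rule integral_mono')
    show "integrable lborel (tent 1)" using integrable_tent_mult[of "\<lambda>_. 1" 1] by simp
    show "\<bar>tent 1 u * G \<tau> n m (\<delta> i * u) x w\<bar> \<le> tent 1 u" for u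
      using mult_left_le[OF G_le_1[OF \<tau>, of n m _ x w] tent_nonneg[of 1 u]] G_nonneg[OF \<tau>(1), of n m _ x w] tent_nonneg[of 1 u]
      by (simp add: abs_mult)
  qed (rule tent_nonneg)
  have lim_X: "(\<lambda>i. \<integral>\<omega>. phi (\<delta> i) \<tau> n m (\<lambda>j. X j t \<omega>) w0 / (\<delta> i)\<^sup>2 \<partial>M)
      \<longlonglongrightarrow> (\<integral>\<omega>. G \<tau> n m 0 (\<lambda>j. X j t \<omega>) w0 * c \<partial>M)"
  proof (rule integral_dominated_convergence[where w = "\<lambda>_. c"])
    show "AE \<omega> in M. (\<lambda>i. phi (\<delta> i) \<tau> n m (\<lambda>j. X j t \<omega>) w0 / (\<delta> i)\<^sup>2) \<longlonglongrightarrow> G \<tau> n m 0 (\<lambda>j. X j t \<omega>) w0 * c"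
      unfolding \<delta>_def c_def by (intro AE_I2 phi_rescaled_tendsto \<tau>)
    show "(\<lambda>\<omega>. G \<tau> n m 0 (\<lambda>j. X j t \<omega>) w0 * c) \<in> borel_measurable M"
      by (intro borel_measurable_times measurable_G X.measurable_X t) auto
    show "(\<lambda>\<omega>. phi (\<delta> i) \<tau> n m (\<lambda>j. X j t \<omega>) w0 / (\<delta> i)\<^sup>2) \<in> borel_measurable M" for i
      by (intro borel_measurable_divide X.measurable_phi_X t) auto
  qed (use bound in auto)
  have lim_W: "(\<lambda>i. \<integral>\<omega>. phi (\<delta> i) \<tau> n m x0 (\<lambda>j. W j t \<omega>) / (\<delta> i)\<^sup>2 \<partial>N)
      \<longlonglongrightarrow> (\<integral>\<omega>. G \<tau> n m 0 x0 (\<lambda>j. W j t \<omega>) * c \<partial>N)"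
  proof (rule integral_dominated_convergence[where w = "\<lambda>_. c"])
    show "AE \<omega> in N. (\<lambda>i. phi (\<delta> i) \<tau> n m x0 (\<lambda>j. W j t \<omega>) / (\<delta> i)\<^sup>2) \<longlonglongrightarrow> G \<tau> n m 0 x0 (\<lambda>j. W j t \<omega>) * c"
      unfolding \<delta>_def c_def by (intro AE_I2 phi_rescaled_tendsto \<tau>)
    show "(\<lambda>\<omega>. G \<tau> n m 0 x0 (\<lambda>j. W j t \<omega>) * c) \<in> borel_measurable N"
      by (intro borel_measurable_times measurable_G W.measurable_X t) auto
    show "(\<lambda>\<omega>. phi (\<delta> i) \<tau> n m x0 (\<lambda>j. W j t \<omega>) / (\<delta> i)\<^sup>2) \<in> borel_measurable N" for i
      unfolding phi_swap[of _ \<tau> n m x0] by (intro borel_measurable_divide W.measurable_phi_X t) auto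
  qed (use bound in auto)
  have eq: "(\<integral>\<omega>. phi (\<delta> i) \<tau> n m (\<lambda>j. X j t \<omega>) w0 / (\<delta> i)\<^sup>2 \<partial>M)
      = (\<integral>\<omega>. phi (\<delta> i) \<tau> n m x0 (\<lambda>j. W j t \<omega>) / (\<delta> i)\<^sup>2 \<partial>N)" for i
    using phi_duality[OF \<delta>(2,3) t, of i] by simp
  have prod_eq: "(\<integral>\<omega>. G \<tau> n m 0 (\<lambda>j. X j t \<omega>) w0 * c \<partial>M) = (\<integral>\<omega>. G \<tau> n m 0 x0 (\<lambda>j. W j t \<omega>) * c \<partial>N)"
    by (rule LIMSEQ_unique[OF lim_X[unfolded eq] lim_W])
  have "c \<noteq> 0" using tent_mass_pos by (simp add: c_def)
  then show ?thesis using prod_eq by simp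
qed

end

section \<open>The sign change for the second process and the conclusion\<close>

lemma indep_std_BMs_uminus:
  assumes "indep_std_BMs M J B"
  shows "indep_std_BMs M J (\<lambda>j t \<omega>. - B j t \<omega>)"
proof -
  note A = assms[unfolded indep_std_BMs_def]
  interpret prob_space M by (rule conjunct1[OF A])
  have meas: "\<forall>j\<in>J. \<forall>t\<ge>0. B j t \<in> borel_measurable M"
    and ae: "AE \<omega> in M. \<forall>j\<in>J. B j 0 \<omega> = 0 \<and> continuous_on {0..} (\<lambda>t. B j t \<omega>)"
    and all: "\<forall>(ts :: nat \<Rightarrow> real) (N :: nat). ts 0 = 0 \<and> (\<forall>k<N. ts k < ts (Suc k)) \<longrightarrow>
        prob_space.indep_vars M (\<lambda>_. borel)
          (\<lambda>(j, k) \<omega>. B j (ts (Suc k)) \<omega> - B j (ts k) \<omega>) (J \<times> {..<N}) \<and>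
        (\<forall>j\<in>J. \<forall>k<N. distributed M lborel (\<lambda>\<omega>. B j (ts (Suc k)) \<omega> - B j (ts k) \<omega>)
                        (normal_density 0 (sqrt (ts (Suc k) - ts k))))"
    by (rule conjunct1[OF conjunct2[OF A]], rule conjunct1[OF conjunct2[OF conjunct2[OF A]]],
        rule conjunct2[OF conjunct2[OF conjunct2[OF A]]])
  show ?thesis
    unfolding indep_std_BMs_def
  proof (intro conjI allI impI)
    show "prob_space M" by (rule prob_space_axioms)
    show "\<forall>j\<in>J. \<forall>t\<ge>0. (\<lambda>\<omega>. - B j t \<omega>) \<in> borel_measurable M" using meas by auto
    show "AE \<omega> in M. \<forall>j\<in>J. - B j 0 \<omega> = 0 \<and> continuous_on {0..} (\<lambda>t. - B j t \<omega>)"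
      using ae by eventually_elim (auto intro: continuous_intros)
    fix ts :: "nat \<Rightarrow> real" and N :: nat
    assume ts: "ts 0 = 0 \<and> (\<forall>k<N. ts k < ts (Suc k))"
    note * = all[THEN spec, THEN spec, THEN mp, OF ts]
    have "indep_vars (\<lambda>_. borel) (\<lambda>a \<omega>. - ((\<lambda>(j, k) \<omega>. B j (ts (Suc k)) \<omega> - B j (ts k) \<omega>) a \<omega>)) (J \<times> {..<N})"
      by (rule indep_vars_compose2[OF conjunct1[OF *], of "\<lambda>_. uminus" "\<lambda>_. borel"]) simp
    then show "indep_vars (\<lambda>_. borel) (\<lambda>(j, k) \<omega>. - B j (ts (Suc k)) \<omega> - - B j (ts k) \<omega>) (J \<times> {..<N})"
      by (simp add: case_prod_unfold)
    show "\<forall>j\<in>J. \<forall>k<N. distributed M lborel (\<lambda>\<omega>. - B j (ts (Suc k)) \<omega> - - B j (ts k) \<omega>)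
        (normal_density 0 (sqrt (ts (Suc k) - ts k)))"
    proof (intro ballI allI impI)
      fix j k assume "j \<in> J" "k < N"
      then have "distributed M lborel (\<lambda>\<omega>. 0 + - 1 * (B j (ts (Suc k)) \<omega> - B j (ts k) \<omega>))
          (normal_density (0 + - 1 * 0) (\<bar>- 1\<bar> * sqrt (ts (Suc k) - ts k)))"
        using * ts by (intro normal_density_affine) auto
      then show "distributed M lborel (\<lambda>\<omega>. - B j (ts (Suc k)) \<omega> - - B j (ts k) \<omega>)
          (normal_density 0 (sqrt (ts (Suc k) - ts k)))" by simp
    qed
  qed
qed

text \<open>Negation reverses the order of the particles together with the signs of p and q, so the
  gaps, and with them the local times, remain the same.\<close>

lemma BMPI_up_uminus:
  assumes "BMPI_up p q m y0 B Y L \<omega>"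
  shows "BMPI_down p q m (\<lambda>i. - y0 i) (\<lambda>i t \<omega>. - B i t \<omega>) (\<lambda>i t \<omega>. - Y i t \<omega>) L \<omega>"
  unfolding BMPI_down_def
proof (intro conjI ballI allI impI)
  fix j t assume "j \<in> {1..m}" "0 \<le> (t::real)"
  then have "Y j t \<omega> = y0 j + B j t \<omega> - p * (if j < m then L j t \<omega> else 0) + q * (if 1 < j then L (j - 1) t \<omega> else 0)"
    using assms unfolding BMPI_up_def by blast
  then show "- Y j t \<omega> = - y0 j + - B j t \<omega> + p * (if j < m then L j t \<omega> else 0) - q * (if 1 < j then L (j - 1) t \<omega> else 0)"
    by linarith
next
  fix j assume "j \<in> {1..<m}"
  then show "collision_local_time (\<lambda>t. L j t \<omega>) (\<lambda>t. - Y j t \<omega> - - Y (Suc j) t \<omega>)"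
    using assms unfolding BMPI_up_def by simp
qed

lemma H_eq_G: "H \<tau> n m x y = G \<tau> n m 0 x (\<lambda>i. - y i)"
  by (simp add: H_def G_def)

theorem theorem1:
  fixes p q t :: real and m n :: nat and x0 y0 :: "nat \<Rightarrow> real"
    and M :: "'a measure" and BX X LX :: "nat \<Rightarrow> real \<Rightarrow> 'a \<Rightarrow> real"
    and N :: "'b measure" and BY Y LY :: "nat \<Rightarrow> real \<Rightarrow> 'b \<Rightarrow> real"
  assumes "p \<ge> 0" "q \<ge> 0" "p + q = 1" "0 < p / q" "p / q < 1"
    and "m \<ge> 1" "n \<ge> 1"
    and "weyl_minus n x0" "weyl_plus m y0"
    and "indep_std_BMs M {1..n} BX"
    and "\<forall>j\<in>{1..n}. \<forall>s\<ge>0. X j s \<in> borel_measurable M"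
    and "AE \<omega> in M. BMPI_down p q n x0 BX X LX \<omega>"
    and "indep_std_BMs N {1..m} BY"
    and "\<forall>i\<in>{1..m}. \<forall>s\<ge>0. Y i s \<in> borel_measurable N"
    and "AE \<omega> in N. BMPI_up p q m y0 BY Y LY \<omega>"
    and "t \<ge> 0"
  shows "(\<integral>\<omega>. H (p / q) n m (\<lambda>j. X j t \<omega>) y0 \<partial>M)
       = (\<integral>\<omega>. H (p / q) n m x0 (\<lambda>i. Y i t \<omega>) \<partial>N)"
proof -
  have pq: "0 < p" "p < q" using assms(1-5) by (auto simp: zero_less_divide_iff divide_less_eq)
  interpret X: BMPI p q M n x0 BX X LX
    using pq assms by (intro BMPI.intro oblique.intro BMPI_axioms.intro) (auto simp: indep_std_BMs_def)
  interpret W: BMPI p q N m "\<lambda>i. - y0 i" "\<lambda>i t \<omega>. - BY i t \<omega>" "\<lambda>i t \<omega>. - Y i t \<omega>" LY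
  proof (intro BMPI.intro oblique.intro BMPI_axioms.intro)
    show "AE \<omega> in N. BMPI_down p q m (\<lambda>i. - y0 i) (\<lambda>i t \<omega>. - BY i t \<omega>) (\<lambda>i t \<omega>. - Y i t \<omega>) LY \<omega>"
      using assms(15) by eventually_elim (rule BMPI_up_uminus)
    show "indep_std_BMs N {1..m} (\<lambda>i t \<omega>. - BY i t \<omega>)" by (rule indep_std_BMs_uminus[OF assms(13)])
    show "prob_space N" using assms(13) by (simp add: indep_std_BMs_def)
    show "weyl_minus m (\<lambda>i. - y0 i)" using assms(9) by (simp add: weyl_plus_def weyl_minus_def)
    show "(\<lambda>\<omega>. - Y i s \<omega>) \<in> borel_measurable N" if "i \<in> {1..m}" "0 \<le> s" for i s
      using assms(14) that by simp
  qed (use pq assms(3,6) in simp_all)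
  interpret dual_pair p q M n x0 BX X LX N m "\<lambda>i. - y0 i" "\<lambda>i t \<omega>. - BY i t \<omega>" "\<lambda>i t \<omega>. - Y i t \<omega>" LY ..
  show ?thesis using G_duality[OF assms(16)] by (simp add: H_eq_G)
qed

end
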